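(* Let $m\ge 1$ be an integer, let $\xi\in\mathcal{E}_m$, and let $\underline{\xi}=(1,\xi,\xi^2)$. Then there exist constants $\rho>0$ and $c>0$ such that \[ \big\| \underline{L}_{\underline{\xi}}(\underline{q})-\rho\,\underline{P}(\rho^{-1}\underline{q}) \big\| \le c \] for each $\underline{q}\in\mathcal{A}(\epsilon)=\{(q_1,q_2)\in\mathbb{R}^2\,;\, q_1\ge 0,\ q_2\le q_1\}$.
   Context: Norms: $\|\cdot\|$ denotes the maximum norm on $\mathbb{R}^n$, and for a real matrix $A$, $\|A\|$ is the maximum of the absolute values of its entries. The set $\mathcal{E}_m$: for an integer $m\ge1$ put $M=\begin{pmatrix} m&1\\-1&0\end{pmatrix}$. A real number $\xi$ belongs to $\mathcal{E}_m$ if there exist an unbounded sequence $(W_i)_{i\ge1}$ in $\mathrm{GL}_2(\mathbb{Z})$ with $W_{i+2}=W_{i+1}W_i$ for all $i\ge1$, and a constant $c\ge1$ such that for each $i\ge1$: (E1) $W_iM_i^{-1}$ is a symmetric matrix, where $M_i=M$ if $i$ is even and $M_i={}^tM$ if $i$ is odd; (E2) $c^{-1}\|W_{i+1}\|\|W_i\|\le\|W_{i+2}\|\le c\|W_{i+1}\|\|W_i\|$; (E3) $c^{-1}\|W_i\|^{-1}\le\|(\xi,-1)W_i\|\le c\|W_i\|^{-1}$. The map $\underline{L}_{\underline{\xi}}$: for $\underline{\xi}=(1,\xi_1,\xi_2)\in\mathbb{R}^3$, $\underline{q}=(q_1,q_2)\in\mathbb{R}^2$ and $j=1,2,3$, $L_{\underline{\xi},j}(\underline{q})$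 is the smallest $t\in\mathbb{R}$ such that the inequalities $|x_0|\le e^t$, $|x_0\xi_1-x_1|\le e^{t-q_1}$, $|x_0\xi_2-x_2|\le e^{t-q_2}$ admit at least $j$ linearly independent solutions $(x_0,x_1,x_2)\in\mathbb{Z}^3$; and $\underline{L}_{\underline{\xi}}(\underline{q})=(L_{\underline{\xi},1}(\underline{q}),L_{\underline{\xi},2}(\underline{q}),L_{\underline{\xi},3}(\underline{q}))$. Words: $E=\{a,b\}$, $E^*$ the monoid of finite words under concatenation, $\epsilon$ the empty word, $|w|$ the length. $u\le w$ means $u$ is a prefix of $w$; $u<w$ means $u\le w$, $u\ne w$. Let $w_1=a$, $w_2=ab$, $w_{i+2}=w_{i+1}w_i$ ($i\ge1$), and $w_\infty=\lim w_i=abaababaab\cdots$. A prefix of $w_\infty$ is a word $v$ with $v\le w_i$ for some $i$; the set of these is $[\epsilon,w_\infty[$. Fibonacci numbers: $F_{-1}=0$, $F_0=1$, $F_{i+2}=F_{i+1}+F_i$, so $|w_i|=F_i$. Maps $\iota,\alpha$: let $\mathcal{F}=\{\epsilon,w_1,w_2,\dots\}$. For a prefix $v$ of $w_\infty$, set $\iota(v)=v$ if $v\in\mathcal{F}$; otherwise $w_i<v<w_{i+1}$ for some $i\ge3$ and $\iota(v)$ is the prefix of $w_\infty$ of length $|v|-2F_{i-2}$. Then $\alpha(v)=\lim_{k\to\infty}\iota^k(v)$ (the iterates are eventually constant, in $\mathcal{F}$). The map $\underline{P}$: for a prefix $v$ of $w_\infty$ let $P_v(q_1,q_2)=\max\{q_1-|v|,\,q_2-|\alpha(v)|,\,|v|\}$,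 and let $\mathcal{A}(v)$, resp. $\mathcal{C}(v)$, be the set of $\underline{q}\in\mathbb{R}^2$ with $P_v(\underline q)=q_1-|v|$, resp. $P_v(\underline q)=|v|$. Let $\Phi:\mathbb{R}^3\to\mathbb{R}^3$ list the coordinates in non-decreasing order. For $\underline q=(q_1,q_2)\in\mathcal{A}(\epsilon)$, define $\underline{P}(\underline q)=(P_1,P_2,P_3)(\underline q)=\Phi(q_1-|u|,\,q_2+|u|-|w|,\,|w|)$, where $u$ is the largest prefix of $w_\infty$ with $\underline q\in\mathcal{A}(u)$ and $w$ is the smallest prefix of $w_\infty$ with $u<w$ and $\underline q\in\mathcal{C}(w)$. *)

theory Defs
  imports
    "HOL-Analysis.Analysis"
    "HOL-Library.Prefix_Order"
    "HOL-Number_Theory.Fib"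
begin

text \<open>The maximum norm on \<open>\<real>\<^sup>n\<close>, and the maximum of the absolute values of the entries
  of a real matrix, are both instances of \<^const>\<open>infnorm\<close>.
  For lists, \<open>\<le>\<close> and \<open><\<close> are the prefix and strict prefix orders.\<close>

definition M_mat :: "int \<Rightarrow> int^2^2" where
  "M_mat m = vector [vector [m, 1], vector [-1, 0]]"

definition M_seq :: "int \<Rightarrow> nat \<Rightarrow> int^2^2" where
  "M_seq m i = (if even i then M_mat m else transpose (M_mat m))"

abbreviation real_mat :: "int^2^2 \<Rightarrow> real^2^2" where
  "real_mat \<equiv> map_matrix real_of_int"

text \<open>\<open>GL\<^sub>2(\<int>)\<close> is the set of invertible elements of \<^typ>\<open>int^2^2\<close>. Sequences are indexed
  by \<open>i \<ge> 1\<close>; the value \<open>W 0\<close> is irrelevant.\<close>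

definition E_set :: "int \<Rightarrow> real set" where
  "E_set m = {\<xi>. \<exists>(W :: nat \<Rightarrow> int^2^2) (c :: real).
      (\<forall>i\<ge>1. invertible (W i)) \<and>
      \<not> bounded ((\<lambda>i. real_mat (W i)) ` {1..}) \<and>
      (\<forall>i\<ge>1. W (i + 2) = W (i + 1) ** W i) \<and>
      c \<ge> 1 \<and>
      (\<forall>i\<ge>1.
        transpose (W i ** matrix_inv (M_seq m i)) = W i ** matrix_inv (M_seq m i) \<and>
        inverse c * infnorm (real_mat (W (i + 1))) * infnorm (real_mat (W i))
          \<le> infnorm (real_mat (W (i + 2))) \<and>
        infnorm (real_mat (W (i + 2)))
          \<le> c * infnorm (real_mat (W (i + 1))) * infnorm (real_mat (W i)) \<and>
        inverse c * inverse (infnorm (real_mat (W i)))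
          \<le> infnorm ((vector [\<xi>, -1] :: real^2) v* real_mat (W i)) \<and>
        infnorm ((vector [\<xi>, -1] :: real^2) v* real_mat (W i))
          \<le> c * inverse (infnorm (real_mat (W i))))}"

text \<open>Vectors \<open>(x\<^sub>0, x\<^sub>1, x\<^sub>2)\<close> are elements of \<^typ>\<open>real^3\<close>, so \<open>x\<^sub>k\<close> is \<open>x $ (k + 1)\<close>; likewise
  \<open>\<xi>\<close> stands for \<open>(1, \<xi>\<^sub>1, \<xi>\<^sub>2)\<close>, and its first coordinate is not used.\<close>

definition L_solutions :: "real^3 \<Rightarrow> real^2 \<Rightarrow> real \<Rightarrow> (real^3) set" where
  "L_solutions \<xi> q t = {x. (\<forall>k. x $ k \<in> \<int>) \<and>
      \<bar>x $ 1\<bar> \<le> exp t \<and>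
      \<bar>x $ 1 * \<xi> $ 2 - x $ 2\<bar> \<le> exp (t - q $ 1) \<and>
      \<bar>x $ 1 * \<xi> $ 3 - x $ 3\<bar> \<le> exp (t - q $ 2)}"

definition L_min :: "real^3 \<Rightarrow> nat \<Rightarrow> real^2 \<Rightarrow> real" where
  "L_min \<xi> j q = (LEAST t. \<exists>S \<subseteq> L_solutions \<xi> q t. independent S \<and> card S = j)"

definition L_map :: "real^3 \<Rightarrow> real^2 \<Rightarrow> real^3" where
  "L_map \<xi> q = vector [L_min \<xi> 1 q, L_min \<xi> 2 q, L_min \<xi> 3 q]"

datatype letter = Letter_a | Letter_b

text \<open>The value at \<open>0\<close> is the one that makes the recursion hold from the start; only the words
  \<open>w\<^sub>i\<close> with \<open>i \<ge> 1\<close> are used below.\<close>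

fun fib_word :: "nat \<Rightarrow> letter list" where
  "fib_word 0 = [Letter_b]"
| "fib_word (Suc 0) = [Letter_a]"
| "fib_word (Suc (Suc i)) = fib_word (Suc i) @ fib_word i"

text \<open>The set \<open>[\<epsilon>, w\<^sub>\<infinity>[\<close> of all prefixes of \<open>w\<^sub>\<infinity>\<close>.\<close>

definition winf_prefixes :: "letter list set" where
  "winf_prefixes = {v. \<exists>i\<ge>1. v \<le> fib_word i}"

definition Fib_words :: "letter list set" where
  "Fib_words = insert [] (fib_word ` {1..})"

text \<open>With \<open>F\<^sub>-\<^sub>1 = 0\<close> and \<open>F\<^sub>0 = 1\<close> one has \<open>F\<^sub>n = fib (n + 1)\<close>, so \<open>F\<^sub>i\<^sub>-\<^sub>2 = fib (i - 1)\<close>. As \<open>v\<close> is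
  itself a prefix of \<open>w\<^sub>\<infinity>\<close>, the prefix of \<open>w\<^sub>\<infinity>\<close> of length \<open>n \<le> |v|\<close> is \<open>take n v\<close>.\<close>

definition iota :: "letter list \<Rightarrow> letter list" where
  "iota v = (if v \<in> Fib_words then v
     else let i = (THE i. i \<ge> 3 \<and> fib_word i < v \<and> v < fib_word (i + 1))
          in take (length v - 2 * fib (i - 1)) v)"

text \<open>The limit of an eventually constant sequence of words.\<close>

definition alpha :: "letter list \<Rightarrow> letter list" where
  "alpha v = (THE u. \<forall>\<^sub>F k in sequentially. (iota ^^ k) v = u)"

definition P_word :: "letter list \<Rightarrow> real^2 \<Rightarrow> real" where
  "P_word v q =
     Max {q $ 1 - real (length v), q $ 2 - real (length (alpha v)), real (length v)}"

definition A_set :: "letter list \<Rightarrow> (real^2) set" where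
  "A_set v = {q. P_word v q = q $ 1 - real (length v)}"

definition C_set :: "letter list \<Rightarrow> (real^2) set" where
  "C_set v = {q. P_word v q = real (length v)}"

definition Phi :: "real^3 \<Rightarrow> real^3" where
  "Phi x = vector (sort [x $ 1, x $ 2, x $ 3])"

text \<open>Only meaningful for \<open>q\<close> in \<open>A_set []\<close>, where both words exist.\<close>

definition P_map :: "real^2 \<Rightarrow> real^3" where
  "P_map q =
     (let u = (GREATEST u. u \<in> winf_prefixes \<and> q \<in> A_set u);
          w = (LEAST w. w \<in> winf_prefixes \<and> u < w \<and> q \<in> C_set w)
      in Phi (vector [q $ 1 - real (length u),
                      q $ 2 + real (length u) - real (length w),
                      real (length w)]))"

lemma alpha_Nil: "alpha [] = []"
proof -
  have "(iota ^^ k) [] = []" for k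
    by (induction k) (simp_all add: iota_def Fib_words_def)
  then show ?thesis
    by (simp add: alpha_def)
qed

lemma A_set_Nil: "A_set [] = {q. 0 \<le> q $ 1 \<and> q $ 2 \<le> q $ 1}"
  by (auto simp: A_set_def P_word_def alpha_Nil max_def)

end

theory Submission
  imports Defs
begin

text \<open>A matrix \<open>W\<^sub>i\<close> of the given sequence factors as \<open>X\<^sub>i M\<^sub>i\<close> with \<open>X\<^sub>i\<close> symmetric, and products
  of the \<open>W\<^sub>i\<close> along the prefixes \<open>v\<close> of \<open>w\<^sub>\<infinity>\<close> give integer pairs \<open>(x\<^sub>0, x\<^sub>1)\<close> of size about
  \<open>exp (\<rho>|v|)\<close> with \<open>|x\<^sub>0\<xi> - x\<^sub>1|\<close> about the inverse of that. Each pair is completed by a third integer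
  \<open>x\<^sub>2\<close> with \<open>|x\<^sub>0\<xi>\<^sup>2 - x\<^sub>2|\<close> of order \<open>exp (-\<rho>|\<alpha>(v)|)\<close>, so that \<open>\<rho> P\<^sub>v(q/\<rho>)\<close> is, up to a bounded error, the
  smallest \<open>t\<close> for which the point \<open>x\<^sub>v\<close> satisfies the three inequalities.

  If \<open>u\<close> and \<open>w\<close> are the prefixes defining \<open>P(q/\<rho>)\<close>, then some prefix \<open>v\<close> strictly between
  them makes \<open>x\<^sub>u, x\<^sub>v, x\<^sub>w\<close> independent with the heights predicted by \<open>P\<close>. The existence of
  \<open>v\<close> follows by induction along \<open>\<iota>\<close>: removing \<open>2F\<^sub>i\<^sub>-\<^sub>2\<close> letters changes the relevant points by
  an invertible linear relation, which transports independence, and reduces everything to the case of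
  three consecutive matrices \<open>X\<^sub>i\<close>. This bounds the minima from above; since the predicted
  heights sum to \<open>q\<^sub>1 + q\<^sub>2\<close> and a nonzero integer determinant is at least 1, it also bounds them from below.\<close>

section \<open>Lengths of prefixes\<close>

text \<open>Two obstacles shape the argument. A point of length n is a product of unboundedly many
  matrices, so bounds up to a constant for each factor are useless. In a norm adapted to the pair
  (x_0, x_0 \<xi> - x_1) the factor \<open>W i\<close> must have norm at most exp(\<rho> F_i)(1 +
  \<delta>_i) with summable \<delta>_i. Such precision is available because the logarithms of m
  |\<open>y0 i\<close>| satisfy the Fibonacci recursion up to a geometrically small error; \<rho> is
  the limit of their quotients by F_i. The second obstacle is that w_j w_{j+1} and w_{j+1} w_j
  differ in their last two letters, so that the transport along \<iota> fails at lengths F_j - 1.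
  There |\<alpha>(v)| is at most 3 for j \<ge> 5, and if u or w has such a length, possibly after
  reductions by \<iota>, then u and w differ by boundedly many letters and q_2 exceeds q_1 / 2 by a
  bounded amount at most. In that degenerate situation the point v is dispensed with: the triple
  consists of the point of u, a companion obtained by applying the same matrix product to the other
  unit vector, and (0, 0, 1). The first two have nearest integers as third coordinates.\<close>

definition F :: "nat \<Rightarrow> nat" where
  "F i = fib (Suc i)"

lemma F_0: "F 0 = 1" and F_1: "F (Suc 0) = 1"
  by (simp_all add: F_def)

lemma F_Suc_Suc: "F (Suc (Suc i)) = F (Suc i) + F i"
  by (simp add: F_def)

lemma F_expand:
  "F (i + 2) = F (i + 1) + F i"
  "F (i + 3) = 2 * F (i + 1) + F i"
  "F (i + 4) = 3 * F (i + 1) + 2 * F i"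
  "F (i + 5) = 5 * F (i + 1) + 3 * F i"
  "F (i + 6) = 8 * F (i + 1) + 5 * F i"
  "F (Suc (i + 1)) = F (i + 1) + F i"
  "F (Suc (i + 2)) = 2 * F (i + 1) + F i"
  "F (Suc (i + 3)) = 3 * F (i + 1) + 2 * F i"
  by (simp_all add: F_Suc_Suc eval_nat_numeral)

lemma F_pos: "F i \<ge> 1"
  using fib_neq_0_nat[of "Suc i"] by (simp add: F_def)

lemma F_mono: "i \<le> j \<Longrightarrow> F i \<le> F j"
  by (simp add: F_def fib_mono)

lemma F_less: "F (i + 1) < F (i + 2)"
  using F_expand(1)[of i] F_pos[of i] by simp

lemma F_strict_mono: "\<lbrakk>1 \<le> i; i < j\<rbrakk> \<Longrightarrow> F i < F j"
  using F_less[of "i - 1"] F_mono[of "Suc i" j] by (simp add: eval_nat_numeral)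

lemma F_ge: "i \<le> F i"
proof (induction i)
  case (Suc i)
  show ?case
  proof (cases i)
    case (Suc j)
    then show ?thesis using Suc.IH F_pos[of j] by (simp add: F_Suc_Suc)
  qed (simp add: F_1)
qed simp

lemma F_values: "F 2 = 2" "F 3 = 3" "F 4 = 5" "F 5 = 8" "F 6 = 13" "F 7 = 21" "F 8 = 34"
  by (simp_all add: eval_nat_numeral F_Suc_Suc F_0 F_1)

lemma F_block_ex:
  assumes "n \<ge> 1"
  obtains i where "i \<ge> 1" "F i \<le> n" "n < F (Suc i)"
proof -
  define i where "i = (GREATEST i. F i \<le> n)"
  have bound: "\<And>y. F y \<le> n \<Longrightarrow> y \<le> n"
    using F_ge order_trans by blast
  have 1: "F (Suc 0) \<le> n" using assms by (simp add: F_1)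
  have "F i \<le> n" unfolding i_def by (rule GreatestI_nat[where P = "\<lambda>i. F i \<le> n", OF 1 bound])
  moreover have "Suc 0 \<le> i" unfolding i_def
    by (rule Greatest_le_nat[where P = "\<lambda>i. F i \<le> n", OF 1 bound])
  moreover have "n < F (Suc i)"
  proof (rule ccontr)
    assume "\<not> n < F (Suc i)"
    then have "Suc i \<le> i" unfolding i_def
      by (intro Greatest_le_nat[where P = "\<lambda>i. F i \<le> n", OF _ bound]) simp
    then show False by simp
  qed
  ultimately show ?thesis using that by simp
qed

lemma F_block_unique:
  assumes "F i \<le> n" "n < F (Suc i)" "F j \<le> n" "n < F (Suc j)" "1 \<le> i" "1 \<le> j"
  shows "i = j"
proof (rule ccontr)
  assume "i \<noteq> j"
  then consider "Suc i \<le> j" | "Suc j \<le> i" by linarith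
  then show False using assms F_mono[of "Suc i" j] F_mono[of "Suc j" i] by cases linarith+
qed

definition ix :: "nat \<Rightarrow> nat" where
  "ix n = (THE i. 1 \<le> i \<and> F i \<le> n \<and> n < F (Suc i))"

lemma ix_eq: "\<lbrakk>1 \<le> i; F i \<le> n; n < F (Suc i)\<rbrakk> \<Longrightarrow> ix n = i"
  unfolding ix_def using F_block_unique by blast

lemma ix_F: "1 \<le> i \<Longrightarrow> ix (F i) = i"
  using ix_eq[of i "F i"] F_strict_mono[of i "Suc i"] by simp

lemma not_F_between: "\<lbrakk>1 \<le> i; F i < n; n < F (Suc i)\<rbrakk> \<Longrightarrow> n \<notin> range F"
proof
  assume *: "1 \<le> i" "F i < n" "n < F (Suc i)" and "n \<in> range F"
  then obtain j where j: "n = F j" by auto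
  have "i < j" using F_mono[of j i] * j by (meson leD leI)
  then show False using F_mono[of "Suc i" j] * j by simp
qed

text \<open>\<open>al n\<close> is the length of \<open>\<alpha>(v)\<close> for the prefix \<open>v\<close> of \<open>w\<^sub>\<infinity>\<close> of length \<open>n\<close>.\<close>

function al :: "nat \<Rightarrow> nat" where
  "al n = (if n = 0 \<or> n \<in> range F then n else al (n - 2 * F (ix n - 2)))"
  by auto
termination
proof (relation "Wellfounded.measure id")
  fix n assume "\<not> (n = 0 \<or> n \<in> range F)"
  then show "(n - 2 * F (ix n - 2), n) \<in> Wellfounded.measure id" using F_pos[of "ix n - 2"] by simp
qed simp

declare al.simps [simp del]

lemma al_0: "al 0 = 0"
  by (simp add: al.simps)

lemma al_F: "al (F i) = F i"
  by (simp add: al.simps)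

text \<open>Since F(j+3) - 2F(j+1) = F j, one step of \<iota> translates the whole interior of the
  block between F(j+3) and F(j+4) to lengths starting at F j. All later inductions use \<iota> in
  this form.\<close>

lemma al_block:
  assumes "0 < k" "k < F (j + 2)"
  shows "al (F (j + 3) + k) = al (F j + k)"
proof -
  have lt: "F (j + 3) < F (j + 3) + k" "F (j + 3) + k < F (Suc (j + 3))"
    using assms F_expand[of j] by linarith+
  have i: "ix (F (j + 3) + k) = j + 3"
    using lt by (intro ix_eq) auto
  have nF: "F (j + 3) + k \<notin> range F"
    using not_F_between[of "j + 3"] lt by simp
  have "j + 3 - 2 = j + 1" by simp
  then have "al (F (j + 3) + k) = al (F (j + 3) + k - 2 * F (j + 1))"
    using nF assms i by (subst al.simps) simp
  then show ?thesis by (simp add: F_expand)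
qed

lemma al_le: "al n \<le> n"
proof (induction n rule: less_induct)
  case (less n)
  show ?case
  proof (cases "n = 0 \<or> n \<in> range F")
    case False
    then show ?thesis
      using less[of "n - 2 * F (ix n - 2)"] F_pos[of "ix n - 2"] by (subst al.simps) simp
  qed (subst al.simps, simp)
qed

text \<open>The blocks starting at F 1 = 1 and F 2 = 2 have no interior, so interior lengths lie in
  blocks of index at least 3, written j + 3.\<close>

lemma block_cases:
  assumes "n \<ge> 1"
  obtains i where "i \<ge> 1" "n = F i"
  | j k where "n = F (j + 3) + k" "0 < k" "k < F (j + 2)"
proof -
  obtain i where i: "i \<ge> 1" "F i \<le> n" "n < F (Suc i)"
    using F_block_ex[OF assms] .
  show ?thesis
  proof (cases "n = F i")
    case False
    have "i \<noteq> 1" "i \<noteq> 2"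
      using False i F_values by (auto simp: F_1 eval_nat_numeral)
    then obtain j where j: "i = j + 3"
      using i(1) by (metis One_nat_def Suc_1 add.commute le_Suc_ex le_antisym not_less_eq_eq numeral_3_eq_3)
    have "Suc i = j + 4" using j by simp
    with i(3) have "n < F (j + 4)" by simp
    then have "n - F i < F (j + 2)"
      using i(2) F_expand[of j] unfolding j by linarith
    then show ?thesis
      using that(2)[of j "n - F i"] False i(2) j by simp
  qed (use that i in blast)
qed

text \<open>A step of \<iota> in block j+3 lowers n by 2F(j+1), keeps \<open>al n\<close> and lands
  below F(j+3), where the bound is 2F(j+2); the two contributions add up to 2F(j+3). Thus n +
  \<open>al n\<close> has its records at Fibonacci lengths.\<close>

lemma al_sum_le:
  assumes "1 \<le> i" "n < F (Suc i)"
  shows "n + al n \<le> 2 * F i"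
  using assms
proof (induction n arbitrary: i rule: less_induct)
  case (less n)
  show ?case
  proof (cases "n < F i")
    case True
    then show ?thesis using al_le[of n] by simp
  next
    case False
    have n1: "n \<ge> 1" using False F_pos[of i] by simp
    show ?thesis
      using n1
    proof (cases rule: block_cases)
      case (1 l)
      have "l = i"
        using F_block_unique[of l n i] 1 less.prems False F_strict_mono[of l "Suc l"] by simp
      then show ?thesis using 1 by (simp add: al_F)
    next
      case (2 j k)
      have "n < F (Suc (j + 3))"
        using 2 F_expand[of j] by linarith
      then have i: "i = j + 3"
        using F_block_unique[of "j + 3" n i] 2 less.prems False by simp
      have lt: "F j + k < n" using 2 F_expand[of j] F_pos[of "j + 1"] by linarith
      have "F j + k < F (Suc (j + 2))"
        using 2 F_expand[of j] F_mono[of j "j + 1"] F_pos[of "j + 1"] by linarith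
      then have "F j + k + al (F j + k) \<le> 2 * F (j + 2)"
        using less.IH[OF lt, of "j + 2"] by simp
      then show ?thesis
        using al_block[of k j] 2(2,3) F_expand[of j] unfolding i 2(1) by linarith
    qed
  qed
qed

text \<open>Two steps of \<iota> lead from F(j+3) - k to F j - k: the length lies in block j+2, is
  sent into block j+1, and from there to just below F j. Hence the pattern of \<open>al\<close> just
  below Fibonacci numbers has period three.\<close>

lemma al_minus:
  assumes "k \<in> {1, 2, 3}" "5 \<le> j"
  shows "al (F (j + 3) - k) = al (F j - k)"
proof -
  obtain l where l: "j = l + 5" using assms(2) le_Suc_ex by (metis add.commute)
  have k: "1 \<le> k" "k \<le> 3" using assms(1) by auto
  have big: "F (l + 4) \<ge> 5" using F_mono[of 4 "l + 4"] F_values by simp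
  define x where "x = F (l + 3)"
  define y where "y = F (l + 4)"
  have e: "F (l + 5) = x + y" "F (l + 6) = x + 2 * y" "F (l + 7) = 2 * x + 3 * y"
    "F (l + 8) = 3 * x + 5 * y"
    using F_expand[of "l + 3"] by (simp_all add: x_def y_def numeral_eq_Suc)
  have "al (F (j + 3) - k) = al (F ((l + 4) + 3) + (x + 2 * y - k))"
    using e k big l by (simp add: y_def add.commute)
  also have "\<dots> = al (F (l + 4) + (x + 2 * y - k))"
    by (rule al_block) (use e k big in \<open>simp_all add: y_def add.commute\<close>)
  also have "F (l + 4) + (x + 2 * y - k) = F ((l + 3) + 3) + (y - k)"
    using e k big by (simp add: y_def add.commute)
  also have "al \<dots> = al (F (l + 3) + (y - k))"
    by (rule al_block) (use e k big in \<open>simp_all add: y_def add.commute\<close>)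
  also have "F (l + 3) + (y - k) = F j - k"
    using e k big l by (simp add: x_def y_def)
  finally show ?thesis .
qed

text \<open>These are the lengths F j - 1, F j - 2 and F j - 3 for j = 5, 6, 7, which start the
  period.\<close>

lemma al_values: "al 5 = 5" "al 6 = 2" "al 7 = 3" "al 10 = 2" "al 11 = 5" "al 12 = 2"
  "al 18 = 8" "al 19 = 3" "al 20 = 2"
proof -
  have al2: "al 2 = 2" "al 3 = 3" "al 5 = 5" "al 8 = 8"
    using al_F[of 2] al_F[of 3] al_F[of 4] al_F[of 5] by (simp_all add: F_values)
  have al4: "al 4 = 2" using al_block[of 1 0] al2 F_values by (simp add: F_0 numeral_2_eq_2)
  show "al 5 = 5" by (fact al2)
  have "F (1 + 2) = 3" "F (1 + 3) = 5" using F_values by (simp_all add: numeral_eq_Suc)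
  then show 6: "al 6 = 2" using al_block[of 1 1] al2(1) by (simp add: F_1 numeral_2_eq_2)
  show 7: "al 7 = 3" using al_block[of 2 1] al2 \<open>F (1 + 2) = 3\<close> \<open>F (1 + 3) = 5\<close> by (simp add: F_1 numeral_3_eq_3)
  show "al 11 = 5" using al_block[of 3 2] al2 by (simp add: F_values)
  show "al 12 = 2" using al_block[of 4 2] 6 by (simp add: F_values)
  show "al 18 = 8" using al_block[of 5 3] al2 by (simp add: F_values)
  have 9: "al 9 = 3" using al_block[of 1 2] al2 by (simp add: F_values)
  show "al 19 = 3" using al_block[of 6 3] 9 by (simp add: F_values)
  show 10: "al 10 = 2" using al_block[of 2 2] al4 by (simp add: F_values)
  show "al 20 = 2" using al_block[of 7 3] 10 by (simp add: F_values)
qed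

text \<open>By periodicity only j = 5, 6, 7 need checking. The disjunction says that F j - 1 is not
  a record of n + \<open>al n\<close>: one of the two preceding lengths does at least as
  well.\<close>

lemma al_near_F:
  assumes "5 \<le> j"
  shows "al (F j - 1) \<le> 3 \<and>
    (al (F j - 1) + 1 \<le> al (F j - 2) \<or> al (F j - 1) + 2 \<le> al (F j - 3))"
  using assms
proof (induction j rule: less_induct)
  case (less j)
  show ?case
  proof (cases "j < 8")
    case True
    then consider "j = 5" | "j = 6" | "j = 7" using less.prems by linarith
    then show ?thesis by cases (simp_all add: F_values al_values)
  next
    case False
    have "j - 3 + 3 = j" using False by simp
    then show ?thesis
      using less.IH[of "j - 3"] False al_minus[of _ "j - 3"] by simp
  qed
qed

text \<open>For \<open>|v| = n\<close> one has \<open>q \<in> A(v)\<close> iff \<open>n \<le> q\<^sub>1 / 2\<close> and \<open>excess n \<le> q\<^sub>1 - q\<^sub>2\<close>, and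
  \<open>q \<in> C(v)\<close> iff \<open>q\<^sub>1 / 2 \<le> n\<close> and \<open>q\<^sub>2 \<le> reach n\<close>.\<close>

definition excess :: "nat \<Rightarrow> real" where
  "excess n = real n - real (al n)"

definition reach :: "nat \<Rightarrow> real" where
  "reach n = real n + real (al n)"

lemma excess_block:
  assumes "0 < k" "k < F (j + 2)"
  shows "excess (F (j + 3) + k) = 2 * real (F (j + 1)) + excess (F j + k)"
  using al_block[OF assms] F_expand(2)[of j] by (simp add: excess_def)

lemma reach_block:
  assumes "0 < k" "k < F (j + 2)"
  shows "reach (F (j + 3) + k) = 2 * real (F (j + 1)) + reach (F j + k)"
  using al_block[OF assms] F_expand(2)[of j] by (simp add: reach_def)

lemma excess_nonneg: "0 \<le> excess n"
  using al_le[of n] by (simp add: excess_def)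

lemma excess_F: "excess (F i) = 0"
  by (simp add: excess_def al_F)

lemma reach_F: "reach (F i) = 2 * real (F i)"
  by (simp add: reach_def al_F)

lemma reach_le: "\<lbrakk>1 \<le> i; n < F (Suc i)\<rbrakk> \<Longrightarrow> reach n \<le> 2 * real (F i)"
  using al_sum_le[of i n] by (simp add: reach_def)

section \<open>Brackets and the search for an intermediate length\<close>

text \<open>With \<open>h = q\<^sub>1 / 2\<close> and \<open>\<delta> = q\<^sub>1 - q\<^sub>2\<close>, the numbers \<open>n\<close> and \<open>n'\<close> are the lengths of the
  words \<open>u\<close> and \<open>w\<close> in the definition of \<open>P(q)\<close>.\<close>

definition bracket :: "real \<Rightarrow> real \<Rightarrow> nat \<Rightarrow> nat \<Rightarrow> bool" where
  "bracket h \<delta> n n' \<longleftrightarrow> 0 \<le> h \<and> 0 \<le> \<delta> \<and>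
     real n \<le> h \<and> excess n \<le> \<delta> \<and> (\<forall>k. n < k \<and> real k \<le> h \<longrightarrow> \<delta> < excess k) \<and>
     n < n' \<and> h \<le> real n' \<and> 2 * h - \<delta> \<le> reach n' \<and>
     (\<forall>k. n < k \<and> k < n' \<and> h \<le> real k \<longrightarrow> reach k < 2 * h - \<delta>)"

text \<open>Fibonacci lengths have excess 0, so they qualify for n as soon as they are at most h. In
  the next lemma they qualify for n' as soon as they are at least h, their reach being 2 F i \<ge>
  2h.\<close>

lemma bracket_ge:
  assumes "bracket h \<delta> n n'" "real (F i) \<le> h"
  shows "F i \<le> n"
  using assms excess_F[of i] by (auto simp: bracket_def intro: leI)

lemma bracket_le:
  assumes "bracket h \<delta> n n'" "h \<le> real (F i)" "n < F i"
  shows "n' \<le> F i"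
  using assms reach_F[of i] unfolding bracket_def by (force intro: leI)

text \<open>With F j = N + 8, the reach of n' is at most N + 10. Minimality of n' against the two
  preceding lengths forces N + 5 \<le> n or N + 5 < h. If n < N, then N itself was rejected for its
  excess, so \<delta> < N and 2h - \<delta> > N + 10, a contradiction. Hence n \<ge> N, and h -
  \<delta> is bounded as well.\<close>

lemma bracket_near_F:
  assumes b: "bracket h \<delta> n (F j - 1)" and j: "5 \<le> j"
  shows "F j - 1 \<le> n + 25 \<and> h - \<delta> \<le> 25"
proof -
  have "F j \<ge> 8" using F_mono[of 5 j] j F_values by simp
  then obtain N where N: "F j = N + 8" using le_Suc_ex by (metis add.commute)
  have a: "al (N + 7) \<le> 3" "al (N + 7) + 1 \<le> al (N + 6) \<or> al (N + 7) + 2 \<le> al (N + 5)"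
    using al_near_F[OF j] by (simp_all add: N add.commute)
  have b: "real n \<le> h" "2 * h - \<delta> \<le> reach (N + 7)"
    "\<And>k. n < k \<Longrightarrow> real k \<le> h \<Longrightarrow> \<delta> < excess k"
    "\<And>k. n < k \<Longrightarrow> k < N + 7 \<Longrightarrow> h \<le> real k \<Longrightarrow> reach k < 2 * h - \<delta>"
    using b by (simp_all add: bracket_def N add.commute)
  have tot: "2 * h - \<delta> \<le> real N + 10"
    using b(2) a by (simp add: reach_def)
  have "reach (N + 7) \<le> reach (N + 6) \<or> reach (N + 7) \<le> reach (N + 5)"
    using a by (auto simp: reach_def)
  then have h: "N + 5 \<le> n \<or> real N + 5 < h"
    using b(2) b(4)[of "N + 6"] b(4)[of "N + 5"] by fastforce
  have "N \<le> n"
  proof (rule ccontr)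
    assume *: "\<not> N \<le> n"
    then have "\<delta> < excess N" using h b(3)[of N] by auto
    also have "\<dots> \<le> real N" by (simp add: excess_def)
    finally show False using tot h * by auto
  qed
  then show ?thesis using tot h b(1) by (auto simp: N)
qed

text \<open>The middle height predicted by P is q_2 + n - n'. The condition
  \<open>n' \<le> n + al v\<close> is what makes the third coordinate of the point of v fit it;
  \<open>4 \<le> al v\<close> keeps v away from the exceptional lengths F j - 1, where
  \<open>al\<close> is at most 3 for j \<ge> 5.\<close>

definition linked :: "(nat \<Rightarrow> nat \<Rightarrow> nat \<Rightarrow> bool) \<Rightarrow> nat \<Rightarrow> nat \<Rightarrow> bool" where
  "linked T n n' \<longleftrightarrow> (\<exists>v. n < v \<and> v < n' \<and> n' \<le> n + al v \<and> 4 \<le> al v \<and> T n v n')"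

text \<open>\<open>T\<close> abstracts linear independence of the points attached to three prefixes. The lengths
  \<open>F i - 1\<close> are excluded in \<open>T_low\<close> because the third coordinates do not follow the recursion there.\<close>

locale shift_closed =
  fixes T :: "nat \<Rightarrow> nat \<Rightarrow> nat \<Rightarrow> bool"
  assumes T_full: "\<And>j. T (F (j + 5)) (F (j + 5) + F (j + 3)) (F (j + 6))"
    and T_part: "\<And>j. T (F (j + 5)) (F (j + 5) + F (j + 1)) (F (j + 5) + F (j + 3))"
    and T_low: "\<And>j k l k'. \<lbrakk>1 \<le> j; k < l; l < k'; k' \<le> F (j + 1);
      k + 1 \<noteq> F (j + 1); l + 1 \<noteq> F (j + 1); k' + 1 \<noteq> F (j + 1); T (F j + k) (F j + l) (F j + k')\<rbrakk>
      \<Longrightarrow> T (F (j + 3) + k) (F (j + 3) + l) (F (j + 3) + k')"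
    and T_high: "\<And>j k l k'. \<lbrakk>1 \<le> j; k < l; l < k'; k' \<le> F j;
      T (F (j + 2) + k) (F (j + 2) + l) (F (j + 2) + k')\<rbrakk>
      \<Longrightarrow> T (F (j + 3) + F (j + 1) + k) (F (j + 3) + F (j + 1) + l) (F (j + 3) + F (j + 1) + k')"
begin

text \<open>The witness F i + F(i-2) reduces under \<iota> to F(i-3) + F(i-2) = F(i-1), which is
  exactly the gap F(i+1) - F i.\<close>

lemma linked_full:
  assumes "6 \<le> i"
  shows "linked T (F i) (F (i + 1))"
proof -
  obtain j where i: "i = j + 6" using assms le_Suc_ex by (metis add.commute)
  have 5: "F (j + 5) \<ge> 8" using F_mono[of 5 "j + 5"] F_values by simp
  have e: "F (j + 7) = F (j + 6) + F (j + 5)" "F (j + 5) = F (j + 4) + F (j + 3)"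
    "F (j + 6) = F (j + 5) + F (j + 4)"
    by (simp_all add: F_Suc_Suc eval_nat_numeral)
  have "al (F ((j + 3) + 3) + F (j + 4)) = al (F (j + 3) + F (j + 4))"
    by (rule al_block) (use e F_pos[of "j + 3"] F_pos[of "j + 4"] in \<open>simp_all add: add.commute\<close>)
  then have "al (F (j + 6) + F (j + 4)) = F (j + 5)"
    using e(2) al_F[of "j + 5"] by (simp add: add.commute)
  moreover have "T (F (j + 6)) (F (j + 6) + F (j + 4)) (F (j + 7))"
    using T_full[of "j + 1"] by (simp add: numeral_eq_Suc)
  ultimately show ?thesis
    unfolding linked_def i using e 5 F_pos[of "j + 4"] F_pos[of "j + 3"]
    by (intro exI[of _ "F (j + 6) + F (j + 4)"]) (simp add: add.commute)
qed

text \<open>The witness F i + F(i-4) reduces to F(i-2), again exactly the gap.\<close>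

lemma linked_part:
  assumes "6 \<le> i"
  shows "linked T (F i) (F i + F (i - 2))"
proof -
  obtain j where i: "i = j + 6" using assms le_Suc_ex by (metis add.commute)
  have 4: "F (j + 4) \<ge> 5" using F_mono[of 4 "j + 4"] F_values by simp
  have e: "F (j + 5) = F (j + 4) + F (j + 3)" "F (j + 4) = F (j + 3) + F (j + 2)"
    by (simp_all add: F_Suc_Suc eval_nat_numeral)
  have "al (F ((j + 3) + 3) + F (j + 2)) = al (F (j + 3) + F (j + 2))"
    by (rule al_block) (use e F_pos[of "j + 3"] F_pos[of "j + 2"] in \<open>simp_all add: add.commute\<close>)
  then have "al (F (j + 6) + F (j + 2)) = F (j + 4)"
    using e(2) al_F[of "j + 4"] by (simp add: add.commute)
  moreover have "T (F (j + 6)) (F (j + 6) + F (j + 2)) (F (j + 6) + F (j + 4))"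
    using T_part[of "j + 1"] by (simp add: numeral_eq_Suc)
  ultimately show ?thesis
    unfolding linked_def i using e 4 F_pos[of "j + 2"] F_pos[of "j + 3"]
    by (intro exI[of _ "F (j + 6) + F (j + 2)"]) (simp add: add.commute)
qed

text \<open>The witness moves along with both ends and keeps its \<open>al\<close>. It cannot sit at
  the forbidden offset, where \<open>al\<close> would be at most 3.\<close>

lemma linked_low:
  assumes "1 \<le> j" "linked T (F j + k) (F j + k')" "k' \<le> F (j + 1)"
    "k + 1 \<noteq> F (j + 1)" "k' + 1 \<noteq> F (j + 1)" "3 \<le> j"
  shows "linked T (F (j + 3) + k) (F (j + 3) + k')"
proof -
  obtain v where v: "F j + k < v" "v < F j + k'" "F j + k' \<le> F j + k + al v" "4 \<le> al v"
    "T (F j + k) v (F j + k')"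
    using assms(2) by (auto simp: linked_def)
  define l where "l = v - F j"
  have l: "v = F j + l" "k < l" "l < k'" using v(1,2) by (simp_all add: l_def)
  have "l + 1 \<noteq> F (j + 1)"
  proof
    assume "l + 1 = F (j + 1)"
    then have "v = F (j + 2) - 1" using l F_expand(1)[of j] by simp
    then show False using al_near_F[of "j + 2"] assms(6) v(4) by simp
  qed
  then have "T (F (j + 3) + k) (F (j + 3) + l) (F (j + 3) + k')"
    using T_low[of j k l k'] assms l v(5) by simp
  moreover have "al (F (j + 3) + l) = al v"
    unfolding l(1) by (rule al_block) (use l assms(3) F_expand(1)[of j] in linarith)+
  ultimately show ?thesis unfolding linked_def
    using v l by (intro exI[of _ "F (j + 3) + l"]) simp
qed

lemma linked_high:
  assumes "1 \<le> j" "linked T (F (j + 2) + k) (F (j + 2) + k')" "k' \<le> F j"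
  shows "linked T (F (j + 3) + F (j + 1) + k) (F (j + 3) + F (j + 1) + k')"
proof -
  obtain v where v: "F (j + 2) + k < v" "v < F (j + 2) + k'"
    "F (j + 2) + k' \<le> F (j + 2) + k + al v" "4 \<le> al v" "T (F (j + 2) + k) v (F (j + 2) + k')"
    using assms(2) by (auto simp: linked_def)
  define l where "l = v - F (j + 2)"
  have l: "v = F (j + 2) + l" "k < l" "l < k'" using v(1,2) by (simp_all add: l_def)
  have T: "T (F (j + 3) + F (j + 1) + k) (F (j + 3) + F (j + 1) + l) (F (j + 3) + F (j + 1) + k')"
    using T_high[of j k l k'] assms l v(5) by simp
  have "al (F (j + 3) + (F (j + 1) + l)) = al (F j + (F (j + 1) + l))"
    by (rule al_block) (use l assms(3) F_expand(1)[of j] in linarith)+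
  also have "F j + (F (j + 1) + l) = v" using l F_expand(1)[of j] by simp
  finally show ?thesis unfolding linked_def
    using v l T by (intro exI[of _ "F (j + 3) + F (j + 1) + l"]) (simp add: add.assoc)
qed

text \<open>Here Q plays the part of q_2, and n' is the first length after F i whose reach is at
  least Q. Either n' is one of two explicit record lengths, or everything reduces by \<iota> from i
  to i - 3.\<close>

lemma linked_or_small_at_F:
  assumes "1 \<le> i" "Q \<le> 2 * real (F (i + 1))" "F i < n'" "Q \<le> reach n'"
    "\<And>k. \<lbrakk>F i < k; k < n'\<rbrakk> \<Longrightarrow> reach k < Q"
  shows "linked T (F i) n' \<or> n' \<le> F i + 25 \<and> Q \<le> real (F i) + 25"
  using assms
proof (induction i arbitrary: Q n' rule: less_induct)
  case (less i)
  have n'_le: "n' \<le> k" if "F i < k" "Q \<le> reach k" for k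
    using less.prems(5)[of k] that by force
  have up: "n' \<le> F (i + 1)"
    using n'_le[of "F (i + 1)"] less.prems(1,2) F_strict_mono[of i "i + 1"] by (simp add: reach_F)
  show ?case
  proof (cases "i \<le> 5")
    case True
    \<comment> \<open>This case fixes the constant 25: Q is at most 2 * 13 = 26, and F i is at least
      1.\<close>
    then have "F (i + 1) \<le> 13" "F (i + 1) \<le> F i + 5"
      using less.prems(1) F_mono[of "i + 1" 6] F_expand(1)[of "i - 1"] F_mono[of "i - 1" 4]
      by (simp_all add: F_values)
    then show ?thesis using less.prems(2) up F_mono[of 1 i] less.prems(1) F_pos[of i]
      by auto
  next
    case False
    then obtain l where l: "i = l + 6" using le_Suc_ex[of 6 i] by (auto simp: add.commute)
    define x where "x = F (l + 2)"
    define y where "y = F (l + 3)"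
    have e: "F (l + 2) = x" "F (l + 3) = y" "F (l + 4) = x + y" "F (l + 5) = x + 2 * y"
      "F (l + 6) = 2 * x + 3 * y" "F (l + 7) = 3 * x + 5 * y"
      using F_expand[of "l + 2"] by (simp_all add: x_def y_def numeral_eq_Suc)
    have xy: "x \<ge> 2" "y \<ge> 3"
      using F_mono[of 2 "l + 2"] F_mono[of 3 "l + 3"] F_values by (simp_all add: x_def y_def)
    have tot: "reach (F (l + 6) + k) = 2 * real (x + y) + reach (y + k)"
      if "0 < k" "k < x + 2 * y" for k
      using reach_block[of k "l + 3"] that e by (simp add: numeral_eq_Suc)
    \<comment> \<open>The thresholds are the reach of F i + F(i-2), which is 2 F i, and that of F i
      + F(i-4), which is 4 F(i-2). Above the first only F(i+1) is left; between them n' = F i +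
      F(i-2); below the second n' stays in the part of the block that translates to F(i-3).\<close>
    consider "2 * real (F i) < Q" | "4 * real (x + y) < Q" "Q \<le> 2 * real (F i)" | "Q \<le> 4 * real (x + y)"
      by linarith
    then show ?thesis
    proof cases
      case 1
      then have "\<not> n' < F (Suc i)"
        using reach_le[of i n'] less.prems(1,4) by linarith
      then have "n' = F (i + 1)" using up by simp
      then show ?thesis using linked_full[of i] l by simp
    next
      case 2
      have "reach (F i + (x + y)) = 2 * real (F i)"
      proof -
        have "y + (x + y) = F (l + 5)" using e by simp
        then have "reach (F (l + 6) + (x + y)) = 2 * real (x + y) + 2 * real (F (l + 5))"
          using tot[of "x + y"] xy reach_F[of "l + 5"] by simp
        then show ?thesis using e l by simp
      qed
      then have "n' \<le> F i + (x + y)"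
        using n'_le[of "F i + (x + y)"] 2 xy by simp
      moreover have "\<not> n' < F i + (x + y)"
      proof
        assume lt: "n' < F i + (x + y)"
        define k where "k = n' - F i"
        have k: "n' = F i + k" "0 < k" "k < x + y" using less.prems(3) lt by (simp_all add: k_def)
        have "reach (y + k) \<le> 2 * real (F (l + 4))"
          by (rule reach_le) (use k e in \<open>simp_all add: numeral_eq_Suc\<close>)
        then have "reach n' \<le> 4 * real (x + y)"
          using tot[of k] k e l by simp
        then show False using 2 less.prems(4) by linarith
      qed
      moreover have "F (i - 2) = x + y" using e l by (simp add: add.commute)
      ultimately have "n' = F i + F (i - 2)" by simp
      then show ?thesis using linked_part[of i] l by simp
    next
      case 3
      have "reach (F i + x) = 4 * real (x + y)"
        using tot[of x] xy reach_F[of "l + 4"] e l by (simp add: add.commute)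
      then have le: "n' \<le> F i + x"
        using n'_le[of "F i + x"] 3 xy by simp
      define k where "k = n' - F i"
      have k: "n' = F i + k" "0 < k" "k \<le> x" using less.prems(3) le by (simp_all add: k_def)
      have "linked T (F (l + 3)) (F (l + 3) + k) \<or> F (l + 3) + k \<le> F (l + 3) + 25 \<and>
        Q - 2 * real (x + y) \<le> real (F (l + 3)) + 25"
      proof (rule less.IH)
        show "Q - 2 * real (x + y) \<le> 2 * real (F (l + 3 + 1))" using 3 e by (simp add: numeral_eq_Suc)
        show "Q - 2 * real (x + y) \<le> reach (F (l + 3) + k)"
          using tot[of k] k less.prems(4) l e xy by simp
        fix k0 assume k0: "F (l + 3) < k0" "k0 < F (l + 3) + k"
        define z where "z = k0 - F (l + 3)"
        have z: "k0 = y + z" "0 < z" "z < k" using k0 e by (simp_all add: z_def)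
        show "reach k0 < Q - 2 * real (x + y)"
          using tot[of z] z k less.prems(5)[of "F i + z"] l xy by simp
      qed (use l k in simp_all)
      moreover have "linked T (F i) n'" if "linked T (F (l + 3)) (F (l + 3) + k)"
        using linked_low[of "l + 3" 0 k] that k l e xy by (simp add: numeral_eq_Suc)
      ultimately show ?thesis using k l e by auto
    qed
  qed
qed

text \<open>Subtracting 2F(i-2) from both h and \<delta>, where F i \<le> h < F(i+1), corresponds to
  a step of \<iota> and turns a bracket into a bracket of smaller lengths. The exceptions are a
  small \<delta>, which pins n to F i, the end n' = F(i+1), which is not interior to the block, and
  the lengths of the form F j - 1.\<close>

lemma linked_or_small:
  assumes "bracket h \<delta> n n'"
  shows "linked T n n' \<or> n' \<le> n + 25 \<and> h - \<delta> \<le> 25"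
  using assms
proof (induction n' arbitrary: h \<delta> n rule: less_induct)
  case (less n')
  note b = less.prems
  have pos: "0 \<le> h" "0 \<le> \<delta>" using b by (simp_all add: bracket_def)
  show ?case
  proof (cases "h < 21")
    case True
    have "n' \<le> F 7"
      by (rule bracket_le[OF b]) (use True b in \<open>auto simp: F_values bracket_def\<close>)
    then show ?thesis using True pos by (simp add: F_values)
  next
    case False
    have n1: "nat \<lfloor>h\<rfloor> \<ge> 1" using False by (simp add: le_nat_iff le_floor_iff)
    obtain i where i: "i \<ge> 1" "F i \<le> nat \<lfloor>h\<rfloor>" "nat \<lfloor>h\<rfloor> < F (Suc i)"
      using F_block_ex[OF n1] .
    have hi: "real (F i) \<le> h" "h < real (F (Suc i))"
      using i pos by (auto simp: le_nat_iff le_floor_iff nat_less_iff floor_less_iff)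
    have "7 \<le> i"
    proof (rule ccontr)
      assume "\<not> 7 \<le> i"
      then have "F (Suc i) \<le> 21" using F_mono[of "Suc i" 7] F_values by simp
      then show False using hi False by simp
    qed
    then obtain l where l: "i = l + 6" "1 \<le> l" using le_Suc_ex[of 7 i] by (auto simp: add.commute)
    define x where "x = F (l + 3)"
    define y where "y = F (l + 4)"
    have e: "F (l + 3) = x" "F (l + 4) = y" "F (l + 5) = x + y" "F (l + 6) = x + 2 * y"
      "F (l + 7) = 2 * x + 3 * y"
      using F_expand[of "l + 3"] by (simp_all add: x_def y_def numeral_eq_Suc)
    have xy: "x \<ge> 3" "y \<ge> 5"
      using F_mono[of 3 "l + 3"] F_mono[of 4 "l + 4"] F_values by (simp_all add: x_def y_def)
    have h: "real x + 2 * real y \<le> h" "h < 2 * real x + 3 * real y"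
      using hi e l by (simp_all add: numeral_eq_Suc)
    have tot: "reach (x + 2 * y + k) = 2 * real y + reach (x + k)"
      and exc: "excess (x + 2 * y + k) = 2 * real y + excess (x + k)"
      if "0 < k" "k < x + y" for k
      using reach_block[of k "l + 3"] excess_block[of k "l + 3"] that e by (simp_all add: numeral_eq_Suc)
    have n_ge: "x + 2 * y \<le> n" using bracket_ge[OF b hi(1)] l e by simp
    have "real n < real (2 * x + 3 * y)" using b h by (simp add: bracket_def)
    then have n_lt: "n < 2 * x + 3 * y" by (simp only: of_nat_less_iff)
    have n'_le: "n' \<le> 2 * x + 3 * y"
      using bracket_le[OF b, of "l + 7"] h n_lt e by simp
    show ?thesis
    proof (cases "\<delta> < 2 * real y")
      case True
      \<comment> \<open>Every length inside the block has excess at least 2F(i-2) = 2y > \<delta>,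
        so none of them can be n.\<close>
      have n: "n = F i"
      proof (rule ccontr)
        assume "n \<noteq> F i"
        then have "excess n \<ge> 2 * real y"
          using exc[of "n - (x + 2 * y)"] excess_nonneg n_ge n_lt l e by simp
        then show False using b True by (simp add: bracket_def)
      qed
      have "linked T (F i) n' \<or> n' \<le> F i + 25 \<and> 2 * h - \<delta> \<le> real (F i) + 25"
      proof (rule linked_or_small_at_F)
        show "2 * h - \<delta> \<le> 2 * real (F (i + 1))" using hi pos by simp
        fix k assume k: "F i < k" "k < n'"
        show "reach k < 2 * h - \<delta>"
        proof (cases "h \<le> real k")
          case True
          then show ?thesis using b k n by (simp add: bracket_def)
        next
          case False
          have "excess k \<ge> 2 * real y"
            using exc[of "k - (x + 2 * y)"] excess_nonneg n'_le k l e by simp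
          moreover have "reach k = 2 * real k - excess k" by (simp add: reach_def excess_def)
          ultimately show ?thesis using False True by simp
        qed
      qed (use b n i in \<open>simp_all add: bracket_def\<close>)
      then show ?thesis using n hi by auto
    next
      case False
      \<comment> \<open>The reduced data: lengths and h drop by 2y, and so does \<delta>, because
        excess and reach both drop by 2y.\<close>
      define h0 where "h0 = h - 2 * real y"
      define \<delta>0 where "\<delta>0 = \<delta> - 2 * real y"
      have hd: "h - \<delta> = h0 - \<delta>0" by (simp add: h0_def \<delta>0_def)
      define k where "k = n - (x + 2 * y)"
      have k: "n = x + 2 * y + k" "k < x + y" using n_ge n_lt by (simp_all add: k_def)
      have h0: "real x \<le> h0" "h0 < 2 * real x + real y" using h by (simp_all add: h0_def)
      have exc_n: "excess (x + k) \<le> \<delta>0"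
        using exc[of k] k b excess_F[of "l + 3"] e False
        by (cases "k = 0") (simp_all add: bracket_def \<delta>0_def)
      have exc_up: "\<delta>0 < excess z" if "x + k < z" "real z \<le> h0" for z
      proof -
        define z' where "z' = z - x"
        have "real z < real (2 * x + y)" using that h0 by simp
        then have "z < 2 * x + y" by (simp only: of_nat_less_iff)
        then have z: "z = x + z'" "k < z'" "z' < x + y"
          using that by (simp_all add: z'_def)
        have "\<delta> < excess (x + 2 * y + z')"
          using b that z k unfolding bracket_def by (force simp: h0_def)
        then show ?thesis using exc[of z'] z by (simp add: \<delta>0_def)
      qed
      have tot_up: "reach z < 2 * h0 - \<delta>0"
        if "x + k < z" "h0 \<le> real z" "z < n' - 2 * y" for z
      proof -
        define z' where "z' = z - x"
        have z: "z = x + z'" "k < z'" "x + 2 * y + z' < n'"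
          using that by (simp_all add: z'_def)
        have "reach (x + 2 * y + z') < 2 * h - \<delta>"
          using b that z k unfolding bracket_def by (force simp: h0_def)
        then show ?thesis using tot[of z'] z n'_le by (simp add: h0_def \<delta>0_def)
      qed
      have b0: "bracket h0 \<delta>0 (x + k) z"
        if "x + k < z" "h0 \<le> real z" "2 * h0 - \<delta>0 \<le> reach z" "z \<le> n' - 2 * y" for z
        using that exc_n exc_up tot_up b h0 False k unfolding bracket_def
        by (auto simp: \<delta>0_def) (auto simp: h0_def)
      have kn': "k < n' - (x + 2 * y)" "x + 2 * y + k < n'" using b k by (auto simp: bracket_def)
      have idx: "l + 3 + 1 = l + 4" "l + 3 + 2 = l + 5" "l + 3 + 3 = l + 6" by simp_all
      have high: "linked T n n'"
        if lk: "linked T (x + k) (n' - 2 * y)" and yk: "y \<le> k"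
      proof -
        obtain r where r: "k = y + r" using le_Suc_ex[OF yk] by auto
        obtain r' where r': "n' = x + 2 * y + y + r'"
          using le_Suc_ex[of "x + 2 * y + y" n'] kn' yk by auto
        have eqs: "x + y + r = x + k" "x + y + r' = n' - 2 * y" "r' \<le> x"
          using r r' n'_le by simp_all
        have "linked T (x + y + r) (x + y + r')" unfolding eqs by (fact lk)
        then have "linked T (x + 2 * y + y + r) (x + 2 * y + y + r')"
          by (intro linked_high[of "l + 3" r r', unfolded idx e] eqs(3)) simp_all
        moreover have "x + 2 * y + y + r = n" using k r by simp
        ultimately show ?thesis using r' by simp
      qed
      show ?thesis
      proof (cases "n' = 2 * x + 3 * y")
        case True
        \<comment> \<open>Otherwise the reduced problem has F(l+5) = x + y beyond its lower end.
          Having excess 0, this length would be chosen as lower end unless h0 \<le> x + y; but then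
          its reach suffices and it would precede n' as upper end.\<close>
        have "y \<le> k"
        proof (rule ccontr)
          assume "\<not> y \<le> k"
          then have "x + k < x + y" by simp
          have 0: "excess (x + y) = 0" "reach (x + y) = 2 * real (x + y)"
            using excess_F[of "l + 5"] reach_F[of "l + 5"] unfolding e by blast+
          have "0 \<le> \<delta>0" using False by (simp add: \<delta>0_def)
          then have h0_le: "h0 \<le> real (x + y)"
            using exc_up[of "x + y"] 0 \<open>x + k < x + y\<close> by linarith
          moreover have "x + y < n' - 2 * y" using True xy by simp
          ultimately have "reach (x + y) < 2 * h0 - \<delta>0"
            by (intro tot_up \<open>x + k < x + y\<close>)
          then show False using 0(2) \<open>0 \<le> \<delta>0\<close> h0_le by simp
        qed
        \<comment> \<open>The translate of F(i+1) is 2x + y = F(l+5) + F(l+3), which is not a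
          Fibonacci length; its reach decides whether it may serve as upper end of the reduced
          bracket.\<close>
        have cap: "reach (2 * x + y) = 2 * real (x + y)"
        proof -
          have "al (F ((l + 2) + 3) + F (l + 3)) = al (F (l + 2) + F (l + 3))"
            by (rule al_block) (use F_pos[of "l + 3"] F_less[of "l + 2"] in \<open>simp_all add: numeral_eq_Suc\<close>)
          also have "F (l + 2) + F (l + 3) = F (l + 4)"
            by (simp add: F_Suc_Suc numeral_eq_Suc)
          finally have "al (2 * x + y) = y"
            using e al_F[of "l + 4"] by (simp add: algebra_simps numeral_eq_Suc)
          then show ?thesis by (simp add: reach_def)
        qed
        show ?thesis
        proof (cases "2 * h0 - \<delta>0 \<le> reach (2 * x + y)")
          case True': True
          have "bracket h0 \<delta>0 (x + k) (2 * x + y)"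
            by (rule b0) (use True' True k h0 in simp_all)
          then have "linked T (x + k) (2 * x + y) \<or>
              2 * x + y \<le> x + k + 25 \<and> h0 - \<delta>0 \<le> 25"
            by (rule less.IH[rotated]) (use True xy in simp)
          then show ?thesis
          proof
            have cap_eq: "n' - 2 * y = 2 * x + y" using True by simp
            assume "linked T (x + k) (2 * x + y)"
            then show ?thesis using high[OF _ \<open>y \<le> k\<close>] unfolding cap_eq by blast
          qed (use True k hd in simp)
        next
          case big: False
          then have "\<delta>0 < 2 * real x" using cap h0 by simp
          \<comment> \<open>The failure of 2x + y as upper end gives \<delta>0 < 2x, while all
            lengths in question above F(l+5) have excess at least 2x = 2F(l+3). So the reduced lower
            end is F(l+5), and the pair is the one of \<open>linked_part\<close>.\<close>
          have "k = y"
          proof (rule ccontr)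
            assume "k \<noteq> y"
            then obtain r where r: "k = y + r" "0 < r" using \<open>y \<le> k\<close> by (auto simp: le_iff_add)
            have "excess (F ((l + 2) + 3) + r) = 2 * real (F (l + 2 + 1)) + excess (F (l + 2) + r)"
              by (rule excess_block) (use r k e F_mono[of "l + 3" "l + 4"] in \<open>simp_all add: numeral_eq_Suc\<close>)
            then have "2 * real x \<le> excess (x + k)"
              using r e excess_nonneg by (simp add: numeral_eq_Suc add.assoc)
            then show False using exc_n \<open>\<delta>0 < 2 * real x\<close> by simp
          qed
          moreover have "n' - 2 * y = x + y + x" using True by simp
          moreover have "linked T (F (l + 5)) (F (l + 5) + F (l + 3))"
            using linked_part[of "l + 5"] l by (simp add: add.commute)
          ultimately have "linked T (x + k) (n' - 2 * y)" by (simp only: e)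
          then show ?thesis using high[OF _ \<open>y \<le> k\<close>] by simp
        qed
      next
        case n'_lt: False
        define k' where "k' = n' - (x + 2 * y)"
        have k': "n' = x + 2 * y + k'" "k < k'" "k' < x + y"
          using kn' n'_le n'_lt by (simp_all add: k'_def)
        have br: "bracket h0 \<delta>0 (x + k) (x + k')"
          by (rule b0) (use k k' b tot[of k'] in \<open>simp_all add: bracket_def h0_def \<delta>0_def\<close>)
        then have IH: "linked T (x + k) (x + k') \<or> x + k' \<le> x + k + 25 \<and> h0 - \<delta>0 \<le> 25"
          by (rule less.IH[rotated]) (use k' xy in simp)
        have small: "n' \<le> n + 25 \<and> h - \<delta> \<le> 25" if "x + k' \<le> x + k + 25 \<and> h0 - \<delta>0 \<le> 25"
          using that k k' hd by simp
        \<comment> \<open>In the reduced problem F(l+5) qualifies for the lower end if it is at most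
          h0 and for the upper end if it is at least h0. Both ends therefore lie on the same side of
          it, and a single one of the two transports applies.\<close>
        show ?thesis
        proof (cases "real (x + y) \<le> h0")
          case True
          then have "y \<le> k" using bracket_ge[OF br, of "l + 5"] e by simp
          then show ?thesis using IH small high k' by auto
        next
          case low: False
          have "real (x + k) \<le> h0" using br by (simp add: bracket_def)
          then have "k < y" using low by simp
          then have "k' \<le> y" using bracket_le[OF br, of "l + 5"] low e by simp
          consider "k + 1 = y" | "k' + 1 = y" | "k + 1 \<noteq> y" "k' + 1 \<noteq> y" by blast
          then show ?thesis
          proof cases
            case 1
            have "al (F (l + 5) - 1) \<le> 3" using al_near_F[of "l + 5"] by simp
            moreover have "F (l + 5) - 1 = x + k" using e 1 by simp
            ultimately have "real (x + k) - 3 \<le> \<delta>0" using exc_n by (simp add: excess_def)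
            then show ?thesis using small low 1 \<open>k' \<le> y\<close> by simp
          next
            case 2
            have "F (l + 5) - 1 = x + k'" using e 2 by simp
            then show ?thesis using bracket_near_F[of h0 \<delta>0 "x + k" "l + 5"] br small by simp
          next
            case 3
            have "linked T n n'" if "linked T (x + k) (x + k')"
              using linked_low[of "l + 3" k k', unfolded idx e] that k k' 3 \<open>k' \<le> y\<close> by simp
            then show ?thesis using IH small by blast
          qed
        qed
      qed
    qed
  qed
qed

end

section \<open>Prefixes of the infinite Fibonacci word\<close>

lemma length_fib_word: "length (fib_word i) = F i"
  by (induction i rule: fib_word.induct) (simp_all add: F_0 F_1 F_Suc_Suc)

lemma fib_word_prefix_mono:
  assumes "1 \<le> i" "i \<le> j"
  shows "fib_word i \<le> fib_word j"
  using assms(2)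
proof (induction rule: dec_induct)
  case (step j)
  then obtain l where "j = Suc l" using assms(1) by (cases j) auto
  then have "fib_word j \<le> fib_word (Suc j)" by simp
  then show ?case using step.IH by (rule order_trans[rotated])
qed simp

text \<open>The index \<open>Suc n\<close> makes the word long enough, as F(n+1) \<ge> n + 1, and
  avoids index 0, where the word is not a prefix of w_\<infinity>.\<close>

definition wpre :: "nat \<Rightarrow> letter list" where
  "wpre n = take n (fib_word (Suc n))"

lemma take_fib_word:
  assumes "1 \<le> i" "1 \<le> j" "n \<le> F i" "n \<le> F j"
  shows "take n (fib_word i) = take n (fib_word j)"
proof -
  have *: "take n (fib_word i) = take n (fib_word j)"
    if ij: "1 \<le> i" "i \<le> j" and n: "n \<le> F i" for i j
  proof -
    obtain z where "fib_word j = fib_word i @ z"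
      using fib_word_prefix_mono[OF ij] unfolding less_eq_list_def prefix_def by blast
    then show ?thesis using n length_fib_word[of i] by simp
  qed
  show ?thesis
  proof (cases "i \<le> j")
    case True
    then show ?thesis using *[of i j] assms by blast
  next
    case False
    then show ?thesis using *[of j i, symmetric] assms by simp
  qed
qed

lemma wpre_eq: "\<lbrakk>1 \<le> i; n \<le> F i\<rbrakk> \<Longrightarrow> wpre n = take n (fib_word i)"
  unfolding wpre_def using F_ge[of "Suc n"] by (intro take_fib_word) simp_all

lemma length_wpre: "length (wpre n) = n"
  using F_ge[of "Suc n"] by (simp add: wpre_def length_fib_word)

lemma take_wpre: "k \<le> n \<Longrightarrow> take k (wpre n) = wpre k"
  using wpre_eq[of "Suc n" k] F_ge[of "Suc n"] by (simp add: wpre_def)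

lemma wpre_F: "1 \<le> i \<Longrightarrow> wpre (F i) = fib_word i"
  using wpre_eq[of i "F i"] length_fib_word[of i] by simp

lemma wpre_inj: "wpre k = wpre n \<longleftrightarrow> k = n"
  by (metis length_wpre)

lemma wpre_le: "wpre k \<le> wpre n \<longleftrightarrow> k \<le> n"
proof
  assume "wpre k \<le> wpre n"
  then show "k \<le> n"
    using prefix_length_le[of "wpre k" "wpre n"] by (simp add: less_eq_list_def length_wpre)
next
  assume "k \<le> n"
  then show "wpre k \<le> wpre n"
    using take_is_prefix[of k "wpre n"] by (simp add: less_eq_list_def take_wpre)
qed

lemma wpre_less: "wpre k < wpre n \<longleftrightarrow> k < n"
  by (simp add: less_le wpre_le wpre_inj)

text \<open>Prefixes form a chain parametrized by length, so the greatest and least words in the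
  definition of P become extremal natural numbers.\<close>

lemma winf_prefixes_eq: "winf_prefixes = range wpre"
proof (intro equalityI subsetI)
  fix v assume "v \<in> winf_prefixes"
  then obtain i where i: "1 \<le> i" "v \<le> fib_word i" by (auto simp: winf_prefixes_def)
  then obtain z where z: "fib_word i = v @ z" by (auto simp: less_eq_list_def prefix_def)
  have "length v \<le> F i" using z length_fib_word[of i] by simp
  then have "wpre (length v) = v" using wpre_eq[OF i(1)] z by simp
  then show "v \<in> range wpre" by (metis rangeI)
next
  fix v assume "v \<in> range wpre"
  then obtain n where n: "v = wpre n" by auto
  have "v \<le> fib_word (Suc n)" unfolding n wpre_def by (simp add: less_eq_list_def take_is_prefix)
  then show "v \<in> winf_prefixes" by (auto simp: winf_prefixes_def)
qed

lemma wpre_in_Fib_words: "wpre n \<in> Fib_words \<longleftrightarrow> n = 0 \<or> n \<in> range F"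
proof
  assume "wpre n \<in> Fib_words"
  then consider "wpre n = []" | i where "1 \<le> i" "wpre n = fib_word i"
    by (auto simp: Fib_words_def)
  then show "n = 0 \<or> n \<in> range F"
    by cases (metis length_wpre list.size(3), metis length_wpre length_fib_word rangeI)
next
  assume "n = 0 \<or> n \<in> range F"
  then consider "n = 0" | i where "n = F i" "1 \<le> i"
    using F_0 F_1 by (metis One_nat_def imageE le_numeral_extra(4) less_one not_le)
  then show "wpre n \<in> Fib_words"
  proof cases
    case 2
    then show ?thesis by (auto simp: Fib_words_def wpre_F)
  qed (simp add: Fib_words_def wpre_def)
qed

lemma iota_wpre:
  "iota (wpre n) = wpre (if n = 0 \<or> n \<in> range F then n else n - 2 * F (ix n - 2))"
proof (cases "n = 0 \<or> n \<in> range F")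
  case True
  then show ?thesis using wpre_in_Fib_words by (simp add: iota_def)
next
  case False
  then have "n \<ge> 1" by simp
  then obtain j k where jk: "n = F (j + 3) + k" "0 < k" "k < F (j + 2)"
    using block_cases False by blast
  have lt: "F (j + 3) < n" "n < F (Suc (j + 3))"
    using jk F_expand[of j] by linarith+
  have ix: "ix n = j + 3" using lt by (intro ix_eq) simp_all
  have "(THE i. i \<ge> 3 \<and> fib_word i < wpre n \<and> wpre n < fib_word (i + 1)) = j + 3"
  proof (rule the_equality)
    show "j + 3 \<ge> 3 \<and> fib_word (j + 3) < wpre n \<and> wpre n < fib_word (j + 3 + 1)"
      using lt by (simp flip: wpre_F add: wpre_less)
    fix i assume i: "i \<ge> 3 \<and> fib_word i < wpre n \<and> wpre n < fib_word (i + 1)"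
    then have "wpre (F i) < wpre n" "wpre n < wpre (F (Suc i))" by (simp_all add: wpre_F)
    then have "F i < n" "n < F (Suc i)" by (simp_all add: wpre_less)
    then show "i = j + 3" using lt i by (intro F_block_unique[of i n "j + 3"]) simp_all
  qed
  then have "iota (wpre n) = take (n - 2 * fib (j + 3 - 1)) (wpre n)"
    using False wpre_in_Fib_words by (simp add: iota_def Let_def length_wpre)
  also have "fib (j + 3 - 1) = F (ix n - 2)" by (simp add: ix F_def)
  finally show ?thesis using False by (simp add: take_wpre)
qed

text \<open>The iterates become constant by induction along \<iota>, and an eventual value is
  unique, which resolves the \<open>THE\<close>.\<close>

lemma alpha_wpre: "alpha (wpre n) = wpre (al n)"
proof -
  have ev: "\<exists>K. \<forall>k\<ge>K. (iota ^^ k) (wpre n) = wpre (al n)"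
  proof (induction n rule: less_induct)
    case (less n)
    show ?case
    proof (cases "n = 0 \<or> n \<in> range F")
      case True
      then have "(iota ^^ k) (wpre n) = wpre n" for k
        by (induction k) (simp_all add: iota_wpre)
      then show ?thesis using True by (simp add: al.simps[of n])
    next
      case False
      define n0 where "n0 = n - 2 * F (ix n - 2)"
      have "n0 < n" using F_pos[of "ix n - 2"] False by (simp add: n0_def)
      then obtain K where K: "\<forall>k\<ge>K. (iota ^^ k) (wpre n0) = wpre (al n0)"
        using less.IH by blast
      have "al n = al n0" using False by (simp add: al.simps[of n] n0_def)
      moreover have "(iota ^^ Suc k) (wpre n) = (iota ^^ k) (wpre n0)" for k
        using False by (simp add: iota_wpre n0_def funpow_swap1 del: funpow.simps) (simp add: funpow_swap1 iota_wpre)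
      ultimately have "\<forall>k\<ge>Suc K. (iota ^^ k) (wpre n) = wpre (al n)"
        using K by (metis Suc_le_D Suc_le_mono)
      then show ?thesis by blast
    qed
  qed
  have "(\<forall>\<^sub>F k in sequentially. (iota ^^ k) (wpre n) = u) \<longleftrightarrow> u = wpre (al n)" for u
  proof
    assume "\<forall>\<^sub>F k in sequentially. (iota ^^ k) (wpre n) = u"
    then obtain K' where "\<forall>k\<ge>K'. (iota ^^ k) (wpre n) = u" by (auto simp: eventually_sequentially)
    moreover obtain K where "\<forall>k\<ge>K. (iota ^^ k) (wpre n) = wpre (al n)" using ev by blast
    ultimately show "u = wpre (al n)" by (metis max.cobounded1 max.cobounded2)
  qed (use ev in \<open>auto simp: eventually_sequentially\<close>)
  then show ?thesis unfolding alpha_def by simp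
qed

lemma A_set_wpre: "q \<in> A_set (wpre n) \<longleftrightarrow> real n \<le> q $ 1 / 2 \<and> excess n \<le> q $ 1 - q $ 2"
  by (auto simp: A_set_def P_word_def length_wpre alpha_wpre excess_def max_def)

lemma C_set_wpre: "q \<in> C_set (wpre n) \<longleftrightarrow> q $ 1 / 2 \<le> real n \<and> q $ 2 \<le> reach n"
  by (auto simp: C_set_def P_word_def length_wpre alpha_wpre reach_def max_def)

text \<open>Both words exist: length 0 qualifies for u because q lies in A(\<epsilon>), and lengths
  above h do not; every sufficiently large Fibonacci length qualifies for w.\<close>

lemma P_map_bracket:
  assumes "q \<in> A_set []"
  obtains n n' where "bracket (q $ 1 / 2) (q $ 1 - q $ 2) n n'"
    "P_map q = Phi (vector [q $ 1 - real n, q $ 2 + real n - real n', real n'])"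
proof -
  define h where "h = q $ 1 / 2"
  define \<delta> where "\<delta> = q $ 1 - q $ 2"
  have pos: "0 \<le> h" "0 \<le> \<delta>" using assms by (simp_all add: A_set_Nil h_def \<delta>_def)
  have q2: "q $ 2 = 2 * h - \<delta>" by (simp add: h_def \<delta>_def)
  define PA where "PA k \<longleftrightarrow> real k \<le> h \<and> excess k \<le> \<delta>" for k
  define n where "n = (GREATEST k. PA k)"
  have PA0: "PA 0" using pos by (simp add: PA_def excess_def al_0)
  have PAb: "k \<le> nat \<lfloor>h\<rfloor>" if "PA k" for k using that by (simp add: PA_def le_nat_iff le_floor_iff)
  have n: "PA n" "\<And>k. PA k \<Longrightarrow> k \<le> n"
    unfolding n_def using GreatestI_nat[of PA, OF PA0 PAb] Greatest_le_nat[of PA, OF _ PAb] by blast+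
  have A: "wpre k \<in> winf_prefixes \<and> q \<in> A_set (wpre k) \<longleftrightarrow> PA k" for k
    by (simp add: A_set_wpre winf_prefixes_eq PA_def h_def \<delta>_def)
  have u: "(GREATEST u. u \<in> winf_prefixes \<and> q \<in> A_set u) = wpre n"
  proof (rule Greatest_equality)
    show "wpre n \<in> winf_prefixes \<and> q \<in> A_set (wpre n)" using n(1) A by blast
    fix y assume y: "y \<in> winf_prefixes \<and> q \<in> A_set y"
    then obtain k where k: "y = wpre k" by (auto simp: winf_prefixes_eq)
    then have "PA k" using y A by blast
    then show "y \<le> wpre n" using n(2) by (simp add: k wpre_le)
  qed
  define PC where "PC k \<longleftrightarrow> n < k \<and> h \<le> real k \<and> 2 * h - \<delta> \<le> reach k" for k
  define n' where "n' = (LEAST k. PC k)"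
  obtain i where "n + nat \<lceil>h\<rceil> < F i" using F_ge[of "Suc (n + nat \<lceil>h\<rceil>)"] Suc_le_lessD by blast
  then have "n < F i" "h \<le> real (F i)" by linarith+
  then have "PC (F i)" using pos by (simp add: PC_def reach_F)
  then have n': "PC n'" "\<And>k. PC k \<Longrightarrow> n' \<le> k"
    unfolding n'_def by (auto intro: LeastI Least_le)
  have C: "wpre k \<in> winf_prefixes \<and> wpre n < wpre k \<and> q \<in> C_set (wpre k) \<longleftrightarrow> PC k" for k
    by (auto simp: C_set_wpre winf_prefixes_eq PC_def h_def \<delta>_def wpre_less)
  have w: "(LEAST w. w \<in> winf_prefixes \<and> wpre n < w \<and> q \<in> C_set w) = wpre n'"
  proof (rule Least_equality)
    show "wpre n' \<in> winf_prefixes \<and> wpre n < wpre n' \<and> q \<in> C_set (wpre n')" using n'(1) C by blast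
    fix y assume y: "y \<in> winf_prefixes \<and> wpre n < y \<and> q \<in> C_set y"
    then obtain k where k: "y = wpre k" by (auto simp: winf_prefixes_eq)
    then have "PC k" using y C by blast
    then show "wpre n' \<le> y" using n'(2) by (simp add: k wpre_le)
  qed
  have "bracket h \<delta> n n'"
    unfolding bracket_def using pos n n' by (auto simp: PA_def PC_def not_le not_less)
       (use n(2) in \<open>fastforce simp: PA_def\<close>, use n'(2) in \<open>fastforce simp: PC_def\<close>)
  moreover have "P_map q = Phi (vector [q $ 1 - real n, q $ 2 + real n - real n', real n'])"
    unfolding P_map_def u Let_def w by (simp add: length_wpre)
  ultimately show ?thesis using that unfolding h_def \<delta>_def by blast
qed

section \<open>Successive minima\<close>

lemma infnorm_3_le:
  fixes x :: "real^3"
  assumes "\<bar>x $ 1\<bar> \<le> c" "\<bar>x $ 2\<bar> \<le> c" "\<bar>x $ 3\<bar> \<le> c"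
  shows "infnorm x \<le> c"
  unfolding infnorm_cart using assms exhaust_3 by (intro cSup_least) (auto, metis)

lemma L_solutions_mono: "s \<le> t \<Longrightarrow> L_solutions \<xi> q s \<subseteq> L_solutions \<xi> q t"
  unfolding L_solutions_def by (auto intro: order_trans)

lemma finite_integer_box: "finite {x :: real^3. \<forall>k. x $ k \<in> \<int> \<and> \<bar>x $ k\<bar> \<le> B}"
proof -
  define N where "N = \<lceil>B\<rceil>"
  have "{x :: real^3. \<forall>k. x $ k \<in> \<int> \<and> \<bar>x $ k\<bar> \<le> B}
      \<subseteq> (\<lambda>(a, b, c). vector [of_int a, of_int b, of_int c]) ` ({-N..N} \<times> {-N..N} \<times> {-N..N})"
  proof
    fix x :: "real^3" assume x: "x \<in> {x. \<forall>k. x $ k \<in> \<int> \<and> \<bar>x $ k\<bar> \<le> B}"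
    have "\<exists>a. x $ k = of_int a \<and> a \<in> {-N..N}" for k
    proof -
      obtain a where a: "x $ k = of_int a" using x by (auto elim: Ints_cases)
      have "\<bar>real_of_int a\<bar> \<le> B" using x a by (metis (mono_tags, lifting) mem_Collect_eq)
      then have "a \<in> {-N..N}" unfolding N_def by (auto simp: abs_le_iff) linarith+
      then show ?thesis using a by blast
    qed
    then obtain a where a: "\<And>k. x $ k = of_int (a k)" "\<And>k. a k \<in> {-N..N}" by metis
    have "x = (\<lambda>(a, b, c). vector [of_int a, of_int b, of_int c]) (a 1, a 2, a 3)"
      by (simp add: vec_eq_iff forall_3 a(1) vector_3)
    then show "x \<in> (\<lambda>(a, b, c). vector [of_int a, of_int b, of_int c]) ` ({-N..N} \<times> {-N..N} \<times> {-N..N})"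
      using a(2) by blast
  qed
  then show ?thesis by (rule finite_subset) simp
qed

lemma finite_L_solutions: "finite (L_solutions \<xi> q t)"
proof -
  define B where "B = exp t * (1 + \<bar>\<xi> $ 2\<bar> + \<bar>\<xi> $ 3\<bar>) + exp (t - q $ 1) + exp (t - q $ 2)"
  have "\<bar>x $ k\<bar> \<le> B" if x: "x \<in> L_solutions \<xi> q t" for x k
  proof -
    have 1: "\<bar>x $ 1\<bar> \<le> exp t" "\<bar>x $ 1 * \<xi> $ 2 - x $ 2\<bar> \<le> exp (t - q $ 1)"
      "\<bar>x $ 1 * \<xi> $ 3 - x $ 3\<bar> \<le> exp (t - q $ 2)"
      using x by (simp_all add: L_solutions_def)
    have 2: "\<bar>x $ 1 * \<xi> $ i\<bar> \<le> exp t * \<bar>\<xi> $ i\<bar>" for i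
      using 1(1) by (simp add: abs_mult mult_right_mono)
    have 3: "0 \<le> exp t * \<bar>\<xi> $ i\<bar>" for i by simp
    have e: "exp (t - q $ i) > 0" for i by simp
    have "\<bar>x $ 1\<bar> \<le> B" "\<bar>x $ 2\<bar> \<le> B" "\<bar>x $ 3\<bar> \<le> B"
      using 1 2[of 2] 2[of 3] 3[of 2] 3[of 3] e[of 1] e[of 2] exp_gt_zero[of t]
      unfolding B_def by (simp_all only: distrib_left) linarith+
    then show ?thesis using exhaust_3[of k] by auto
  qed
  then have "L_solutions \<xi> q t \<subseteq> {x. \<forall>k. x $ k \<in> \<int> \<and> \<bar>x $ k\<bar> \<le> B}"
    by (auto simp: L_solutions_def)
  then show ?thesis using finite_integer_box finite_subset by blast
qed

definition indep_at :: "real^3 \<Rightarrow> real^2 \<Rightarrow> nat \<Rightarrow> real \<Rightarrow> bool" where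
  "indep_at \<xi> q j t \<longleftrightarrow> (\<exists>S \<subseteq> L_solutions \<xi> q t. independent S \<and> card S = j)"

text \<open>The smallest \<open>t\<close> for which a nonzero \<open>x\<close> satisfies the inequalities; thus the minima are
  attained, and the description of \<open>L_min\<close> by \<open>LEAST\<close> is meaningful.\<close>

definition level :: "real^3 \<Rightarrow> real^2 \<Rightarrow> real^3 \<Rightarrow> real" where
  "level \<xi> q x = ln (max \<bar>x $ 1\<bar> (max (\<bar>x $ 1 * \<xi> $ 2 - x $ 2\<bar> * exp (q $ 1))
     (\<bar>x $ 1 * \<xi> $ 3 - x $ 3\<bar> * exp (q $ 2))))"

lemma mem_L_solutions_iff_level:
  assumes "x \<noteq> 0"
  shows "x \<in> L_solutions \<xi> q t \<longleftrightarrow> (\<forall>k. x $ k \<in> \<int>) \<and> level \<xi> q x \<le> t"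
proof -
  let ?m = "max \<bar>x $ 1\<bar> (max (\<bar>x $ 1 * \<xi> $ 2 - x $ 2\<bar> * exp (q $ 1))
     (\<bar>x $ 1 * \<xi> $ 3 - x $ 3\<bar> * exp (q $ 2)))"
  have "x $ 1 \<noteq> 0 \<or> x $ 1 * \<xi> $ 2 - x $ 2 \<noteq> 0 \<or> x $ 1 * \<xi> $ 3 - x $ 3 \<noteq> 0"
    using assms by (auto simp: vec_eq_iff forall_3)
  then have "?m > 0" by (auto simp: less_max_iff_disj)
  then have "level \<xi> q x \<le> t \<longleftrightarrow> ?m \<le> exp t"
    unfolding level_def by (metis exp_le_cancel_iff exp_ln)
  then show ?thesis
    by (auto simp: L_solutions_def exp_diff pos_le_divide_eq)
qed

text \<open>Only finitely many independent sets of size j occur at level t0, and each consists of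
  solutions exactly from its largest \<open>level\<close> on. The minimum over them is the required
  least value.\<close>

lemma L_min_attained:
  assumes "indep_at \<xi> q j t0" "1 \<le> j"
  shows "indep_at \<xi> q j (L_min \<xi> j q)" "indep_at \<xi> q j t \<Longrightarrow> L_min \<xi> j q \<le> t"
proof -
  define SS where "SS = {S. S \<subseteq> L_solutions \<xi> q t0 \<and> independent S \<and> card S = j}"
  define T where "T S = Max (level \<xi> q ` S)" for S
  define t1 where "t1 = Min (T ` SS)"
  have fin: "finite SS" unfolding SS_def
    by (rule finite_subset[of _ "Pow (L_solutions \<xi> q t0)"]) (auto simp: finite_L_solutions)
  have ne: "SS \<noteq> {}" using assms by (auto simp: SS_def indep_at_def)
  have S_props: "finite S" "S \<noteq> {}" "0 \<notin> S" if "S \<in> SS" for S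
    using that assms(2) dependent_zero finite_L_solutions finite_subset
    by (fastforce simp: SS_def)+
  have le: "T S \<le> t \<longleftrightarrow> S \<subseteq> L_solutions \<xi> q t" if S: "S \<in> SS" for S t
  proof -
    have "x \<in> L_solutions \<xi> q t \<longleftrightarrow> level \<xi> q x \<le> t" if "x \<in> S" for x
    proof -
      have "x \<noteq> 0" using S_props(3)[OF S] that by auto
      moreover have "x \<in> L_solutions \<xi> q t0" using S that by (auto simp: SS_def)
      ultimately show ?thesis using mem_L_solutions_iff_level by blast
    qed
    then show ?thesis using S_props[OF S] by (auto simp: T_def)
  qed
  have "t1 \<in> T ` SS"
    unfolding t1_def using fin ne by (intro Min_in) simp_all
  then obtain S1 where S1: "S1 \<in> SS" "T S1 = t1"
    by (metis imageE)
  have P1: "indep_at \<xi> q j t1"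
    using le[OF S1(1), of t1] S1 by (auto simp: indep_at_def SS_def)
  have P2: "t1 \<le> t" if t: "indep_at \<xi> q j t" for t
  proof (cases "t0 \<le> t")
    case True
    have "T S1 \<le> t0" using le[OF S1(1)] S1(1) by (simp add: SS_def)
    then show ?thesis using True S1(2) by simp
  next
    case False
    obtain S where S: "S \<subseteq> L_solutions \<xi> q t" "independent S" "card S = j"
      using t by (auto simp: indep_at_def)
    then have "S \<in> SS" using L_solutions_mono[of t t0 \<xi> q] False by (auto simp: SS_def)
    then have "T S \<le> t" using le S(1) by blast
    moreover have "t1 \<le> T S" unfolding t1_def using fin \<open>S \<in> SS\<close> by simp
    ultimately show ?thesis by simp
  qed
  have "L_min \<xi> j q = t1"
    unfolding L_min_def indep_at_def[symmetric] using P1 P2 by (intro Least_equality) auto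
  then show "indep_at \<xi> q j (L_min \<xi> j q)" "indep_at \<xi> q j t \<Longrightarrow> L_min \<xi> j q \<le> t"
    using P1 P2 by auto
qed

text \<open>Steinitz exchange. It yields one triple whose members come from the three different
  levels, so that the determinant is bounded by the sum of the minima and not by three times the
  last.\<close>

lemma independent_transversal:
  fixes S1 S2 S3 :: "(real^3) set"
  assumes "independent S1" "card S1 = 1" "independent S2" "card S2 = 2" "independent S3" "card S3 = 3"
  obtains x y z where "x \<in> S1" "y \<in> S2" "z \<in> S3" "independent {x, y, z}" "x \<noteq> y" "x \<noteq> z" "y \<noteq> z"
proof -
  obtain x where x: "S1 = {x}" using assms(2) card_1_singletonE by blast
  have "\<not> S2 \<subseteq> span {x}"
    using independent_span_bound[of "{x}" S2] assms by auto
  then obtain y where y: "y \<in> S2" "y \<notin> span {x}" by blast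
  then have xy: "independent {y, x}" using assms(1) x independent_insertI by blast
  have "y \<noteq> x" using y(2) span_base by blast
  then have "card {y, x} = 2" by simp
  then have "\<not> S3 \<subseteq> span {y, x}"
    using independent_span_bound[of "{y, x}" S3] assms by auto
  then obtain z where z: "z \<in> S3" "z \<notin> span {y, x}" by blast
  then have "independent {z, y, x}" using xy independent_insertI by blast
  moreover have "z \<noteq> y" "z \<noteq> x" using z(2) span_base by blast+
  ultimately show ?thesis using that[of x y z] x y z \<open>y \<noteq> x\<close> by (simp add: insert_commute)
qed

definition det3 :: "real^3 \<Rightarrow> real^3 \<Rightarrow> real^3 \<Rightarrow> real" where
  "det3 x y z = x $ 1 * (y $ 2 * z $ 3 - y $ 3 * z $ 2) - x $ 2 * (y $ 1 * z $ 3 - y $ 3 * z $ 1)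
     + x $ 3 * (y $ 1 * z $ 2 - y $ 2 * z $ 1)"

lemma det3_nonzero:
  assumes "independent {x, y, z}" "x \<noteq> y" "x \<noteq> z" "y \<noteq> z"
  shows "det3 x y z \<noteq> 0"
proof -
  let ?A = "vector [x, y, z] :: real^3^3"
  have "\<forall>c. (\<Sum>i\<in>UNIV. c i *s row i ?A) = 0 \<longrightarrow> (\<forall>i. c i = 0)"
  proof (intro allI impI)
    fix c :: "3 \<Rightarrow> real" and i
    assume c: "(\<Sum>i\<in>UNIV. c i *s row i ?A) = 0"
    define u where "u v = (if v = x then c 1 else if v = y then c 2 else c 3)" for v
    have "c 1 *\<^sub>R x + (c 2 *\<^sub>R y + c 3 *\<^sub>R z) = 0"
      using c by (simp add: sum_3 row_def vec_eq_iff forall_3 vector_3 add.assoc)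
    moreover have "(\<Sum>v\<in>{x, y, z}. u v *\<^sub>R v) = c 1 *\<^sub>R x + (c 2 *\<^sub>R y + c 3 *\<^sub>R z)"
      using assms(2-4) assms(2-4)[symmetric] by (simp add: u_def)
    ultimately have "(\<Sum>v\<in>{x, y, z}. u v *\<^sub>R v) = 0" by simp
    then have "\<forall>v\<in>{x, y, z}. u v = 0"
      using assms(1) by (subst (asm) independent_explicit) (auto dest: spec[of _ u])
    then show "c i = 0" using assms exhaust_3[of i] by (auto simp: u_def split: if_splits)
  qed
  then have "\<exists>B. ?A ** B = mat 1"
    using matrix_right_invertible_independent_rows by blast
  then have "det ?A \<noteq> 0"
    using invertible_det_nz invertible_right_inverse by blast
  then show ?thesis by (simp add: det_3 det3_def vector_3 algebra_simps)
qed

lemma det3_le: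
  assumes "x \<in> L_solutions \<xi> q s" "y \<in> L_solutions \<xi> q t" "z \<in> L_solutions \<xi> q u"
  shows "\<bar>det3 x y z\<bar> \<le> 6 * exp (s + t + u - q $ 1 - q $ 2)"
proof -
  define a where "a v = v $ 1 * \<xi> $ 2 - v $ 2" for v :: "real^3"
  define b where "b v = v $ 1 * \<xi> $ 3 - v $ 3" for v :: "real^3"
  \<comment> \<open>Column operations with \<xi> replace the second and third columns by the small
    linear forms. Each of the six terms then has one factor from every column, hence the same
    exponential bound.\<close>
  have det: "det3 x y z = x $ 1 * a y * b z - x $ 1 * b y * a z - a x * y $ 1 * b z + a x * b y * z $ 1
      + b x * y $ 1 * a z - b x * a y * z $ 1"
    by (simp add: det3_def a_def b_def algebra_simps)
  have x: "\<bar>x $ 1\<bar> \<le> exp s" "\<bar>a x\<bar> \<le> exp (s - q $ 1)" "\<bar>b x\<bar> \<le> exp (s - q $ 2)"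
    and y: "\<bar>y $ 1\<bar> \<le> exp t" "\<bar>a y\<bar> \<le> exp (t - q $ 1)" "\<bar>b y\<bar> \<le> exp (t - q $ 2)"
    and z: "\<bar>z $ 1\<bar> \<le> exp u" "\<bar>a z\<bar> \<le> exp (u - q $ 1)" "\<bar>b z\<bar> \<le> exp (u - q $ 2)"
    using assms by (simp_all add: L_solutions_def a_def b_def)
  let ?E = "exp (s + t + u - q $ 1 - q $ 2)"
  have prod: "\<bar>c * d * e\<bar> \<le> ?E"
    if "\<bar>c\<bar> \<le> exp c'" "\<bar>d\<bar> \<le> exp d'" "\<bar>e\<bar> \<le> exp e'" "c' + d' + e' = s + t + u - q $ 1 - q $ 2"
    for c d e c' d' e'
  proof -
    have "\<bar>c * d * e\<bar> \<le> exp c' * exp d' * exp e'"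
      unfolding abs_mult using that by (intro mult_mono) auto
    then show ?thesis using that(4) by (simp flip: exp_add)
  qed
  have "\<bar>x $ 1 * a y * b z\<bar> \<le> ?E" by (rule prod[OF x(1) y(2) z(3)]) simp
  moreover have "\<bar>x $ 1 * b y * a z\<bar> \<le> ?E" by (rule prod[OF x(1) y(3) z(2)]) simp
  moreover have "\<bar>a x * y $ 1 * b z\<bar> \<le> ?E" by (rule prod[OF x(2) y(1) z(3)]) simp
  moreover have "\<bar>a x * b y * z $ 1\<bar> \<le> ?E" by (rule prod[OF x(2) y(3) z(1)]) simp
  moreover have "\<bar>b x * y $ 1 * a z\<bar> \<le> ?E" by (rule prod[OF x(3) y(1) z(2)]) simp
  moreover have "\<bar>b x * a y * z $ 1\<bar> \<le> ?E" by (rule prod[OF x(3) y(2) z(1)]) simp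
  ultimately show ?thesis unfolding det by linarith
qed

lemma L_min_sum_ge:
  assumes "indep_at \<xi> q 1 t1" "indep_at \<xi> q 2 t2" "indep_at \<xi> q 3 t3"
  shows "q $ 1 + q $ 2 - ln 6 \<le> t1 + t2 + t3"
proof -
  obtain S1 S2 S3 where S: "S1 \<subseteq> L_solutions \<xi> q t1" "independent S1" "card S1 = 1"
    "S2 \<subseteq> L_solutions \<xi> q t2" "independent S2" "card S2 = 2"
    "S3 \<subseteq> L_solutions \<xi> q t3" "independent S3" "card S3 = 3"
    using assms by (auto simp: indep_at_def)
  obtain x y z where xyz: "x \<in> S1" "y \<in> S2" "z \<in> S3" "independent {x, y, z}"
    "x \<noteq> y" "x \<noteq> z" "y \<noteq> z"
    using independent_transversal[OF S(2,3,5,6,8,9)] .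
  have sol: "x \<in> L_solutions \<xi> q t1" "y \<in> L_solutions \<xi> q t2" "z \<in> L_solutions \<xi> q t3"
    using xyz S by auto
  have "det3 x y z \<in> \<int>"
    using sol by (auto simp: det3_def L_solutions_def intro!: Ints_add Ints_diff Ints_mult)
  moreover have "det3 x y z \<noteq> 0" by (rule det3_nonzero[OF xyz(4-7)])
  ultimately have "1 \<le> \<bar>det3 x y z\<bar>" by (rule Ints_nonzero_abs_ge1)
  also have "\<dots> \<le> 6 * exp (t1 + t2 + t3 - q $ 1 - q $ 2)"
    by (rule det3_le[OF sol])
  also have "\<dots> = exp (ln 6 + (t1 + t2 + t3 - q $ 1 - q $ 2))" by (simp add: exp_add exp_diff)
  finally show ?thesis by (simp add: one_le_exp_iff)
qed

text \<open>Given upper bounds for all three minima, the lower bound for their sum gives one for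
  each of them. The factor 2 comes from the other two upper bounds.\<close>

lemma L_map_close_sorted:
  assumes indep: "\<And>\<alpha> \<beta> \<gamma>. \<alpha> *\<^sub>R X + \<beta> *\<^sub>R Y + \<gamma> *\<^sub>R Z = 0 \<Longrightarrow> \<alpha> = 0 \<and> \<beta> = 0 \<and> \<gamma> = 0"
    and sol: "X \<in> L_solutions \<xi> q (p1 + C)" "Y \<in> L_solutions \<xi> q (p2 + C)" "Z \<in> L_solutions \<xi> q (p3 + C)"
    and sum: "p1 + p2 + p3 = q $ 1 + q $ 2" and C: "0 \<le> C" and sorted: "p1 \<le> p2" "p2 \<le> p3"
  shows "infnorm (L_map \<xi> q - Phi (vector [p1, p2, p3])) \<le> 2 * C + ln 6"
proof -
  have ne: "X \<noteq> Y" "X \<noteq> Z" "Y \<noteq> Z"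
    using indep[of 1 "-1" 0] indep[of 1 0 "-1"] indep[of 0 1 "-1"] by auto
  have ind: "independent {X, Y, Z}"
    unfolding independent_explicit
  proof (intro conjI allI impI ballI)
    fix u v assume *: "(\<Sum>v\<in>{X, Y, Z}. u v *\<^sub>R v) = 0" "v \<in> {X, Y, Z}"
    then have "u X *\<^sub>R X + u Y *\<^sub>R Y + u Z *\<^sub>R Z = 0" using ne by (simp add: add.assoc)
    from indep[OF this] show "u v = 0" using *(2) by auto
  qed simp
  have 1: "indep_at \<xi> q 1 (p1 + C)"
    unfolding indep_at_def using sol independent_mono[OF ind, of "{X}"] by (intro exI[of _ "{X}"]) auto
  have 2: "indep_at \<xi> q 2 (p2 + C)"
    unfolding indep_at_def
    using sol independent_mono[OF ind, of "{X, Y}"] ne L_solutions_mono[of "p1 + C" "p2 + C" \<xi> q] sorted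
    by (intro exI[of _ "{X, Y}"]) auto
  have 3: "indep_at \<xi> q 3 (p3 + C)"
    unfolding indep_at_def
    using sol ind ne L_solutions_mono[of "p1 + C" "p3 + C" \<xi> q] L_solutions_mono[of "p2 + C" "p3 + C" \<xi> q]
      sorted
    by (intro exI[of _ "{X, Y, Z}"]) auto
  have up: "L_min \<xi> 1 q \<le> p1 + C" "L_min \<xi> 2 q \<le> p2 + C" "L_min \<xi> 3 q \<le> p3 + C"
    using L_min_attained(2)[OF 1 _ 1] L_min_attained(2)[OF 2 _ 2] L_min_attained(2)[OF 3 _ 3] by simp_all
  have "q $ 1 + q $ 2 - ln 6 \<le> L_min \<xi> 1 q + L_min \<xi> 2 q + L_min \<xi> 3 q"
    by (intro L_min_sum_ge[where \<xi> = \<xi>] L_min_attained(1)[OF 1] L_min_attained(1)[OF 2]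
      L_min_attained(1)[OF 3]) simp_all
  moreover have "0 \<le> ln (6 :: real)" by simp
  ultimately have "\<bar>L_min \<xi> 1 q - p1\<bar> \<le> 2 * C + ln 6" "\<bar>L_min \<xi> 2 q - p2\<bar> \<le> 2 * C + ln 6"
    "\<bar>L_min \<xi> 3 q - p3\<bar> \<le> 2 * C + ln 6"
    using up sum C by linarith+
  moreover have "Phi (vector [p1, p2, p3]) = vector [p1, p2, p3]"
    using sorted by (simp add: Phi_def)
  ultimately show ?thesis
    by (intro infnorm_3_le) (simp_all only: L_map_def vector_minus_component vector_3)
qed

text \<open>The predicted heights come in no fixed order, but \<open>Phi\<close> depends only on
  their multiset, so the points may be permuted.\<close>

lemma L_map_close:
  assumes indep: "\<And>\<alpha> \<beta> \<gamma>. \<alpha> *\<^sub>R X + \<beta> *\<^sub>R Y + \<gamma> *\<^sub>R Z = 0 \<Longrightarrow> \<alpha> = 0 \<and> \<beta> = 0 \<and> \<gamma> = 0"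
    and sol: "X \<in> L_solutions \<xi> q (p1 + C)" "Y \<in> L_solutions \<xi> q (p2 + C)" "Z \<in> L_solutions \<xi> q (p3 + C)"
    and sum: "p1 + p2 + p3 = q $ 1 + q $ 2" and C: "0 \<le> C"
  shows "infnorm (L_map \<xi> q - Phi (vector [p1, p2, p3])) \<le> 2 * C + ln 6"
proof -
  have Phi_eq: "Phi (vector [a, b, c]) = Phi (vector [a', b', c'])"
    if "mset [a, b, c] = mset [a', b', c']" for a b c a' b' c' :: real
  proof -
    have "sort [a, b, c] = sort [a', b', c']"
      using that by (intro properties_for_sort) simp_all
    then show ?thesis by (simp add: Phi_def)
  qed
  have i2: "\<alpha> = 0 \<and> \<beta> = 0 \<and> \<gamma> = 0" if "\<alpha> *\<^sub>R X + \<beta> *\<^sub>R Z + \<gamma> *\<^sub>R Y = 0" for \<alpha> \<beta> \<gamma>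
    using indep[of \<alpha> \<gamma> \<beta>] that by (simp add: ac_simps)
  have i3: "\<alpha> = 0 \<and> \<beta> = 0 \<and> \<gamma> = 0" if "\<alpha> *\<^sub>R Y + \<beta> *\<^sub>R X + \<gamma> *\<^sub>R Z = 0" for \<alpha> \<beta> \<gamma>
    using indep[of \<beta> \<alpha> \<gamma>] that by (simp add: ac_simps)
  have i4: "\<alpha> = 0 \<and> \<beta> = 0 \<and> \<gamma> = 0" if "\<alpha> *\<^sub>R Y + \<beta> *\<^sub>R Z + \<gamma> *\<^sub>R X = 0" for \<alpha> \<beta> \<gamma>
    using indep[of \<gamma> \<alpha> \<beta>] that by (simp add: ac_simps)
  have i5: "\<alpha> = 0 \<and> \<beta> = 0 \<and> \<gamma> = 0" if "\<alpha> *\<^sub>R Z + \<beta> *\<^sub>R X + \<gamma> *\<^sub>R Y = 0" for \<alpha> \<beta> \<gamma>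
    using indep[of \<beta> \<gamma> \<alpha>] that by (simp add: ac_simps)
  have i6: "\<alpha> = 0 \<and> \<beta> = 0 \<and> \<gamma> = 0" if "\<alpha> *\<^sub>R Z + \<beta> *\<^sub>R Y + \<gamma> *\<^sub>R X = 0" for \<alpha> \<beta> \<gamma>
    using indep[of \<gamma> \<beta> \<alpha>] that by (simp add: ac_simps)
  consider "p1 \<le> p2" "p2 \<le> p3" | "p1 \<le> p3" "p3 \<le> p2" | "p2 \<le> p1" "p1 \<le> p3"
    | "p2 \<le> p3" "p3 \<le> p1" | "p3 \<le> p1" "p1 \<le> p2" | "p3 \<le> p2" "p2 \<le> p1"
    by linarith
  then show ?thesis
  proof cases
    case 1
    then show ?thesis using L_map_close_sorted[OF indep sol sum C] by blast
  next
    case 2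
    have "infnorm (L_map \<xi> q - Phi (vector [p1, p3, p2])) \<le> 2 * C + ln 6"
      by (rule L_map_close_sorted[OF i2 sol(1,3,2)]) (use 2 sum C in simp_all)
    then show ?thesis using Phi_eq[of p1 p3 p2 p1 p2 p3] by simp
  next
    case 3
    have "infnorm (L_map \<xi> q - Phi (vector [p2, p1, p3])) \<le> 2 * C + ln 6"
      by (rule L_map_close_sorted[OF i3 sol(2,1,3)]) (use 3 sum C in simp_all)
    then show ?thesis using Phi_eq[of p2 p1 p3 p1 p2 p3] by simp
  next
    case 4
    have "infnorm (L_map \<xi> q - Phi (vector [p2, p3, p1])) \<le> 2 * C + ln 6"
      by (rule L_map_close_sorted[OF i4 sol(2,3,1)]) (use 4 sum C in simp_all)
    then show ?thesis using Phi_eq[of p2 p3 p1 p1 p2 p3] by simp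
  next
    case 5
    have "infnorm (L_map \<xi> q - Phi (vector [p3, p1, p2])) \<le> 2 * C + ln 6"
      by (rule L_map_close_sorted[OF i5 sol(3,1,2)]) (use 5 sum C in simp_all)
    then show ?thesis using Phi_eq[of p3 p1 p2 p1 p2 p3] by simp
  next
    case 6
    have "infnorm (L_map \<xi> q - Phi (vector [p3, p2, p1])) \<le> 2 * C + ln 6"
      by (rule L_map_close_sorted[OF i6 sol(3,2,1)]) (use 6 sum C in simp_all)
    then show ?thesis using Phi_eq[of p3 p2 p1 p1 p2 p3] by simp
  qed
qed

section \<open>Points attached to prefixes\<close>

text \<open>This sign unifies M and its transpose: M_i has rows (m, \<open>sg i\<close>) and
  (-\<open>sg i\<close>, 0).\<close>

definition sg :: "nat \<Rightarrow> real" where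
  "sg i = (-1) ^ i"

lemma sg_simps [simp]: "sg (Suc i) = - sg i" "sg (i + 1) = - sg i" "sg (i + 2) = sg i"
  "sg (i + 3) = - sg i" "sg (i + 4) = sg i" "sg (i + 5) = - sg i" "sg (i + 6) = sg i"
  by (simp_all add: sg_def eval_nat_numeral)

lemma sg_square [simp]: "sg i * sg i = 1" "sg i * (sg i * x) = x"
proof -
  show "sg i * sg i = 1" by (simp add: sg_def flip: power_add mult_2)
  then show "sg i * (sg i * x) = x" by (simp flip: mult.assoc)
qed

text \<open>The entries of the symmetric matrices \<open>X\<^sub>i\<close> with \<open>W\<^sub>i = X\<^sub>i M\<^sub>i\<close> are \<open>y0 i, y1 i, y1 i, y2 i\<close>. The
  four recursions are the entries of \<open>X\<^sub>i\<^sub>+\<^sub>2 = X\<^sub>i\<^sub>+\<^sub>1 M\<^sub>i\<^sub>+\<^sub>1 X\<^sub>i\<close>.\<close>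

locale sym_data =
  fixes m \<xi> :: real and y0 y1 y2 \<epsilon> :: "nat \<Rightarrow> real"
  assumes ints: "m \<in> \<int>" "1 \<le> i \<Longrightarrow> y0 i \<in> \<int>" "1 \<le> i \<Longrightarrow> y1 i \<in> \<int>" "1 \<le> i \<Longrightarrow> y2 i \<in> \<int>"
    and det: "1 \<le> i \<Longrightarrow> y0 i * y2 i - y1 i * y1 i = \<epsilon> i"
    and eps: "1 \<le> i \<Longrightarrow> \<epsilon> i = 1 \<or> \<epsilon> i = -1"
    and rec0: "1 \<le> i \<Longrightarrow> y0 (i + 2) = y0 (i + 1) * (m * y0 i + sg (i + 1) * y1 i) - sg (i + 1) * y1 (i + 1) * y0 i"
    and rec1: "1 \<le> i \<Longrightarrow> y1 (i + 2) = y1 (i + 1) * (m * y0 i + sg (i + 1) * y1 i) - sg (i + 1) * y2 (i + 1) * y0 i"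
    and rec1': "1 \<le> i \<Longrightarrow> y1 (i + 2) = y0 (i + 1) * (m * y1 i + sg (i + 1) * y2 i) - sg (i + 1) * y1 (i + 1) * y1 i"
    and rec2: "1 \<le> i \<Longrightarrow> y2 (i + 2) = y1 (i + 1) * (m * y1 i + sg (i + 1) * y2 i) - sg (i + 1) * y2 (i + 1) * y1 i"
begin

text \<open>The linear map p \<mapsto> X_i M_i p on column vectors.\<close>

definition W :: "nat \<Rightarrow> real \<times> real \<Rightarrow> real \<times> real" where
  "W i p = (y0 i * (m * fst p + sg i * snd p) - sg i * y1 i * fst p,
            y1 i * (m * fst p + sg i * snd p) - sg i * y2 i * fst p)"

abbreviation c1 :: "nat \<Rightarrow> real \<times> real" where "c1 i \<equiv> (y0 i, y1 i)"
abbreviation c2 :: "nat \<Rightarrow> real \<times> real" where "c2 i \<equiv> (y1 i, y2 i)"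

text \<open>The first two formulas are the columns of X_{i+2} = X_{i+1} M_{i+1} X_i. The others come
  from transposing this: the X are symmetric and the transpose of M_{i+1} is M_i.\<close>

lemma W_c: "1 \<le> i \<Longrightarrow> W (i + 1) (c1 i) = c1 (i + 2)" "1 \<le> i \<Longrightarrow> W (i + 1) (c2 i) = c2 (i + 2)"
  "1 \<le> i \<Longrightarrow> W i (c1 (i + 1)) = c1 (i + 2)" "1 \<le> i \<Longrightarrow> W i (c2 (i + 1)) = c2 (i + 2)"
proof -
  assume i: "1 \<le> i"
  show "W (i + 1) (c1 i) = c1 (i + 2)" "W (i + 1) (c2 i) = c2 (i + 2)"
    using rec0[OF i] rec1[OF i] rec1'[OF i] rec2[OF i] by (simp_all add: W_def)
  show "W i (c1 (i + 1)) = c1 (i + 2)"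
    using rec0[OF i] rec1'[OF i] by (simp add: W_def algebra_simps)
  show "W i (c2 (i + 1)) = c2 (i + 2)"
    using rec1[OF i] rec2[OF i] by (simp add: W_def algebra_simps)
qed

lemma W_linear:
  "W i (a *\<^sub>R p + b *\<^sub>R q) = a *\<^sub>R W i p + b *\<^sub>R W i q"
  by (simp add: W_def algebra_simps)

lemma W_add: "W i (p + q) = W i p + W i q"
  and W_scale: "W i (a *\<^sub>R p) = a *\<^sub>R W i p"
  using W_linear[of i 1 p 1 q] W_linear[of i a p 0 q] by simp_all

lemma W_cols: "W i p = (m * fst p + sg i * snd p) *\<^sub>R c1 i - (sg i * fst p) *\<^sub>R c2 i"
  by (simp add: W_def algebra_simps)

lemma W_e2: "W i (0, 1) = sg i *\<^sub>R c1 i"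
  by (simp add: W_def algebra_simps)

lemma W_comp:
  assumes "1 \<le> i"
  shows "W (i + 2) p = W (i + 1) (W i p)"
proof -
  have "W (i + 1) (W i p) = (m * fst p + sg i * snd p) *\<^sub>R W (i + 1) (c1 i) - (sg i * fst p) *\<^sub>R W (i + 1) (c2 i)"
    using W_linear[of "i + 1" "m * fst p + sg i * snd p" "c1 i" "- (sg i * fst p)" "c2 i"]
    by (simp only: W_cols[of i p]) simp
  then show ?thesis unfolding W_c(1,2)[OF assms] using W_cols[of "i + 2" p] by simp
qed

lemma eps_nonzero: "1 \<le> i \<Longrightarrow> \<epsilon> i \<noteq> 0" and eps_abs: "1 \<le> i \<Longrightarrow> \<bar>\<epsilon> i\<bar> = 1"
  using eps by fastforce+

lemma W_inverse:
  assumes "1 \<le> i"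
  shows "\<epsilon> i * fst p = sg i * (y1 i * fst (W i p) - y0 i * snd (W i p))"
    "\<epsilon> i * snd p = (m * y0 i - sg i * y1 i) * snd (W i p) - (m * y1 i - sg i * y2 i) * fst (W i p)"
  by (simp_all add: W_def algebra_simps flip: det[OF assms])

lemma W_eq_0: "\<lbrakk>1 \<le> i; W i p = 0\<rbrakk> \<Longrightarrow> p = 0"
  using W_inverse[of i p] eps_nonzero[of i] by (simp add: prod_eq_iff)

text \<open>The trace of X_i M_i is m \<open>y0 i\<close>, and its determinant is that of X_i
  because det M_i = 1.\<close>

lemma W_Cayley_Hamilton:
  assumes "1 \<le> i"
  shows "W i (W i p) = (m * y0 i) *\<^sub>R W i p - \<epsilon> i *\<^sub>R p"
  by (simp add: W_def prod_eq_iff algebra_simps flip: det[OF assms])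

lemma eps_rec:
  assumes "1 \<le> i"
  shows "\<epsilon> (i + 2) = \<epsilon> (i + 1) * \<epsilon> i"
proof -
  have "\<epsilon> (i + 2) = fst (c1 (i + 2)) * snd (c2 (i + 2)) - snd (c1 (i + 2)) * fst (c2 (i + 2))"
    using det[of "i + 2"] by simp
  also have "\<dots> = (y0 (i + 1) * y2 (i + 1) - y1 (i + 1) * y1 (i + 1)) * (y0 i * y2 i - y1 i * y1 i)"
    unfolding W_c(1,2)[OF assms, symmetric] by (simp add: W_def algebra_simps)
  finally show ?thesis using det[OF assms] det[of "i + 1"] by simp
qed

lemma y2_rec:
  assumes "1 \<le> j"
  shows "y2 (j + 3) = m * y0 (j + 1) * y2 (j + 2) - \<epsilon> (j + 1) * y2 j"
proof -
  have "c2 (j + 3) = W (j + 1) (W (j + 1) (c2 j))"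
    using W_c(2)[OF assms] W_c(4)[of "j + 1"] by (simp add: numeral_eq_Suc)
  also have "\<dots> = (m * y0 (j + 1)) *\<^sub>R c2 (j + 2) - \<epsilon> (j + 1) *\<^sub>R c2 j"
    using W_Cayley_Hamilton[of "j + 1" "c2 j"] W_c(2)[OF assms] by simp
  finally show ?thesis by simp
qed

text \<open>Let J(a, b) = (b, -a). The last factor splits as M_{j+3} p = m (\<open>fst p\<close>)
  (1, 0) - \<open>sg j\<close> J p, and X_{j+3} is \<open>W (j + 2)\<close> applied to
  X_{j+1}.\<close>

lemma W_expand:
  "W (j + 3) p = (m * fst p) *\<^sub>R c1 (j + 3)
     - sg j *\<^sub>R W (j + 2) (y0 (j + 1) * snd p - y1 (j + 1) * fst p, y1 (j + 1) * snd p - y2 (j + 1) * fst p)"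
proof -
  have "W (j + 2) (snd p *\<^sub>R c1 (j + 1) + (- fst p) *\<^sub>R c2 (j + 1)) = snd p *\<^sub>R c1 (j + 3) + (- fst p) *\<^sub>R c2 (j + 3)"
    unfolding W_linear using W_c(1,2)[of "j + 1"] by (simp add: numeral_eq_Suc)
  then show ?thesis
    unfolding W_cols[of "j + 3"] by (simp add: algebra_simps)
qed

text \<open>Splitting off J twice produces X J X J with X = X_{j+1}. For symmetric X one has X J X =
  det(X) J, so this is -\<epsilon>(j+1) times the identity. Up to first columns of X_{j+3} and
  X_{j+2}, \<open>W (j + 3)\<close> is therefore \<epsilon>(j+1) \<open>W j\<close>: the matrix form
  of removing 2F(j+1) letters.\<close>

lemma W_shift_low:
  assumes "1 \<le> j"
  shows "W (j + 3) p = \<epsilon> (j + 1) *\<^sub>R W j p + (m * fst p) *\<^sub>R c1 (j + 3)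
     - (sg j * m * (y0 (j + 1) * snd p - y1 (j + 1) * fst p)) *\<^sub>R c1 (j + 2)"
proof -
  have e: "\<epsilon> (j + 1) = y0 (j + 1) * y2 (j + 1) - y1 (j + 1) * y1 (j + 1)"
    using det[of "j + 1"] by simp
  define q where "q = (y0 (j + 1) * snd p - y1 (j + 1) * fst p, y1 (j + 1) * snd p - y2 (j + 1) * fst p)"
  have q: "snd q *\<^sub>R c1 (j + 1) + (- fst q) *\<^sub>R c2 (j + 1) = (- \<epsilon> (j + 1)) *\<^sub>R p"
    unfolding e by (simp add: q_def prod_eq_iff algebra_simps)
  have "snd q *\<^sub>R c1 (j + 2) + (- fst q) *\<^sub>R c2 (j + 2) = W j ((- \<epsilon> (j + 1)) *\<^sub>R p)"
    unfolding q[symmetric] W_linear W_c(3,4)[OF assms] ..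
  then have "snd q *\<^sub>R c1 (j + 2) - fst q *\<^sub>R c2 (j + 2) = - \<epsilon> (j + 1) *\<^sub>R W j p"
    using W_linear[of j "- \<epsilon> (j + 1)" p 0 p] by simp
  moreover have "W (j + 2) q = (m * fst q) *\<^sub>R c1 (j + 2) + sg j *\<^sub>R (snd q *\<^sub>R c1 (j + 2) - fst q *\<^sub>R c2 (j + 2))"
    unfolding W_cols by (simp add: algebra_simps)
  ultimately have "W (j + 2) q = (m * fst q) *\<^sub>R c1 (j + 2) - (sg j * \<epsilon> (j + 1)) *\<^sub>R W j p"
    by simp
  then have "sg j *\<^sub>R W (j + 2) q = (sg j * m * fst q) *\<^sub>R c1 (j + 2) - \<epsilon> (j + 1) *\<^sub>R W j p"
    by (simp only: scaleR_diff_right scaleR_scaleR sg_square mult.assoc)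
  then show ?thesis using W_expand[of j p] by (simp add: q_def)
qed

text \<open>The same identity X J X = det(X) J, now with the second X supplied by
  \<open>W (j + 1)\<close> = X M_{j+1}.\<close>

lemma W_shift_high:
  "W (j + 3) (W (j + 1) p) = (m * fst (W (j + 1) p)) *\<^sub>R c1 (j + 3)
     - \<epsilon> (j + 1) *\<^sub>R (W (j + 2) p - (m * fst p) *\<^sub>R c1 (j + 2))"
proof -
  have e: "\<epsilon> (j + 1) = y0 (j + 1) * y2 (j + 1) - y1 (j + 1) * y1 (j + 1)"
    using det[of "j + 1"] by simp
  define r where "r = W (j + 1) p"
  have "(y0 (j + 1) * snd r - y1 (j + 1) * fst r, y1 (j + 1) * snd r - y2 (j + 1) * fst r)
      = \<epsilon> (j + 1) *\<^sub>R (sg j *\<^sub>R p - (m * fst p) *\<^sub>R (0, 1))"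
    unfolding e by (simp add: r_def W_def prod_eq_iff algebra_simps)
  moreover have "W (j + 2) (\<epsilon> (j + 1) *\<^sub>R (sg j *\<^sub>R p - (m * fst p) *\<^sub>R (0, 1)))
     = \<epsilon> (j + 1) *\<^sub>R (sg j *\<^sub>R W (j + 2) p - (m * fst p * sg j) *\<^sub>R c1 (j + 2))"
    by (simp add: W_def algebra_simps)
  ultimately have "sg j *\<^sub>R W (j + 2) (y0 (j + 1) * snd r - y1 (j + 1) * fst r, y1 (j + 1) * snd r - y2 (j + 1) * fst r)
     = sg j *\<^sub>R \<epsilon> (j + 1) *\<^sub>R (sg j *\<^sub>R W (j + 2) p - (m * fst p * sg j) *\<^sub>R c1 (j + 2))"
    by (simp only:)
  also have "\<dots> = \<epsilon> (j + 1) *\<^sub>R (W (j + 2) p - (m * fst p) *\<^sub>R c1 (j + 2))"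
    by (simp add: prod_eq_iff algebra_simps)
  finally show ?thesis using W_expand[of j r] by (simp add: r_def)
qed

text \<open>Inverting \<open>W (i + 1)\<close> expresses the minors of the last two rows through the
  first row. The determinant of the three rows becomes -2 \<open>sg (i + 1)\<close> \<epsilon>(i+1)
  \<epsilon>(i), hence is nonzero.\<close>

lemma consecutive_independent:
  assumes i: "1 \<le> i"
    and rel: "a * y0 i + b * y0 (i + 1) + c * y0 (i + 2) = 0"
      "a * y1 i + b * y1 (i + 1) + c * y1 (i + 2) = 0"
      "a * y2 i + b * y2 (i + 1) + c * y2 (i + 2) = 0"
  shows "a = 0 \<and> b = 0 \<and> c = 0"
proof -
  let ?x0 = "y0 i" and ?x1 = "y1 i" and ?x2 = "y2 i"
  let ?y0 = "y0 (i + 1)" and ?y1 = "y1 (i + 1)" and ?y2 = "y2 (i + 1)"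
  let ?z0 = "y0 (i + 2)" and ?z1 = "y1 (i + 2)" and ?z2 = "y2 (i + 2)"
  let ?s = "sg (i + 1)" and ?e = "\<epsilon> (i + 1)"
  have W: "W (i + 1) (c1 i) = (?z0, ?z1)" "W (i + 1) (c2 i) = (?z1, ?z2)"
    using W_c(1,2)[OF i] by simp_all
  have A: "?e * ?x0 = ?s * (?y1 * ?z0 - ?y0 * ?z1)" "?e * ?x1 = ?s * (?y1 * ?z1 - ?y0 * ?z2)"
    "?e * ?x1 = (m * ?y0 - ?s * ?y1) * ?z1 - (m * ?y1 - ?s * ?y2) * ?z0"
    "?e * ?x2 = (m * ?y0 - ?s * ?y1) * ?z2 - (m * ?y1 - ?s * ?y2) * ?z1"
    using W_inverse[of "i + 1" "c1 i"] W_inverse[of "i + 1" "c2 i"] unfolding W by simp_all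
  have s: "?s * ?s = 1" by simp
  define D where "D = ?x0 * (?y1 * ?z2 - ?y2 * ?z1) - ?x1 * (?y0 * ?z2 - ?y2 * ?z0) + ?x2 * (?y0 * ?z1 - ?y1 * ?z0)"
  have m1: "?y0 * ?z1 - ?y1 * ?z0 = - ?s * ?e * ?x0"
    using A(1) s by algebra
  have m2: "?y0 * ?z2 - ?y1 * ?z1 = - ?s * ?e * ?x1"
    using A(2) s by algebra
  have m3: "?y1 * ?z2 - ?y2 * ?z1 = - m * ?e * ?x1 - ?s * ?e * ?x2"
    using A(4) m2 s by algebra
  have m4: "?y1 * ?z1 - ?y2 * ?z0 = - m * ?e * ?x0 - ?s * ?e * ?x1"
    using A(3) m1 s by algebra
  have "D = - 2 * ?s * ?e * (?x0 * ?x2 - ?x1 * ?x1)"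
    unfolding D_def using m1 m2 m3 m4 by algebra
  then have D: "D \<noteq> 0"
    using det[OF i] eps_nonzero[OF i] eps_nonzero[of "i + 1"] by (simp add: sg_def)
  have "a * D = 0" "b * D = 0" "c * D = 0"
    unfolding D_def using rel by algebra+
  then show ?thesis using D by simp
qed

text \<open>\<open>om e n\<close> applies to \<open>e\<close> the product of the matrices \<open>W\<^sub>i\<close> that corresponds to the greedy
  decomposition of the prefix of length \<open>n\<close> into words \<open>w\<^sub>i\<close>.\<close>

function om :: "real \<times> real \<Rightarrow> nat \<Rightarrow> real \<times> real" where
  "om e n = (if n = 0 then e else W (ix n) (om e (n - F (ix n))))"
  by auto
termination
  by (relation "Wellfounded.measure snd") (simp_all add: F_pos[THEN order_less_le_trans[OF zero_less_one]])

declare om.simps [simp del]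

lemma om_0: "om e 0 = e"
  by (simp add: om.simps)

lemma om_block: "k < F j \<Longrightarrow> om e (F (j + 1) + k) = W (j + 1) (om e k)"
  using F_expand(1)[of j] F_pos[of "j + 1"] ix_eq[of "j + 1" "F (j + 1) + k"]
  by (subst om.simps) (simp add: F_Suc_Suc)

lemma om_F: "1 \<le> i \<Longrightarrow> om e (F i) = W i e"
  using om_block[of 0 "i - 1" e] F_pos[of "i - 1"] by (simp add: om_0)

text \<open>Matrix form of the fact that w_j w_\<infinity> and w_\<infinity> agree on their first
  F(j+2) - 2 letters. The induction rewrites the greedy factors by \<open>W_comp\<close>; in the
  last case it passes from j to j - 2.\<close>

lemma om_shift:
  assumes "1 \<le> j" "k + 1 < F (j + 1)"
  shows "W j (om e k) = om e (F j + k)"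
  using assms
proof (induction j arbitrary: k rule: less_induct)
  case (less j)
  obtain p where p: "j = p + 1" using less.prems(1) le_Suc_ex by (metis add.commute)
  consider "k < F p" | "F p \<le> k" "k < F j" | "F j \<le> k" by linarith
  then show ?case
  proof cases
    case 1
    then show ?thesis using om_block[of k p e] p by simp
  next
    case 2
    have "p \<noteq> 0"
    proof
      assume "p = 0"
      then show False using 2 p by (simp add: F_0 F_1)
    qed
    then obtain q where q: "p = q + 1" by (metis Suc_eq_plus1 not0_implies_Suc)
    define k' where "k' = k - F p"
    have k': "k = F p + k'" "k' < F q" using 2 F_expand(1)[of q] by (simp_all add: k'_def p q)
    have "W j (om e k) = W (q + 1 + 1) (W (q + 1) (om e k'))"
      using om_block[of k' q e] k' p q by simp
    also have "\<dots> = W (q + 3) (om e k')"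
      using W_comp[of "q + 1" "om e k'"] by (simp add: numeral_eq_Suc)
    also have "\<dots> = om e (F (q + 3) + k')"
      using om_block[of k' "q + 2" e] k' F_mono[of q "q + 2"] by (simp add: numeral_eq_Suc)
    also have "F (q + 3) + k' = F j + k"
      using k' p q F_expand[of q] by simp
    finally show ?thesis .
  next
    case 3
    have "p \<noteq> 0"
    proof
      assume "p = 0"
      then show False using 3 p less.prems by (simp add: F_0 F_1 F_Suc_Suc)
    qed
    then obtain q where q: "p = q + 1" by (metis Suc_eq_plus1 not0_implies_Suc)
    have "q \<noteq> 0"
    proof
      assume "q = 0"
      then show False using 3 p q less.prems by (simp add: F_0 F_1 F_Suc_Suc)
    qed
    define k' where "k' = k - F j"
    have k': "k = F j + k'" "k' + 1 < F (q + 1)"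
      using 3 less.prems F_expand[of q] by (simp_all add: k'_def p q numeral_eq_Suc)
    have IH: "W q (om e k') = om e (F q + k')"
      using less.IH[of q k'] k' p q \<open>q \<noteq> 0\<close> by simp
    have "W j (om e k) = W (q + 2) (W (q + 2) (om e k'))"
      using om_block[of k' "q + 1" e] k' p q by simp
    also have "\<dots> = W (q + 2) (W (q + 1) (W q (om e k')))"
      using W_comp[of q "om e k'"] \<open>q \<noteq> 0\<close> by simp
    also have "\<dots> = W (q + 3) (om e (F q + k'))"
      using W_comp[of "q + 1"] IH by (simp add: numeral_eq_Suc)
    also have "\<dots> = om e (F (q + 3) + (F q + k'))"
      using om_block[of "F q + k'" "q + 2" e] k' F_expand[of q] by (simp add: numeral_eq_Suc)
    also have "F (q + 3) + (F q + k') = F j + k"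
      using k' p q F_expand[of q] by simp
    finally show ?thesis .
  qed
qed

section \<open>Points and their third coordinates\<close>

abbreviation pt :: "nat \<Rightarrow> real \<times> real" where
  "pt \<equiv> om (0, 1)"

text \<open>The recursion is the one that the vectors \<open>pt n\<close> satisfy under \<open>\<iota>\<close>. It breaks down when
  \<open>k + 1 = F (i - 2)\<close>, but there \<open>al n\<close> is bounded and a nearest integer is good enough.\<close>

function X2 :: "nat \<Rightarrow> real" where
  "X2 n = (if n = 0 then 0
     else let i = ix n; k = n - F i in
       if k = 0 then sg i * y2 i
       else if k + 1 < F (i - 2) then
         \<epsilon> (i - 2) * X2 (n - 2 * F (i - 2)) + m * fst (pt k) * y2 i
           + sg i * m * (y0 (i - 2) * snd (pt k) - y1 (i - 2) * fst (pt k)) * y2 (i - 1)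
       else if k + 1 = F (i - 2) then of_int (round (\<xi>\<^sup>2 * fst (pt n)))
       else m * fst (pt k) * y2 i
         - \<epsilon> (i - 2) * (X2 (n - 2 * F (i - 2)) - m * fst (pt (k - F (i - 2))) * y2 (i - 1)))"
  by auto
termination
proof (relation "Wellfounded.measure id")
  fix n i k assume "n \<noteq> 0" "i = ix n"
  then show "(n - 2 * F (i - 2), n) \<in> Wellfounded.measure id"
    using F_pos[of "i - 2"] by simp
  then show "(n - 2 * F (i - 2), n) \<in> Wellfounded.measure id" .
qed simp

declare X2.simps [simp del]

lemma X2_0: "X2 0 = 0"
  by (simp add: X2.simps)

lemma X2_F: "1 \<le> i \<Longrightarrow> X2 (F i) = sg i * y2 i"
  using ix_F[of i] F_pos[of i] by (simp add: X2.simps)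

lemma ix_block: "k < F (j + 2) \<Longrightarrow> ix (F (j + 3) + k) = j + 3"
  by (rule ix_eq) (use F_expand[of j] in linarith)+

lemma X2_block:
  assumes "0 < k" "k < F (j + 2)"
  shows "X2 (F (j + 3) + k) =
       (if k + 1 < F (j + 1) then
         \<epsilon> (j + 1) * X2 (F j + k) + m * fst (pt k) * y2 (j + 3)
           - sg j * m * (y0 (j + 1) * snd (pt k) - y1 (j + 1) * fst (pt k)) * y2 (j + 2)
       else if k + 1 = F (j + 1) then of_int (round (\<xi>\<^sup>2 * fst (pt (F (j + 3) + k))))
       else m * fst (pt k) * y2 (j + 3)
         - \<epsilon> (j + 1) * (X2 (F j + k) - m * fst (pt (k - F (j + 1))) * y2 (j + 2)))"
proof -
  have "F (j + 3) + k - 2 * F (j + 1) = F j + k" using F_expand(2)[of j] by simp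
  moreover have "j + 3 - 2 = j + 1" "j + 3 - 1 = j + 2" by simp_all
  moreover have "F (j + 3) + k \<noteq> 0" using assms by simp
  ultimately show ?thesis
    using assms(1) ix_block[OF assms(2)]
    by (subst X2.simps) (simp only: Let_def if_False diff_add_inverse sg_simps, simp)
qed

lemma pt_F: "1 \<le> i \<Longrightarrow> pt (F i) = sg i *\<^sub>R c1 i"
  by (simp only: om_F W_e2)

lemma pt_block: "k < F (j + 2) \<Longrightarrow> pt (F (j + 3) + k) = W (j + 3) (pt k)"
  using om_block[of k "j + 2"] by (simp add: numeral_eq_Suc)

text \<open>The sign \<sigma> admits the end point k = F(j+1), where both lengths involved are
  Fibonacci numbers of consecutive index on the two sides of \<open>W j\<close>, so that the factors
  \<open>sg\<close> in \<open>pt_F\<close> disagree.\<close>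

lemma shift_low:
  assumes j: "1 \<le> j" and k: "k \<le> F (j + 1)" "k + 1 \<noteq> F (j + 1)"
  obtains \<sigma> where "\<sigma> = 1 \<or> \<sigma> = -1" "\<sigma> *\<^sub>R pt (F j + k) = W j (pt k)"
    "X2 (F (j + 3) + k) = \<epsilon> (j + 1) * (\<sigma> * X2 (F j + k)) + m * fst (pt k) * y2 (j + 3)
       - sg j * m * (y0 (j + 1) * snd (pt k) - y1 (j + 1) * fst (pt k)) * y2 (j + 2)"
proof (cases "k < F (j + 1)")
  case True
  then have lt: "k + 1 < F (j + 1)" using k by simp
  have pt: "pt (F j + k) = W j (pt k)" using om_shift[OF j lt] by simp
  show ?thesis
  proof (cases "k = 0")
    case True
    have "sg (j + 3) * y2 (j + 3) = \<epsilon> (j + 1) * (1 * (sg j * y2 j)) + m * fst (pt 0) * y2 (j + 3)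
       - sg j * m * (y0 (j + 1) * snd (pt 0) - y1 (j + 1) * fst (pt 0)) * y2 (j + 2)"
      unfolding y2_rec[OF j] by (simp add: om_0 algebra_simps)
    then show ?thesis using that[of 1] pt True X2_F[OF j] X2_F[of "j + 3"] by simp
  next
    case False
    then show ?thesis
      using that[of 1] pt X2_block[of k j] lt F_expand(1)[of j] by simp
  qed
next
  case False
  then have k: "k = F (j + 1)" using k by simp
  have s: "F j + k = F (j + 2)" using k F_expand(1)[of j] by simp
  have pk: "pt k = - sg j *\<^sub>R c1 (j + 1)" using pt_F[of "j + 1"] k by simp
  have "W j (pt k) = - sg j *\<^sub>R c1 (j + 2)"
    unfolding pk using W_scale[of j "- sg j" "c1 (j + 1)"] W_c(3)[OF j] by simp
  then have 1: "(-1) *\<^sub>R pt (F j + k) = W j (pt k)"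
    unfolding s using pt_F[of "j + 2"] by simp
  have "X2 (F (j + 3) + k) = m * fst (pt k) * y2 (j + 3) - \<epsilon> (j + 1) * X2 (F j + k)"
    using X2_block[of k j] k F_pos[of "j + 1"] F_less[of j] by (simp add: om_0)
  moreover have "y0 (j + 1) * snd (pt k) - y1 (j + 1) * fst (pt k) = 0"
    unfolding pk by simp
  ultimately have "X2 (F (j + 3) + k) = \<epsilon> (j + 1) * (-1 * X2 (F j + k)) + m * fst (pt k) * y2 (j + 3)
       - sg j * m * (y0 (j + 1) * snd (pt k) - y1 (j + 1) * fst (pt k)) * y2 (j + 2)"
    by simp
  then show ?thesis using that[of "-1"] 1 by simp
qed

text \<open>The end point r = F j is included: there the lengths become F(j+2) and F(j+4), which
  belong to later blocks, so the formulas are verified separately by the recursion for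
  \<open>y2\<close>.\<close>

lemma shift_high:
  assumes j: "1 \<le> j" and r: "r \<le> F j"
  shows "pt (F (j + 1) + r) = W (j + 1) (pt r)"
    "pt (F (j + 3) + F (j + 1) + r) = W (j + 3) (W (j + 1) (pt r))"
    "pt (F (j + 2) + r) = W (j + 2) (pt r)"
    "X2 (F (j + 3) + F (j + 1) + r) = m * fst (W (j + 1) (pt r)) * y2 (j + 3)
       - \<epsilon> (j + 1) * (X2 (F (j + 2) + r) - m * fst (pt r) * y2 (j + 2))"
proof -
  have Fj: "F j < F (j + 1)" using F_strict_mono[OF j] by simp
  obtain p where p: "j = p + 1" using j le_Suc_ex by (metis add.commute)
  show 3: "pt (F (j + 2) + r) = W (j + 2) (pt r)"
    using om_block[of r "j + 1"] r Fj by simp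
  show 1: "pt (F (j + 1) + r) = W (j + 1) (pt r)"
  proof (cases "r < F j")
    case False
    then have rj: "r = F j" using r by simp
    have "pt (F (j + 2)) = W (j + 2) (0, 1)" by (rule om_F) simp
    also have "\<dots> = W (j + 1) (pt (F j))" unfolding W_comp[OF j] om_F[OF j] ..
    finally show ?thesis using rj F_expand(1)[of j] by simp
  qed (use om_block[of r j] in simp)
  show 2: "pt (F (j + 3) + F (j + 1) + r) = W (j + 3) (W (j + 1) (pt r))"
  proof (cases "r < F j")
    case True
    then have "pt (F (j + 3) + (F (j + 1) + r)) = W (j + 3) (pt (F (j + 1) + r))"
      using F_expand(1)[of j] by (intro pt_block) simp
    then show ?thesis using 1 by (simp add: add.assoc)
  next
    case False
    then have rj: "r = F j" using r by simp
    have s: "F (j + 3) + F (j + 1) + r = F (j + 4)" "F (j + 1) + r = F (j + 2)"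
      using rj F_expand[of j] by simp_all
    have "pt (F (j + 4)) = W (j + 4) (0, 1)" by (rule om_F) simp
    also have "\<dots> = W (j + 3) (W (j + 2) (0, 1))" using W_comp[of "j + 2"] by (simp add: numeral_eq_Suc)
    also have "W (j + 2) (0, 1) = pt (F (j + 2))" by (rule om_F[symmetric]) simp
    finally show ?thesis using 1 s by simp
  qed
  show "X2 (F (j + 3) + F (j + 1) + r) = m * fst (W (j + 1) (pt r)) * y2 (j + 3)
       - \<epsilon> (j + 1) * (X2 (F (j + 2) + r) - m * fst (pt r) * y2 (j + 2))"
  proof (cases "r < F j")
    case True
    have "X2 (F (j + 3) + (F (j + 1) + r)) = m * fst (pt (F (j + 1) + r)) * y2 (j + 3)
       - \<epsilon> (j + 1) * (X2 (F j + (F (j + 1) + r)) - m * fst (pt (F (j + 1) + r - F (j + 1))) * y2 (j + 2))"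
      using True F_expand(1)[of j] F_pos[of "j + 1"] by (subst X2_block) simp_all
    moreover have "F j + (F (j + 1) + r) = F (j + 2) + r" using F_expand(1)[of j] by simp
    ultimately show ?thesis using 1 by (simp only: add.assoc diff_add_inverse)
  next
    case False
    then have rj: "r = F j" using r by simp
    have s: "F (j + 3) + F (j + 1) + r = F (j + 4)" "F (j + 1) + r = F (j + 2)" "F p + F j = F (j + 1)"
      using rj F_expand[of j] F_expand(1)[of p] p by simp_all
    have "X2 (F (p + 3) + F j) = m * fst (pt (F j)) * y2 (p + 3) - \<epsilon> (p + 1) * X2 (F p + F j)"
      using F_pos[of j] F_strict_mono[OF j, of "j + 1"] p by (subst X2_block) (simp_all add: om_0)
    then have xa: "X2 (F (j + 2) + F j) = m * (sg j * y0 j) * y2 (j + 2) - \<epsilon> j * (- sg j * y2 (j + 1))"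
      using p s(3) pt_F[OF j] X2_F[of "j + 1"] by (simp add: numeral_eq_Suc)
    have xb: "fst (W (j + 1) (pt r)) = sg j * y0 (j + 2)"
      unfolding 1[symmetric] s(2) using pt_F[of "j + 2"] by simp
    have xc: "X2 (F (j + 4)) = sg j * y2 (j + 4)" using X2_F[of "j + 4"] by simp
    have xd: "y2 (j + 4) = m * y0 (j + 2) * y2 (j + 3) - \<epsilon> (j + 2) * y2 (j + 1)"
      using y2_rec[of "j + 1"] by (simp add: numeral_eq_Suc)
    have xe: "fst (pt (F j)) = sg j * y0 j" using pt_F[OF j] by simp
    show ?thesis
      unfolding s(1) xb xc xd unfolding rj xa xe eps_rec[OF j] by algebra
  qed
qed

section \<open>Transport of linear independence\<close>

definition lin_indep :: "nat \<Rightarrow> nat \<Rightarrow> nat \<Rightarrow> bool" where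
  "lin_indep n v n' \<longleftrightarrow> (\<forall>a b c. a *\<^sub>R pt n + b *\<^sub>R pt v + c *\<^sub>R pt n' = 0 \<longrightarrow>
     a * X2 n + b * X2 v + c * X2 n' = 0 \<longrightarrow> a = 0 \<and> b = 0 \<and> c = 0)"

lemma W_linear3: "W i (a *\<^sub>R p + b *\<^sub>R q + c *\<^sub>R r) = a *\<^sub>R W i p + b *\<^sub>R W i q + c *\<^sub>R W i r"
  by (simp only: W_add W_scale)

text \<open>As \<open>W (j + 3)\<close> is injective, a relation between the shifted points is one
  between the points of k, l, k'. The correction terms in \<open>X2\<close> are linear in those
  points with coefficients independent of k, so they cancel, and \<open>W j\<close> carries the
  relation to the unshifted points.\<close>

lemma lin_indep_low:
  assumes j: "1 \<le> j" and k: "k < l" "l < k'" "k' \<le> F (j + 1)"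
    "k + 1 \<noteq> F (j + 1)" "l + 1 \<noteq> F (j + 1)" "k' + 1 \<noteq> F (j + 1)"
    and ind: "lin_indep (F j + k) (F j + l) (F j + k')"
  shows "lin_indep (F (j + 3) + k) (F (j + 3) + l) (F (j + 3) + k')"
  unfolding lin_indep_def
proof (intro allI impI)
  fix a b c
  assume rel: "a *\<^sub>R pt (F (j + 3) + k) + b *\<^sub>R pt (F (j + 3) + l) + c *\<^sub>R pt (F (j + 3) + k') = 0"
    and rel2: "a * X2 (F (j + 3) + k) + b * X2 (F (j + 3) + l) + c * X2 (F (j + 3) + k') = 0"
  obtain \<sigma>k where sk: "\<sigma>k = 1 \<or> \<sigma>k = -1" "\<sigma>k *\<^sub>R pt (F j + k) = W j (pt k)"
    "X2 (F (j + 3) + k) = \<epsilon> (j + 1) * (\<sigma>k * X2 (F j + k)) + m * fst (pt k) * y2 (j + 3)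
       - sg j * m * (y0 (j + 1) * snd (pt k) - y1 (j + 1) * fst (pt k)) * y2 (j + 2)"
    by (rule shift_low[OF j, of k]) (use k in simp_all)
  obtain \<sigma>l where sl: "\<sigma>l = 1 \<or> \<sigma>l = -1" "\<sigma>l *\<^sub>R pt (F j + l) = W j (pt l)"
    "X2 (F (j + 3) + l) = \<epsilon> (j + 1) * (\<sigma>l * X2 (F j + l)) + m * fst (pt l) * y2 (j + 3)
       - sg j * m * (y0 (j + 1) * snd (pt l) - y1 (j + 1) * fst (pt l)) * y2 (j + 2)"
    by (rule shift_low[OF j, of l]) (use k in simp_all)
  obtain \<sigma>k' where sk': "\<sigma>k' = 1 \<or> \<sigma>k' = -1" "\<sigma>k' *\<^sub>R pt (F j + k') = W j (pt k')"
    "X2 (F (j + 3) + k') = \<epsilon> (j + 1) * (\<sigma>k' * X2 (F j + k')) + m * fst (pt k') * y2 (j + 3)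
       - sg j * m * (y0 (j + 1) * snd (pt k') - y1 (j + 1) * fst (pt k')) * y2 (j + 2)"
    by (rule shift_low[OF j, of k']) (use k in simp_all)
  define \<Omega> where "\<Omega> = a *\<^sub>R pt k + b *\<^sub>R pt l + c *\<^sub>R pt k'"
  have "k < F (j + 2)" "l < F (j + 2)" "k' < F (j + 2)"
    using k F_less[of j] by simp_all
  then have "W (j + 3) \<Omega> = 0" using rel by (simp only: \<Omega>_def W_linear3 pt_block)
  then have \<Omega>: "\<Omega> = 0" by (rule W_eq_0[rotated]) simp
  have "W j \<Omega> = 0" unfolding \<Omega> using W_scale[of j 0 0] by simp
  then have *: "(a * \<sigma>k) *\<^sub>R pt (F j + k) + (b * \<sigma>l) *\<^sub>R pt (F j + l) + (c * \<sigma>k') *\<^sub>R pt (F j + k') = 0"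
    by (simp only: \<Omega>_def W_linear3 sk(2)[symmetric] sl(2)[symmetric] sk'(2)[symmetric] scaleR_scaleR)
  have \<Omega>0: "a * fst (pt k) + b * fst (pt l) + c * fst (pt k') = 0"
    "a * snd (pt k) + b * snd (pt l) + c * snd (pt k') = 0"
    using arg_cong[OF \<Omega>, of fst] arg_cong[OF \<Omega>, of snd] by (simp_all add: \<Omega>_def)
  have "\<epsilon> (j + 1) * (a * \<sigma>k * X2 (F j + k) + b * \<sigma>l * X2 (F j + l) + c * \<sigma>k' * X2 (F j + k')) =
      (a * X2 (F (j + 3) + k) + b * X2 (F (j + 3) + l) + c * X2 (F (j + 3) + k'))
      - m * y2 (j + 3) * (a * fst (pt k) + b * fst (pt l) + c * fst (pt k'))
      + sg j * m * y2 (j + 2) * (y0 (j + 1) * (a * snd (pt k) + b * snd (pt l) + c * snd (pt k'))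
          - y1 (j + 1) * (a * fst (pt k) + b * fst (pt l) + c * fst (pt k')))"
    unfolding sk(3) sl(3) sk'(3) by algebra
  also have "\<dots> = 0" unfolding \<Omega>0 rel2 by simp
  finally have "a * \<sigma>k * X2 (F j + k) + b * \<sigma>l * X2 (F j + l) + c * \<sigma>k' * X2 (F j + k') = 0"
    using eps_nonzero[of "j + 1"] by simp
  then have "a * \<sigma>k = 0 \<and> b * \<sigma>l = 0 \<and> c * \<sigma>k' = 0"
    using ind * unfolding lin_indep_def by blast
  then show "a = 0 \<and> b = 0 \<and> c = 0" using sk(1) sl(1) sk'(1) by auto
qed

lemma lin_indep_high:
  assumes j: "1 \<le> j" and k: "k < l" "l < k'" "k' \<le> F j"
    and ind: "lin_indep (F (j + 2) + k) (F (j + 2) + l) (F (j + 2) + k')"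
  shows "lin_indep (F (j + 3) + F (j + 1) + k) (F (j + 3) + F (j + 1) + l) (F (j + 3) + F (j + 1) + k')"
  unfolding lin_indep_def
proof (intro allI impI)
  fix a b c
  assume rel: "a *\<^sub>R pt (F (j + 3) + F (j + 1) + k) + b *\<^sub>R pt (F (j + 3) + F (j + 1) + l)
      + c *\<^sub>R pt (F (j + 3) + F (j + 1) + k') = 0"
    and rel2: "a * X2 (F (j + 3) + F (j + 1) + k) + b * X2 (F (j + 3) + F (j + 1) + l)
      + c * X2 (F (j + 3) + F (j + 1) + k') = 0"
  have le: "k \<le> F j" "l \<le> F j" "k' \<le> F j" using k by simp_all
  note sk = shift_high[OF j le(1)] and sl = shift_high[OF j le(2)] and sk' = shift_high[OF j le(3)]
  define \<Omega> where "\<Omega> = a *\<^sub>R pt k + b *\<^sub>R pt l + c *\<^sub>R pt k'"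
  have "W (j + 3) (W (j + 1) \<Omega>) = 0"
    using rel by (simp only: \<Omega>_def W_linear3 sk(2) sl(2) sk'(2))
  then have "W (j + 1) \<Omega> = 0" by (rule W_eq_0[rotated]) simp
  then have \<Omega>: "\<Omega> = 0" by (rule W_eq_0[rotated]) simp
  have "W (j + 2) \<Omega> = 0" unfolding \<Omega> using W_scale[of "j + 2" 0 0] by simp
  then have *: "a *\<^sub>R pt (F (j + 2) + k) + b *\<^sub>R pt (F (j + 2) + l) + c *\<^sub>R pt (F (j + 2) + k') = 0"
    by (simp only: \<Omega>_def W_linear3 sk(3) sl(3) sk'(3))
  have \<Omega>0: "a * fst (pt k) + b * fst (pt l) + c * fst (pt k') = 0"
    using arg_cong[OF \<Omega>, of fst] by (simp add: \<Omega>_def)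
  have W0: "a * fst (W (j + 1) (pt k)) + b * fst (W (j + 1) (pt l)) + c * fst (W (j + 1) (pt k')) = 0"
    using arg_cong[OF \<open>W (j + 1) \<Omega> = 0\<close>, of fst] unfolding \<Omega>_def W_linear3 by simp
  have "\<epsilon> (j + 1) * (a * X2 (F (j + 2) + k) + b * X2 (F (j + 2) + l) + c * X2 (F (j + 2) + k')) =
      m * y2 (j + 3) * (a * fst (W (j + 1) (pt k)) + b * fst (W (j + 1) (pt l)) + c * fst (W (j + 1) (pt k')))
      + \<epsilon> (j + 1) * m * y2 (j + 2) * (a * fst (pt k) + b * fst (pt l) + c * fst (pt k'))
      - (a * X2 (F (j + 3) + F (j + 1) + k) + b * X2 (F (j + 3) + F (j + 1) + l)
      + c * X2 (F (j + 3) + F (j + 1) + k'))"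
    unfolding sk(4) sl(4) sk'(4) by algebra
  also have "\<dots> = 0" unfolding \<Omega>0 W0 rel2 by simp
  finally have "a * X2 (F (j + 2) + k) + b * X2 (F (j + 2) + l) + c * X2 (F (j + 2) + k') = 0"
    using eps_nonzero[of "j + 1"] by simp
  then show "a = 0 \<and> b = 0 \<and> c = 0"
    using ind * unfolding lin_indep_def by blast
qed

text \<open>Modulo the point at F(j+5), the middle point is a nonzero multiple of the one at F(j+4),
  in all three coordinates. This leaves three consecutive X.\<close>

lemma lin_indep_full: "lin_indep (F (j + 5)) (F (j + 5) + F (j + 3)) (F (j + 6))"
  unfolding lin_indep_def
proof (intro allI impI)
  fix a b c
  assume rel: "a *\<^sub>R pt (F (j + 5)) + b *\<^sub>R pt (F (j + 5) + F (j + 3)) + c *\<^sub>R pt (F (j + 6)) = 0"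
    and rel2: "a * X2 (F (j + 5)) + b * X2 (F (j + 5) + F (j + 3)) + c * X2 (F (j + 6)) = 0"
  have h: "pt (F (j + 5) + F (j + 3)) = W (j + 5) (W (j + 3) (0, 1))"
    "X2 (F (j + 5) + F (j + 3)) = m * fst (W (j + 3) (0, 1)) * y2 (j + 5) - \<epsilon> (j + 3) * X2 (F (j + 4))"
    using shift_high(2,4)[of "j + 2" 0] by (simp_all add: om_0 numeral_eq_Suc)
  have p5: "pt (F (j + 5)) = - sg j *\<^sub>R c1 (j + 5)" "X2 (F (j + 5)) = - sg j * y2 (j + 5)"
    and p6: "pt (F (j + 6)) = sg j *\<^sub>R c1 (j + 6)" "X2 (F (j + 6)) = sg j * y2 (j + 6)"
    and x4: "X2 (F (j + 4)) = sg j * y2 (j + 4)"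
    using pt_F[of "j + 5"] X2_F[of "j + 5"] pt_F[of "j + 6"] X2_F[of "j + 6"] X2_F[of "j + 4"]
    by simp_all
  define w where "w = m * fst (W (j + 3) (0, 1))"
  have pv: "pt (F (j + 5) + F (j + 3)) = w *\<^sub>R c1 (j + 5) - (\<epsilon> (j + 3) * sg j) *\<^sub>R c1 (j + 4)"
    unfolding h(1) w_def using W_shift_high[of "j + 2" "(0, 1)"] W_e2[of "j + 4"] by (simp add: numeral_eq_Suc)
  have e: "\<epsilon> (j + 3) \<noteq> 0" "sg j \<noteq> 0" using eps_nonzero[of "j + 3"] by (simp_all add: sg_def)
  have r: "(- b * \<epsilon> (j + 3) * sg j) * y0 (j + 4) + (- a * sg j + b * w) * y0 (j + 4 + 1) + (c * sg j) * y0 (j + 4 + 2) = 0"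
    "(- b * \<epsilon> (j + 3) * sg j) * y1 (j + 4) + (- a * sg j + b * w) * y1 (j + 4 + 1) + (c * sg j) * y1 (j + 4 + 2) = 0"
    using rel unfolding pv p5 p6 by (simp_all add: prod_eq_iff algebra_simps numeral_eq_Suc)
  have r2: "(- b * \<epsilon> (j + 3) * sg j) * y2 (j + 4) + (- a * sg j + b * w) * y2 (j + 4 + 1) + (c * sg j) * y2 (j + 4 + 2) = 0"
    using rel2 unfolding h(2) w_def[symmetric] p5 p6 x4 by (simp add: algebra_simps numeral_eq_Suc)
  have "- b * \<epsilon> (j + 3) * sg j = 0 \<and> - a * sg j + b * w = 0 \<and> c * sg j = 0"
    by (rule consecutive_independent[OF _ r r2]) simp
  then show "a = 0 \<and> b = 0 \<and> c = 0" using e by auto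
qed

text \<open>The coefficient matrix is triangular with respect to the points of indices j+3, j+4,
  j+5: the middle point contributes index j+3, and the last point contributes j+4.\<close>

lemma lin_indep_part: "lin_indep (F (j + 5)) (F (j + 5) + F (j + 1)) (F (j + 5) + F (j + 3))"
  unfolding lin_indep_def
proof (intro allI impI)
  fix a b c
  assume rel: "a *\<^sub>R pt (F (j + 5)) + b *\<^sub>R pt (F (j + 5) + F (j + 1)) + c *\<^sub>R pt (F (j + 5) + F (j + 3)) = 0"
    and rel2: "a * X2 (F (j + 5)) + b * X2 (F (j + 5) + F (j + 1)) + c * X2 (F (j + 5) + F (j + 3)) = 0"
  have h: "pt (F (j + 5) + F (j + 3)) = W (j + 5) (W (j + 3) (0, 1))"
    "X2 (F (j + 5) + F (j + 3)) = m * fst (W (j + 3) (0, 1)) * y2 (j + 5) - \<epsilon> (j + 3) * X2 (F (j + 4))"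
    using shift_high(2,4)[of "j + 2" 0] by (simp_all add: om_0 numeral_eq_Suc)
  have p5: "pt (F (j + 5)) = - sg j *\<^sub>R c1 (j + 5)" "X2 (F (j + 5)) = - sg j * y2 (j + 5)"
    and x4: "X2 (F (j + 4)) = sg j * y2 (j + 4)"
    and p3: "pt (F (j + 3)) = - sg j *\<^sub>R c1 (j + 3)" "X2 (F (j + 3)) = - sg j * y2 (j + 3)"
    using pt_F[of "j + 5"] X2_F[of "j + 5"] X2_F[of "j + 4"] pt_F[of "j + 3"] X2_F[of "j + 3"]
    by simp_all
  define w where "w = m * fst (W (j + 3) (0, 1))"
  have pv: "pt (F (j + 5) + F (j + 3)) = w *\<^sub>R c1 (j + 5) - (\<epsilon> (j + 3) * sg j) *\<^sub>R c1 (j + 4)"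
    unfolding h(1) w_def using W_shift_high[of "j + 2" "(0, 1)"] W_e2[of "j + 4"] by (simp add: numeral_eq_Suc)
  have lt: "F (j + 1) + 1 < F (j + 3)" "F (j + 1) < F (j + 4)" "F (j + 2) + F (j + 1) = F (j + 3)"
    using F_expand[of j] F_pos[of j] F_pos[of "j + 1"] by linarith+
  have "F (j + 2) \<ge> 2" using F_mono[of 2 "j + 2"] F_values by simp
  define u where "u = m * fst (pt (F (j + 1)))"
  define t where "t = sg j * m * (y0 (j + 3) * snd (pt (F (j + 1))) - y1 (j + 3) * fst (pt (F (j + 1))))"
  have x1: "X2 (F (j + 5) + F (j + 1)) = \<epsilon> (j + 3) * X2 (F (j + 3)) + u * y2 (j + 5) - t * y2 (j + 4)"
    using X2_block[of "F (j + 1)" "j + 2"] lt F_pos[of "j + 1"] by (simp add: u_def t_def numeral_eq_Suc)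
  have "pt (F (j + 5) + F (j + 1)) = W (j + 5) (pt (F (j + 1)))"
    using pt_block[of "F (j + 1)" "j + 2"] lt by (simp add: numeral_eq_Suc)
  moreover have "W (j + 2) (pt (F (j + 1))) = pt (F (j + 3))"
    using om_shift[of "j + 2" "F (j + 1)" "(0, 1)"] lt by (simp add: numeral_eq_Suc)
  ultimately have p1: "pt (F (j + 5) + F (j + 1)) = \<epsilon> (j + 3) *\<^sub>R pt (F (j + 3)) + u *\<^sub>R c1 (j + 5) - t *\<^sub>R c1 (j + 4)"
    using W_shift_low[of "j + 2" "pt (F (j + 1))"] by (simp add: u_def t_def numeral_eq_Suc)
  have e: "\<epsilon> (j + 3) \<noteq> 0" "sg j \<noteq> 0" using eps_nonzero[of "j + 3"] by (simp_all add: sg_def)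
  have r: "(- b * \<epsilon> (j + 3) * sg j) * y0 (j + 3) + (- b * t - c * \<epsilon> (j + 3) * sg j) * y0 (j + 3 + 1)
      + (- a * sg j + b * u + c * w) * y0 (j + 3 + 2) = 0"
    "(- b * \<epsilon> (j + 3) * sg j) * y1 (j + 3) + (- b * t - c * \<epsilon> (j + 3) * sg j) * y1 (j + 3 + 1)
      + (- a * sg j + b * u + c * w) * y1 (j + 3 + 2) = 0"
    using rel unfolding pv p5 p1 p3 by (simp_all add: prod_eq_iff algebra_simps numeral_eq_Suc)
  have r2: "(- b * \<epsilon> (j + 3) * sg j) * y2 (j + 3) + (- b * t - c * \<epsilon> (j + 3) * sg j) * y2 (j + 3 + 1)
      + (- a * sg j + b * u + c * w) * y2 (j + 3 + 2) = 0"
    using rel2 unfolding h(2) w_def[symmetric] p5 x1 p3 x4 by (simp add: algebra_simps numeral_eq_Suc)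
  have "- b * \<epsilon> (j + 3) * sg j = 0 \<and> - b * t - c * \<epsilon> (j + 3) * sg j = 0 \<and> - a * sg j + b * u + c * w = 0"
    by (rule consecutive_independent[OF _ r r2]) simp
  then show "a = 0 \<and> b = 0 \<and> c = 0" using e by auto
qed

sublocale shift_closed lin_indep
  by (unfold_locales; (rule lin_indep_full lin_indep_part)?; (rule lin_indep_low lin_indep_high)?)

lemma W_Ints: "\<lbrakk>1 \<le> i; fst p \<in> \<int>; snd p \<in> \<int>\<rbrakk> \<Longrightarrow> fst (W i p) \<in> \<int> \<and> snd (W i p) \<in> \<int>"
  using ints(1) ints(2-4)[of i] by (auto simp: W_def sg_def intro!: Ints_add Ints_diff Ints_mult Ints_power)

lemma ix_ge_1: "1 \<le> n \<Longrightarrow> 1 \<le> ix n"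
  using F_block_ex[of n] ix_eq by metis

lemma om_Ints: "\<lbrakk>fst e \<in> \<int>; snd e \<in> \<int>\<rbrakk> \<Longrightarrow> fst (om e n) \<in> \<int> \<and> snd (om e n) \<in> \<int>"
proof (induction n rule: less_induct)
  case (less n)
  show ?case
  proof (cases "n = 0")
    case False
    then show ?thesis
      using less.IH[of "n - F (ix n)"] less.prems F_pos[of "ix n"] W_Ints ix_ge_1[of n]
      by (subst (1 2) om.simps) simp
  qed (use less.prems in \<open>simp add: om_0\<close>)
qed

lemma eps_Ints: "1 \<le> i \<Longrightarrow> \<epsilon> i \<in> \<int>"
  using eps[of i] by auto

lemma X2_Ints: "X2 n \<in> \<int>"
proof (induction n rule: less_induct)
  case (less n)
  show ?case
  proof (cases "n = 0")
    case False
    then have "n \<ge> 1" by simp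
    then show ?thesis
    proof (cases rule: block_cases)
      case (1 i)
      then show ?thesis using X2_F[of i] ints by (simp add: sg_def Ints_mult Ints_power)
    next
      case (2 j k)
      have "F j + k < n" using 2 F_expand(2)[of j] F_pos[of "j + 1"] by simp
      then have "X2 (F j + k) \<in> \<int>" by (rule less.IH)
      moreover have "fst (pt k) \<in> \<int>" "snd (pt k) \<in> \<int>" "fst (pt (k - F (j + 1))) \<in> \<int>" for k
        using om_Ints[of "(0, 1)"] by simp_all
      ultimately show ?thesis
        unfolding 2(1) X2_block[OF 2(2,3)] using ints eps_Ints[of "j + 1"]
        by (auto simp: sg_def intro!: Ints_add Ints_diff Ints_mult Ints_power)
    qed
  qed (simp add: X2_0)
qed

section \<open>Size estimates\<close>

definition err :: "real \<times> real \<Rightarrow> real" where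
  "err p = \<xi> * fst p - snd p"

text \<open>In the coordinates (x_0, x_0 \<xi> - x_1) this is the off-diagonal entry of
  \<open>W i\<close> through which the large coordinate enters the small one. It would vanish if
  (\<xi>, -1) were a left eigenvector.\<close>

definition leak :: "nat \<Rightarrow> real" where
  "leak i = m * err (c1 i) + sg i * (\<xi> * err (c1 i) - err (c2 i))"

lemma fst_W: "fst (W i p) = y0 i * (m * fst p - sg i * err p) + sg i * err (c1 i) * fst p"
  and err_W: "err (W i p) = leak i * fst p - sg i * err (c1 i) * err p"
  by (simp_all add: W_def err_def leak_def algebra_simps)

text \<open>The weight m is chosen because the main part of \<open>fst (W i p)\<close> is
  \<open>y0 i\<close> times m x_0 - \<open>sg i\<close> \<open>err p\<close>. In this norm the
  operator norm of \<open>W i\<close> is m |\<open>y0 i\<close>| up to small terms, without a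
  further constant.\<close>

definition size_of :: "real \<times> real \<Rightarrow> real" where
  "size_of p = m * \<bar>fst p\<bar> + \<bar>err p\<bar>"

end

text \<open>All bounds have leading constant 1 except the one for \<open>c2\<close>, which never
  enters a long product. The exponent for \<open>leak\<close> compensates the growth of the
  coordinate it multiplies.\<close>

locale sized_data = sym_data +
  fixes \<rho> C :: real and \<delta> :: "nat \<Rightarrow> real"
  assumes m_ge: "1 \<le> m" and rho: "0 < \<rho>" and C_ge: "0 \<le> C"
    and delta: "\<And>i. 0 \<le> \<delta> i" "summable \<delta>"
    and bound_y0: "\<And>i. 1 \<le> i \<Longrightarrow> m * \<bar>y0 i\<bar> + 2 * \<bar>err (c1 i)\<bar> + \<bar>leak i\<bar> \<le> exp (\<rho> * F i) * (1 + \<delta> i)"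
    and bound_e: "\<And>i. 1 \<le> i \<Longrightarrow> \<bar>err (c1 i)\<bar> \<le> exp (- \<rho> * F i) * (1 + \<delta> i)"
    and bound_f: "\<And>i. 1 \<le> i \<Longrightarrow> \<bar>err (c2 i)\<bar> \<le> C * exp (- \<rho> * F i)"
    and bound_leak: "\<And>i. 1 \<le> i \<Longrightarrow> \<bar>leak i\<bar> \<le> \<delta> i * exp (- \<rho> * (F i + 2 * real (F (i - 1))))"
begin

definition S :: real where
  "S = suminf \<delta>"

definition E :: "nat \<Rightarrow> real" where
  "E i = sum \<delta> {..<i}"

lemma E_le_S: "E i \<le> S"
  unfolding E_def S_def using delta by (intro sum_le_suminf) auto

lemma E_mono: "i \<le> j \<Longrightarrow> E i \<le> E j"
  unfolding E_def using delta(1) by (intro sum_mono2) auto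

lemma E_Suc: "E (Suc i) = E i + \<delta> i"
  by (simp add: E_def)

lemma delta_le_S: "\<delta> i \<le> S"
  using E_le_S[of "Suc i"] E_mono[of 0 i] by (simp add: E_Suc) (simp add: E_def)

lemma S_nonneg: "0 \<le> S"
  using delta_le_S[of 0] delta(1)[of 0] by linarith

lemma size_nonneg: "0 \<le> size_of p" and fst_le_size: "\<bar>fst p\<bar> \<le> size_of p"
  and err_le_size: "\<bar>err p\<bar> \<le> size_of p"
proof -
  have "\<bar>fst p\<bar> \<le> m * \<bar>fst p\<bar>" using m_ge mult_right_mono[of 1 m "\<bar>fst p\<bar>"] by simp
  then show "0 \<le> size_of p" "\<bar>fst p\<bar> \<le> size_of p" "\<bar>err p\<bar> \<le> size_of p"
    unfolding size_of_def by (smt (verit))+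
qed

lemma size_W:
  assumes "1 \<le> i"
  shows "size_of (W i p) \<le> exp (\<rho> * F i) * (1 + \<delta> i) * size_of p"
proof -
  let ?e = "\<bar>err (c1 i)\<bar>"
  have 1: "\<bar>m * fst p - sg i * err p\<bar> \<le> size_of p"
  proof -
    have "\<bar>sg i\<bar> = 1" by (simp add: sg_def)
    then have "\<bar>m * fst p - sg i * err p\<bar> \<le> \<bar>m\<bar> * \<bar>fst p\<bar> + \<bar>err p\<bar>"
      by (metis abs_mult abs_triangle_ineq4 mult_1)
    then show ?thesis using m_ge by (simp add: size_of_def)
  qed
  have sg: "\<bar>sg i\<bar> = 1" by (simp add: sg_def)
  have "\<bar>fst (W i p)\<bar> \<le> \<bar>y0 i\<bar> * \<bar>m * fst p - sg i * err p\<bar> + ?e * \<bar>fst p\<bar>"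
    unfolding fst_W using sg by (metis abs_mult abs_triangle_ineq mult_1)
  also have "\<dots> \<le> \<bar>y0 i\<bar> * size_of p + ?e * \<bar>fst p\<bar>"
    using 1 by (intro add_right_mono mult_left_mono) simp_all
  finally have "m * \<bar>fst (W i p)\<bar> \<le> m * (\<bar>y0 i\<bar> * size_of p + ?e * \<bar>fst p\<bar>)"
    using m_ge by (intro mult_left_mono) simp_all
  moreover have "?e * (m * \<bar>fst p\<bar>) \<le> ?e * size_of p"
    by (intro mult_left_mono) (simp_all add: size_of_def)
  moreover have "\<bar>err (W i p)\<bar> \<le> \<bar>leak i\<bar> * \<bar>fst p\<bar> + ?e * \<bar>err p\<bar>"
    unfolding err_W using sg by (metis abs_mult abs_triangle_ineq4 mult_1)
  moreover have "\<bar>leak i\<bar> * \<bar>fst p\<bar> \<le> \<bar>leak i\<bar> * size_of p" "?e * \<bar>err p\<bar> \<le> ?e * size_of p"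
    using fst_le_size err_le_size by (simp_all add: mult_left_mono)
  ultimately have "size_of (W i p) \<le> (m * \<bar>y0 i\<bar> + 2 * ?e + \<bar>leak i\<bar>) * size_of p"
    unfolding size_of_def[of "W i p"] by (simp add: algebra_simps)
  also have "\<dots> \<le> exp (\<rho> * F i) * (1 + \<delta> i) * size_of p"
    using bound_y0[OF assms] size_nonneg by (intro mult_right_mono)
  finally show ?thesis .
qed

lemma F_block_split:
  assumes "n < F (Suc i)" "\<not> n < F i"
  obtains p k where "i = p + 1" "n = F i + k" "k < F p"
proof -
  have "i \<noteq> 0"
  proof
    assume "i = 0"
    then show False using assms by (simp add: F_0 F_1)
  qed
  then obtain p where p: "i = p + 1" by (metis Suc_eq_plus1 not0_implies_Suc)
  then show ?thesis using that[of p "n - F i"] assms F_expand(1)[of p] by simp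
qed

text \<open>The greedy decomposition uses each index at most once, so the losses 1 + \<delta>
  multiply to at most the exponential of the sum of \<delta>.\<close>

lemma size_om: "n < F i \<Longrightarrow> size_of (om e n) \<le> exp (E i) * exp (\<rho> * n) * size_of e"
proof (induction i arbitrary: n rule: less_induct)
  case (less i)
  show ?case
  proof (cases i)
    case 0
    then show ?thesis using less.prems by (simp add: F_0 om_0 E_def)
  next
    case (Suc l)
    show ?thesis
    proof (cases "n < F l")
      case True
      then have "size_of (om e n) \<le> exp (E l) * exp (\<rho> * n) * size_of e"
        using less.IH[of l n] Suc by simp
      also have "\<dots> \<le> exp (E i) * exp (\<rho> * n) * size_of e"
        using E_mono[of l i] Suc size_nonneg by (intro mult_right_mono) simp_all
      finally show ?thesis .
    next
      case False
      then obtain p k where pk: "l = p + 1" "n = F l + k" "k < F p"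
        using F_block_split less.prems Suc by blast
      have "size_of (om e n) \<le> exp (\<rho> * F l) * (1 + \<delta> l) * size_of (om e k)"
        using om_block[OF pk(3), of e] size_W[of l "om e k"] pk by simp
      also have "\<dots> \<le> exp (\<rho> * F l) * exp (\<delta> l) * (exp (E l) * exp (\<rho> * k) * size_of e)"
      proof (intro mult_mono)
        show "size_of (om e k) \<le> exp (E l) * exp (\<rho> * k) * size_of e"
          using less.IH[of l k] Suc pk F_mono[of p l] by simp
      qed (use size_nonneg delta(1) in \<open>simp_all add: exp_ge_add_one_self\<close>)
      also have "\<dots> = exp (E i) * exp (\<rho> * n) * size_of e"
        using Suc pk by (simp add: E_Suc exp_add algebra_simps)
      finally show ?thesis .
    qed
  qed
qed

lemma size_om_le: "size_of (om e n) \<le> exp S * exp (\<rho> * n) * size_of e"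
proof -
  have "n < F (Suc n)" using F_ge[of "Suc n"] by simp
  then have "size_of (om e n) \<le> exp (E (Suc n)) * exp (\<rho> * n) * size_of e" by (rule size_om)
  also have "\<dots> \<le> exp S * exp (\<rho> * n) * size_of e"
    using E_le_S size_nonneg by (intro mult_right_mono) simp_all
  finally show ?thesis .
qed

text \<open>The leak adds at most \<delta> K after normalization, because k < F(l-1) for the
  remaining length k. Adding K to the normalized error y turns y \<le> (1 + \<delta>) y' + \<delta>
  K into a purely multiplicative recursion.\<close>

lemma err_om:
  fixes e
  defines "K \<equiv> exp S * size_of e"
  shows "n < F i \<Longrightarrow> exp (\<rho> * n) * \<bar>err (om e n)\<bar> + K \<le> exp (E i) * (size_of e + K)"
proof (induction i arbitrary: n rule: less_induct)
  case (less i)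
  have K: "0 \<le> K" using size_nonneg by (simp add: K_def)
  show ?case
  proof (cases i)
    case 0
    then show ?thesis using less.prems err_le_size[of e] by (simp add: F_0 om_0 E_def)
  next
    case (Suc l)
    show ?thesis
    proof (cases "n < F l")
      case True
      then have "exp (\<rho> * n) * \<bar>err (om e n)\<bar> + K \<le> exp (E l) * (size_of e + K)"
        using less.IH[of l n] Suc by simp
      also have "\<dots> \<le> exp (E i) * (size_of e + K)"
        using E_mono[of l i] Suc size_nonneg K by (intro mult_right_mono) simp_all
      finally show ?thesis .
    next
      case False
      then obtain p k where pk: "l = p + 1" "n = F l + k" "k < F p"
        using F_block_split less.prems Suc by blast
      have om: "om e n = W l (om e k)" using om_block[OF pk(3), of e] pk by simp
      have "\<bar>err (om e n)\<bar> \<le> \<bar>leak l\<bar> * \<bar>fst (om e k)\<bar> + \<bar>err (c1 l)\<bar> * \<bar>err (om e k)\<bar>"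
      proof -
        have "\<bar>sg l\<bar> = 1" by (simp add: sg_def)
        then show ?thesis unfolding om err_W by (metis abs_mult abs_triangle_ineq4 mult_1)
      qed
      also have "\<dots> \<le> \<delta> l * exp (- \<rho> * (F l + 2 * real (F p))) * (exp (\<rho> * k) * K)
          + exp (- \<rho> * F l) * (1 + \<delta> l) * \<bar>err (om e k)\<bar>"
      proof (intro add_mono mult_mono)
        show "\<bar>leak l\<bar> \<le> \<delta> l * exp (- \<rho> * (F l + 2 * real (F p)))"
          using bound_leak[of l] pk by simp
        show "\<bar>err (c1 l)\<bar> \<le> exp (- \<rho> * F l) * (1 + \<delta> l)" using bound_e[of l] pk by simp
        show "\<bar>fst (om e k)\<bar> \<le> exp (\<rho> * k) * K"
          using fst_le_size[of "om e k"] size_om_le[of e k] by (simp add: K_def mult.commute mult.left_commute)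
      qed (use delta(1) in simp_all)
      finally have "exp (\<rho> * n) * \<bar>err (om e n)\<bar> \<le> exp (\<rho> * n) * (\<delta> l * exp (- \<rho> * (F l + 2 * real (F p))) * (exp (\<rho> * k) * K)
          + exp (- \<rho> * F l) * (1 + \<delta> l) * \<bar>err (om e k)\<bar>)"
        by (intro mult_left_mono) simp_all
      also have "\<dots> = \<delta> l * (exp (\<rho> * n) * exp (- \<rho> * (F l + 2 * real (F p))) * exp (\<rho> * k)) * K
          + exp (\<rho> * n) * exp (- \<rho> * F l) * (1 + \<delta> l) * \<bar>err (om e k)\<bar>"
        by (simp add: distrib_left mult_ac)
      also have "exp (\<rho> * n) * exp (- \<rho> * (F l + 2 * real (F p))) * exp (\<rho> * k) = exp (\<rho> * (2 * real k - 2 * real (F p)))"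
        unfolding exp_add[symmetric] using pk by (simp add: algebra_simps)
      also have "exp (\<rho> * n) * exp (- \<rho> * F l) = exp (\<rho> * k)"
        unfolding exp_add[symmetric] using pk by (simp add: algebra_simps)
      also have "\<delta> l * exp (\<rho> * (2 * real k - 2 * real (F p))) * K \<le> \<delta> l * 1 * K"
        using rho pk(3) delta(1) K by (intro mult_mono) (simp_all add: mult_le_0_iff)
      finally have "exp (\<rho> * n) * \<bar>err (om e n)\<bar> + K \<le> (1 + \<delta> l) * (exp (\<rho> * k) * \<bar>err (om e k)\<bar> + K)"
        by (simp add: algebra_simps)
      also have "\<dots> \<le> exp (\<delta> l) * (exp (E l) * (size_of e + K))"
      proof (intro mult_mono)
        show "exp (\<rho> * k) * \<bar>err (om e k)\<bar> + K \<le> exp (E l) * (size_of e + K)"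
          using less.IH[of l k] Suc pk F_mono[of p l] by simp
      qed (use K delta(1) in \<open>simp_all add: exp_ge_add_one_self\<close>)
      also have "\<dots> = exp (E i) * (size_of e + K)"
        using Suc by (simp add: E_Suc exp_add)
      finally show ?thesis .
    qed
  qed
qed

lemma om_bounds:
  obtains K where "0 \<le> K" "\<And>n. \<bar>fst (om e n)\<bar> \<le> K * exp (\<rho> * n)"
    "\<And>n. \<bar>err (om e n)\<bar> \<le> K * exp (- \<rho> * n)"
proof -
  define K where "K = exp S * size_of e"
  define K' where "K' = exp S * (size_of e + K)"
  have K: "0 \<le> K" using size_nonneg by (simp add: K_def)
  have K': "K \<le> K'" "0 \<le> K'"
  proof -
    have "1 * K \<le> exp S * (size_of e + K)"
      using S_nonneg K size_nonneg[of e] by (intro mult_mono) simp_all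
    then show "K \<le> K'" by (simp add: K'_def)
    then show "0 \<le> K'" using K by simp
  qed
  have "\<bar>fst (om e n)\<bar> \<le> K' * exp (\<rho> * n)" for n
  proof -
    have "\<bar>fst (om e n)\<bar> \<le> K * exp (\<rho> * n)"
      using fst_le_size[of "om e n"] size_om_le[of e n] by (simp add: K_def mult_ac)
    also have "\<dots> \<le> K' * exp (\<rho> * n)" using K' by simp
    finally show ?thesis .
  qed
  moreover have "\<bar>err (om e n)\<bar> \<le> K' * exp (- \<rho> * n)" for n
  proof -
    have "n < F (Suc n)" using F_ge[of "Suc n"] by simp
    from err_om[OF this, of e]
    have "exp (\<rho> * n) * \<bar>err (om e n)\<bar> + K \<le> exp (E (Suc n)) * (size_of e + K)"
      by (simp add: K_def)
    also have "\<dots> \<le> K'" unfolding K'_def using E_le_S K size_nonneg by (intro mult_right_mono) simp_all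
    finally have "exp (\<rho> * n) * \<bar>err (om e n)\<bar> \<le> K'" using K by simp
    then have "exp (- \<rho> * n) * (exp (\<rho> * n) * \<bar>err (om e n)\<bar>) \<le> exp (- \<rho> * n) * K'"
      by (intro mult_left_mono) simp_all
    moreover have "exp (- \<rho> * n) * exp (\<rho> * n) = 1" by (simp flip: exp_add)
    ultimately show ?thesis by (simp only: mult.assoc[symmetric] mult_1) (simp add: mult.commute)
  qed
  ultimately show ?thesis using that K'(2) by blast
qed

section \<open>The error of the third coordinate\<close>

definition D :: "nat \<Rightarrow> real" where
  "D n = \<xi>\<^sup>2 * fst (pt n) - X2 n"

definition g :: "nat \<Rightarrow> real" where
  "g i = \<xi>\<^sup>2 * y0 i - y2 i"

definition G :: real where
  "G = \<bar>\<xi>\<bar> * (1 + S) + C"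

lemma G_nonneg: "0 \<le> G"
  using S_nonneg C_ge by (simp add: G_def)

lemma err_c1_le: "1 \<le> i \<Longrightarrow> \<bar>err (c1 i)\<bar> \<le> (1 + S) * exp (- \<rho> * F i)"
proof -
  assume "1 \<le> i"
  from bound_e[OF this] have "\<bar>err (c1 i)\<bar> \<le> (1 + \<delta> i) * exp (- \<rho> * F i)" by (simp add: mult.commute)
  also have "\<dots> \<le> (1 + S) * exp (- \<rho> * F i)" using delta_le_S by simp
  finally show ?thesis .
qed

lemma y0_le: "1 \<le> i \<Longrightarrow> \<bar>y0 i\<bar> \<le> (1 + S) * exp (\<rho> * F i)"
proof -
  assume i: "1 \<le> i"
  have "\<bar>y0 i\<bar> \<le> m * \<bar>y0 i\<bar>" using m_ge mult_right_mono[of 1 m "\<bar>y0 i\<bar>"] by simp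
  also have "\<dots> \<le> exp (\<rho> * F i) * (1 + \<delta> i)" using bound_y0[OF i] by linarith
  also have "\<dots> \<le> exp (\<rho> * F i) * (1 + S)" using delta_le_S by simp
  finally show ?thesis by (simp add: mult.commute)
qed

lemma g_le: assumes "1 \<le> i" shows "\<bar>g i\<bar> \<le> G * exp (- \<rho> * F i)"
proof -
  have "g i = \<xi> * err (c1 i) + err (c2 i)" by (simp add: g_def err_def algebra_simps power2_eq_square)
  then have "\<bar>g i\<bar> \<le> \<bar>\<xi>\<bar> * \<bar>err (c1 i)\<bar> + \<bar>err (c2 i)\<bar>" by (metis abs_mult abs_triangle_ineq)
  also have "\<dots> \<le> \<bar>\<xi>\<bar> * ((1 + S) * exp (- \<rho> * F i)) + C * exp (- \<rho> * F i)"
    using err_c1_le[OF assms] bound_f[OF assms] by (intro add_mono mult_left_mono) simp_all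
  finally show ?thesis by (simp add: G_def algebra_simps)
qed

lemma exp_prod_le:
  fixes a b A B x y z :: real
  assumes "\<bar>a\<bar> \<le> A * exp x" "\<bar>b\<bar> \<le> B * exp y" "x + y \<le> z" "0 \<le> A" "0 \<le> B"
  shows "\<bar>a * b\<bar> \<le> A * B * exp z"
proof -
  have "\<bar>a * b\<bar> \<le> (A * exp x) * (B * exp y)"
    unfolding abs_mult using assms by (intro mult_mono) auto
  also have "\<dots> = A * B * exp (x + y)" by (simp add: exp_add)
  also have "\<dots> \<le> A * B * exp z" using assms by (intro mult_left_mono) simp_all
  finally show ?thesis .
qed

lemma D_F: "1 \<le> i \<Longrightarrow> \<bar>D (F i)\<bar> \<le> G * exp (- \<rho> * F i)"
proof -
  assume i: "1 \<le> i"
  have "D (F i) = sg i * g i" using pt_F[OF i] X2_F[OF i] by (simp add: D_def g_def algebra_simps)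
  then have "\<bar>D (F i)\<bar> = \<bar>g i\<bar>" by (simp add: abs_mult sg_def)
  then show ?thesis using g_le[OF i] by simp
qed

lemma D_mid:
  assumes "0 < k" "k + 1 = F (j + 1)"
  shows "\<bar>D (F (j + 3) + k)\<bar> \<le> 1"
proof -
  have "X2 (F (j + 3) + k) = of_int (round (\<xi>\<^sup>2 * fst (pt (F (j + 3) + k))))"
    using X2_block[of k j] assms F_expand(1)[of j] by simp
  then show ?thesis
    using of_int_round_abs_le[of "\<xi>\<^sup>2 * fst (pt (F (j + 3) + k))"]
    unfolding D_def by linarith
qed

text \<open>\<open>X2\<close> obeys the recursion of \<open>fst (pt n)\<close> with
  \<open>y2\<close> in place of \<open>y0\<close>. Subtracting leaves the same recursion with the
  small quantities \<open>g\<close>.\<close>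

lemma D_low:
  assumes "1 \<le> j" "0 < k" "k + 1 < F (j + 1)"
  shows "D (F (j + 3) + k) = \<epsilon> (j + 1) * D (F j + k) + m * (fst (pt k) * g (j + 3))
    - sg j * m * ((err (c1 (j + 1)) * fst (pt k) - y0 (j + 1) * err (pt k)) * g (j + 2))"
proof -
  have k: "k < F (j + 2)" using assms F_expand(1)[of j] by simp
  have "fst (pt (F (j + 3) + k)) = \<epsilon> (j + 1) * fst (pt (F j + k)) + m * fst (pt k) * y0 (j + 3)
     - sg j * m * (y0 (j + 1) * snd (pt k) - y1 (j + 1) * fst (pt k)) * y0 (j + 2)"
    unfolding pt_block[OF k] W_shift_low[OF assms(1)] om_shift[OF assms(1,3)] by simp
  moreover have "X2 (F (j + 3) + k) = \<epsilon> (j + 1) * X2 (F j + k) + m * fst (pt k) * y2 (j + 3)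
     - sg j * m * (y0 (j + 1) * snd (pt k) - y1 (j + 1) * fst (pt k)) * y2 (j + 2)"
    using X2_block[OF assms(2) k] assms(3) by simp
  moreover have "y0 (j + 1) * snd (pt k) - y1 (j + 1) * fst (pt k)
      = err (c1 (j + 1)) * fst (pt k) - y0 (j + 1) * err (pt k)"
    by (simp add: err_def algebra_simps)
  ultimately show ?thesis unfolding D_def g_def by algebra
qed

lemma D_high:
  assumes "1 \<le> j" "r \<le> F j"
  shows "D (F (j + 3) + F (j + 1) + r) = - \<epsilon> (j + 1) * D (F (j + 2) + r)
    + m * (fst (pt (F (j + 1) + r)) * g (j + 3)) + \<epsilon> (j + 1) * (m * (fst (pt r) * g (j + 2)))"
proof -
  note h = shift_high[OF assms]
  have "fst (pt (F (j + 3) + F (j + 1) + r)) = m * fst (W (j + 1) (pt r)) * y0 (j + 3)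
     - \<epsilon> (j + 1) * (fst (pt (F (j + 2) + r)) - m * fst (pt r) * y0 (j + 2))"
    unfolding h(2,3) W_shift_high by simp
  then show ?thesis unfolding D_def g_def h(4) h(1) by algebra
qed

text \<open>Each step of \<iota> adds an error, and the number of steps is unbounded. The induction
  therefore proves the sharper bound K(2 exp(-\<rho> al n) - exp(-\<rho> n)), whose subtracted term
  absorbs these errors, since it decreases by a fixed ratio at least as the length grows.\<close>

lemma D_bound: obtains K where "0 \<le> K" "\<And>n. \<bar>D n\<bar> \<le> K * exp (- \<rho> * al n)"
proof -
  obtain K1 where K1: "0 \<le> K1" "\<And>n. \<bar>fst (pt n)\<bar> \<le> K1 * exp (\<rho> * n)"
    "\<And>n. \<bar>err (pt n)\<bar> \<le> K1 * exp (- \<rho> * n)"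
    by (rule om_bounds[of "(0, 1)"]) blast
  define B where "B = m * (K1 * G)"
  define A where "A = B + 2 * (1 + S) * B"
  have B: "0 \<le> B" using m_ge K1 G_nonneg by (simp add: B_def)
  have SB: "0 \<le> S * B" using S_nonneg B by simp
  have A: "0 \<le> A" "2 * B \<le> A" using SB B by (simp_all add: A_def algebra_simps)
  have fst_g: "\<bar>m * (fst (pt k) * g i)\<bar> \<le> B * exp z"
    if "1 \<le> i" "\<rho> * k - \<rho> * F i \<le> z" for k i z
  proof -
    have "\<bar>fst (pt k) * g i\<bar> \<le> K1 * G * exp z"
      by (rule exp_prod_le[OF K1(2) g_le[OF that(1)]]) (use that K1 G_nonneg in simp_all)
    then have "m * \<bar>fst (pt k) * g i\<bar> \<le> m * (K1 * G * exp z)"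
      using m_ge by (intro mult_left_mono) simp_all
    then show ?thesis using m_ge by (simp add: B_def abs_mult mult_ac)
  qed
  have eps1: "\<bar>\<epsilon> (j + 1) * x\<bar> = \<bar>x\<bar>" for j x using eps_abs[of "j + 1"] by (simp add: abs_mult)
  have sg1: "\<bar>sg j\<bar> = 1" for j by (simp add: sg_def)
  have low: "\<bar>D (F (j + 3) + k)\<bar> \<le> \<bar>D (F j + k)\<bar> + A * exp (- \<rho> * (F j + k))"
    if "1 \<le> j" "0 < k" "k + 1 < F (j + 1)" for j k
  proof -
    let ?z = "- \<rho> * real (F j + k)"
    have e: "real (F (j + 2)) = real (F (j + 1)) + real (F j)" "real (F (j + 3)) = 2 * real (F (j + 1)) + real (F j)"
      using F_expand[of j] by simp_all
    have k: "real k \<le> real (F (j + 1))" using that by simp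
    have rk: "\<rho> * real k \<le> \<rho> * real (F (j + 1))" using k rho by simp
    have 1: "\<bar>m * (fst (pt k) * g (j + 3))\<bar> \<le> B * exp ?z"
      by (rule fst_g) (use rk in \<open>simp_all add: e algebra_simps\<close>)
    let ?x = "\<rho> * (real (F (j + 1)) - real k)"
    have "\<bar>err (c1 (j + 1)) * fst (pt k)\<bar> \<le> (1 + S) * K1 * exp ?x"
      by (rule exp_prod_le[OF err_c1_le K1(2)]) (use rk K1 S_nonneg in \<open>simp_all add: algebra_simps\<close>)
    moreover have "\<bar>y0 (j + 1) * err (pt k)\<bar> \<le> (1 + S) * K1 * exp ?x"
      by (rule exp_prod_le[OF y0_le K1(3)]) (use rk K1 S_nonneg in \<open>simp_all add: algebra_simps\<close>)
    ultimately have "\<bar>err (c1 (j + 1)) * fst (pt k) - y0 (j + 1) * err (pt k)\<bar> \<le> (2 * (1 + S) * K1) * exp ?x"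
      by linarith
    then have "\<bar>(err (c1 (j + 1)) * fst (pt k) - y0 (j + 1) * err (pt k)) * g (j + 2)\<bar>
        \<le> (2 * (1 + S) * K1) * G * exp ?z"
    proof (rule exp_prod_le[OF _ g_le])
      have "\<rho> * real (F (j + 2)) = \<rho> * real (F (j + 1)) + \<rho> * real (F j)"
        unfolding e by (rule distrib_left)
      then show "?x + - \<rho> * real (F (j + 2)) \<le> ?z" by (simp add: algebra_simps)
    qed (use K1 S_nonneg G_nonneg in simp_all)
    then have "m * \<bar>(err (c1 (j + 1)) * fst (pt k) - y0 (j + 1) * err (pt k)) * g (j + 2)\<bar>
        \<le> m * ((2 * (1 + S) * K1) * G * exp ?z)"
      using m_ge by (intro mult_left_mono) simp_all
    also have "\<dots> = 2 * (1 + S) * B * exp ?z" by (simp add: B_def algebra_simps)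
    finally have 2: "\<bar>sg j * m * ((err (c1 (j + 1)) * fst (pt k) - y0 (j + 1) * err (pt k)) * g (j + 2))\<bar>
        \<le> 2 * (1 + S) * B * exp ?z"
      using m_ge by (simp add: abs_mult sg1)
    have "\<bar>D (F (j + 3) + k)\<bar> \<le> \<bar>D (F j + k)\<bar> + B * exp ?z + 2 * (1 + S) * B * exp ?z"
      using 1 2 eps1[of j "D (F j + k)"] unfolding D_low[OF that] by linarith
    then show ?thesis by (simp add: A_def distrib_right)
  qed
  have high: "\<bar>D (F (j + 3) + F (j + 1) + r)\<bar> \<le> \<bar>D (F (j + 2) + r)\<bar> + A * exp (- \<rho> * (F (j + 2) - r))"
    if "1 \<le> j" "r < F j" for j r
  proof -
    let ?z = "- \<rho> * real (F (j + 2) - r)"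
    have "r \<le> F (j + 2)" using that F_mono[of j "j + 2"] by simp
    then have e: "real (F (j + 2) - r) = real (F (j + 1)) + real (F j) - real r"
      "real (F (j + 2)) = real (F (j + 1)) + real (F j)" "real (F (j + 3)) = 2 * real (F (j + 1)) + real (F j)"
      using F_expand[of j] by (simp_all add: of_nat_diff)
    have e': "\<rho> * real (F (j + 2) - r) = \<rho> * real (F (j + 1)) + \<rho> * real (F j) - \<rho> * real r"
      "\<rho> * real (F (j + 2)) = \<rho> * real (F (j + 1)) + \<rho> * real (F j)"
      "\<rho> * real (F (j + 3)) = 2 * (\<rho> * real (F (j + 1))) + \<rho> * real (F j)"
      "\<rho> * real (F (j + 1) + r) = \<rho> * real (F (j + 1)) + \<rho> * real r"
      unfolding e of_nat_add by (simp_all only: distrib_left right_diff_distrib mult.left_commute)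
    have e'': "?z = - (\<rho> * real (F (j + 2) - r))" by simp
    have 1: "\<bar>m * (fst (pt (F (j + 1) + r)) * g (j + 3))\<bar> \<le> B * exp ?z"
      by (rule fst_g) (use e' e'' in linarith)+
    have 2: "\<bar>m * (fst (pt r) * g (j + 2))\<bar> \<le> B * exp ?z"
      by (rule fst_g) (use e' e'' in linarith)+
    have "\<bar>D (F (j + 3) + F (j + 1) + r)\<bar> \<le> \<bar>D (F (j + 2) + r)\<bar> + 2 * B * exp ?z"
      using 1 2 eps1[of j "D (F (j + 2) + r)"] eps1[of j "m * (fst (pt r) * g (j + 2))"] that
      unfolding D_high[OF that(1) less_imp_le[OF that(2)]] mult_minus_left by linarith
    also have "2 * B * exp ?z \<le> A * exp ?z" using A by simp
    finally show ?thesis by simp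
  qed
  define t where "t = exp (- \<rho>)"
  have t: "0 < t" "t < 1" using rho by (simp_all add: t_def)
  \<comment> \<open>The summands serve in turn the inductive step (t bounds the ratio of the
    subtracted terms), the Fibonacci lengths and their direct successors in the reduction, and the
    exceptional lengths with \<open>al\<close> at most 4, among them n = 4.\<close>
  define K where "K = 2 * A / (1 - t) + G + A + (1 + A + \<bar>D 4\<bar>) * exp (\<rho> * 4)"
  have pos: "0 \<le> 2 * A / (1 - t)" "0 \<le> (1 + A + \<bar>D 4\<bar>) * exp (\<rho> * 4)" using A t by simp_all
  have K: "0 \<le> K" "G + A \<le> K" "(1 + A + \<bar>D 4\<bar>) * exp (\<rho> * 4) \<le> K"
    using pos A G_nonneg by (simp_all add: K_def)
  have Kt: "2 * A \<le> K * (1 - t)"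
  proof -
    have "2 * A = 2 * A / (1 - t) * (1 - t)" using t by simp
    also have "\<dots> \<le> K * (1 - t)" using t A G_nonneg pos by (intro mult_right_mono) (simp_all add: K_def)
    finally show ?thesis .
  qed
  have step: "x \<le> K * (2 * exp (- \<rho> * al n) - exp (- \<rho> * n))"
    if "x \<le> y + 2 * A * exp (- \<rho> * k)" "y \<le> K * (2 * exp (- \<rho> * al k) - exp (- \<rho> * k))" "k < n" "al n = al k"
    for x y and n k :: nat
  proof -
    have "exp (- \<rho> * n) \<le> exp (- \<rho> * (real k + 1))" using that(3) rho by simp
    also have "\<dots> = t * exp (- \<rho> * k)" by (simp add: t_def algebra_simps flip: exp_add)
    finally have "K * exp (- \<rho> * n) \<le> K * (t * exp (- \<rho> * k))" using K by (intro mult_left_mono)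
    moreover have "2 * A * exp (- \<rho> * k) \<le> K * (1 - t) * exp (- \<rho> * k)" using Kt by simp
    ultimately show ?thesis using that(1,2) unfolding that(4) by (simp add: algebra_simps)
  qed
  have small: "x \<le> K * (2 * exp (- \<rho> * al n) - exp (- \<rho> * n))"
    if "x \<le> 1 + A + \<bar>D 4\<bar>" "al n \<le> 4" for x and n :: nat
  proof -
    have le: "exp (- \<rho> * n) \<le> exp (- \<rho> * al n)" using al_le[of n] rho by simp
    have "1 + A + \<bar>D 4\<bar> = (1 + A + \<bar>D 4\<bar>) * exp (\<rho> * 4) * exp (- \<rho> * 4)" by (simp flip: exp_add)
    also have "\<dots> \<le> K * exp (- \<rho> * 4)" using K by (intro mult_right_mono) simp_all
    also have "\<dots> \<le> K * exp (- \<rho> * al n)" using that(2) rho K by (intro mult_left_mono) simp_all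
    also have "\<dots> \<le> K * (2 * exp (- \<rho> * al n) - exp (- \<rho> * n))" using le K by (intro mult_left_mono) simp_all
    finally show ?thesis using that(1) by simp
  qed
  have base: "x \<le> K * (2 * exp (- \<rho> * al n) - exp (- \<rho> * n))"
    if "x \<le> (G + A) * exp (- \<rho> * al n)" for x and n :: nat
  proof -
    have le: "exp (- \<rho> * n) \<le> exp (- \<rho> * al n)" using al_le[of n] rho by simp
    have "x \<le> K * exp (- \<rho> * al n)"
      by (rule order_trans[OF that mult_right_mono[OF K(2)]]) simp
    also have "\<dots> \<le> K * (2 * exp (- \<rho> * al n) - exp (- \<rho> * n))" using le K by (intro mult_left_mono) simp_all
    finally show ?thesis .
  qed
  have al_pre: "al (F (j + 2) - 1) \<le> 4" for j
  proof (cases "5 \<le> j + 2")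
    case True
    then show ?thesis using al_near_F[of "j + 2"] by simp
  next
    case False
    then have "F (j + 2) \<le> 5" using F_mono[of "j + 2" 4] F_values by simp
    then show ?thesis using al_le[of "F (j + 2) - 1"] by simp
  qed
  have main: "\<bar>D n\<bar> \<le> K * (2 * exp (- \<rho> * al n) - exp (- \<rho> * n))" for n
  proof (induction n rule: less_induct)
    case (less n)
    show ?case
    proof (cases "n = 0")
      case True
      then show ?thesis using K by (simp add: D_def om_0 X2_0 al_0)
    next
      case False
      then have "n \<ge> 1" by simp
      then show ?thesis
      proof (cases rule: block_cases)
        case (1 i)
        have "\<bar>D n\<bar> \<le> G * exp (- \<rho> * al n)" using D_F[OF 1(1)] 1(2) al_F by simp
        also have "\<dots> \<le> (G + A) * exp (- \<rho> * al n)" using A by simp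
        finally show ?thesis by (rule base)
      next
        case (2 j k)
        have n_gt: "F j + k < n" using 2 F_expand(2)[of j] F_pos[of "j + 1"] by simp
        have al_n: "al n = al (F j + k)" unfolding 2(1) by (rule al_block[OF 2(2,3)])
        consider "k + 1 < F (j + 1)" | "k + 1 = F (j + 1)" | "F (j + 1) \<le> k" by linarith
        then show ?thesis
        proof cases
          case low': 1
          have "1 \<le> j"
          proof (rule ccontr)
            assume "\<not> 1 \<le> j"
            then have "j = 0" by simp
            then show False using low' by (simp add: F_1)
          qed
          have "\<bar>D n\<bar> \<le> \<bar>D (F j + k)\<bar> + A * exp (- \<rho> * real (F j + k))"
            using low[OF \<open>1 \<le> j\<close> 2(2) low'] 2(1) by simp
          also have "\<dots> \<le> \<bar>D (F j + k)\<bar> + 2 * A * exp (- \<rho> * real (F j + k))" using A by simp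
          finally show ?thesis by (rule step[OF _ less.IH[OF n_gt] n_gt al_n])
        next
          case mid: 2
          have "\<bar>D n\<bar> \<le> 1 + A + \<bar>D 4\<bar>" using D_mid[OF 2(2) mid] 2(1) A by simp
          moreover have "F j + k = F (j + 2) - 1" using mid F_expand(1)[of j] by simp
          ultimately show ?thesis using al_pre[of j] al_n by (intro small) simp_all
        next
          case high': 3
          define r where "r = k - F (j + 1)"
          have r: "k = F (j + 1) + r" "r < F j" using high' 2(3) F_expand(1)[of j] by (simp_all add: r_def)
          have s: "F j + k = F (j + 2) + r" "n = F (j + 3) + F (j + 1) + r"
            using r 2(1) F_expand(1)[of j] by simp_all
          have "1 \<le> j \<or> r = 0 \<and> j = 0" using r(2) by (cases j) (simp_all add: F_0)
          then consider "j = 0" | "1 \<le> j" "r = 0" | "1 \<le> j" "0 < r" by linarith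
          then show ?thesis
          proof cases
            case 1
            \<comment> \<open>With j = 0 the only interior length is F 3 + 1 = 4, to which the high
              recursion does not apply.\<close>
            then have n4: "n = 4" using 2 F_values by (simp add: numeral_2_eq_2 numeral_3_eq_3)
            have "al n \<le> 4" using al_le[of n] n4 by simp
            then show ?thesis using A n4 by (intro small) simp_all
          next
            case j: 2
            have "\<bar>D n\<bar> \<le> \<bar>D (F (j + 2))\<bar> + A * exp (- \<rho> * F (j + 2))"
              using high[OF j(1) r(2)] j(2) s by simp
            also have "\<dots> \<le> (G + A) * exp (- \<rho> * al n)"
              using D_F[of "j + 2"] al_n s j(2) by (simp add: al_F distrib_right)
            finally show ?thesis by (rule base)
          next
            case j: 3
            \<comment> \<open>The error of the high step is governed by F(j+2) - r, too large to be
              compared with the length F(j+2) + r. A second, low reduction to F p + r \<le> F(j+2) -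
              r repairs this; both errors are then charged to F p + r, whence the 2A in
              \<open>step\<close>.\<close>
            obtain p where p: "j = p + 1" using j(1) le_Suc_ex by (metis add.commute)
            have pe: "F (j + 2) = F (p + 3)" "F j = F (p + 1)" "F (j + 1) = F (p + 2)"
              using p by (simp_all add: numeral_eq_Suc)
            have al_r: "al (F (j + 2) + r) = al (F p + r)"
              unfolding pe by (rule al_block) (use j r pe F_less[of p] in simp_all)
            have hi: "\<bar>D n\<bar> \<le> \<bar>D (F (j + 2) + r)\<bar> + A * exp (- \<rho> * (F (j + 2) - r))"
              using high[OF j(1) r(2)] s by simp
            show ?thesis
            proof (cases "r + 1 = F j")
              case True
              have "\<bar>D (F (j + 2) + r)\<bar> \<le> 1" unfolding pe by (rule D_mid) (use j True pe in simp_all)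
              moreover have "A * exp (- \<rho> * (F (j + 2) - r)) \<le> A * 1"
                using A rho by (intro mult_left_mono) simp_all
              ultimately have "\<bar>D n\<bar> \<le> 1 + A + \<bar>D 4\<bar>" using hi by linarith
              moreover have eqp: "F p + r = F (p + 2) - 1" using True pe F_expand(1)[of p] by simp
              have "al n \<le> 4" unfolding al_n s(1) al_r eqp by (rule al_pre)
              ultimately show ?thesis by (rule small)
            next
              case False
              then have lt: "r + 1 < F (p + 1)" using r(2) pe by simp
              have "1 \<le> p"
              proof (rule ccontr)
                assume "\<not> 1 \<le> p"
                then have "p = 0" by simp
                then show False using lt by (simp add: F_1)
              qed
              have "\<bar>D (F (j + 2) + r)\<bar> \<le> \<bar>D (F p + r)\<bar> + A * exp (- \<rho> * real (F p + r))"
                unfolding pe using low[OF \<open>1 \<le> p\<close> j(2) lt] by simp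
              moreover have "A * exp (- \<rho> * (F (j + 2) - r)) \<le> A * exp (- \<rho> * real (F p + r))"
              proof -
                have "F p + r \<le> F (j + 2) - r" using lt pe F_expand[of p] by simp
                then show ?thesis using A rho by (intro mult_left_mono) simp_all
              qed
              ultimately have "\<bar>D n\<bar> \<le> \<bar>D (F p + r)\<bar> + 2 * A * exp (- \<rho> * real (F p + r))"
                using hi by simp
              moreover have "F p + r < n" using s lt pe F_expand[of p] by simp
              moreover have "al n = al (F p + r)" using al_n s al_r by simp
              ultimately show ?thesis by (intro step[OF _ less.IH])
            qed
          qed
        qed
      qed
    qed
  qed
  have "\<bar>D n\<bar> \<le> (2 * K) * exp (- \<rho> * al n)" for n
  proof -
    have "0 \<le> K * exp (- \<rho> * n)" using K(1) by simp
    then show ?thesis using main[of n] unfolding right_diff_distrib mult.assoc by linarith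
  qed
  then show ?thesis using that[of "2 * K"] K by simp
qed

end

section \<open>The exponential rate\<close>

lemma geometric_increments_tail:
  fixes v :: "nat \<Rightarrow> real"
  assumes "\<And>i. \<bar>v (Suc i) - v i\<bar> \<le> A * (1 / 16) ^ i"
  obtains s where "\<And>i. \<bar>v i - s\<bar> \<le> 2 * A * (1 / 16) ^ i"
proof -
  have A: "0 \<le> A" using assms[of 0] by simp
  have part: "\<bar>v (i + k) - v i\<bar> \<le> 2 * A * (1 / 16) ^ i - 2 * A * (1 / 16) ^ (i + k)" for i k
  proof (induction k)
    case (Suc k)
    have "\<bar>v (i + Suc k) - v i\<bar> \<le> \<bar>v (Suc (i + k)) - v (i + k)\<bar> + \<bar>v (i + k) - v i\<bar>"
      by simp
    also have "\<dots> \<le> A * (1 / 16) ^ (i + k) + (2 * A * (1 / 16) ^ i - 2 * A * (1 / 16) ^ (i + k))"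
      by (rule add_mono[OF assms Suc])
    also have "\<dots> \<le> 2 * A * (1 / 16) ^ i - 2 * A * (1 / 16) ^ (i + Suc k)"
      using A by (simp add: power_add)
    finally show ?case .
  qed simp
  have "summable (\<lambda>i. v (Suc i) - v i)"
  proof (rule summable_comparison_test')
    show "summable (\<lambda>i. A * (1 / 16 :: real) ^ i)" by (intro summable_mult summable_geometric) simp
  qed (use assms in simp)
  then have "convergent v" by (simp add: summable_iff_convergent sum_lessThan_telescope convergent_diff_const_right_iff)
  then obtain s where s: "v \<longlonglongrightarrow> s" by (auto simp: convergent_def)
  have "\<bar>v i - s\<bar> \<le> 2 * A * (1 / 16) ^ i" for i
  proof (rule tendsto_upperbound)
    show "(\<lambda>k. \<bar>v i - v (i + k)\<bar>) \<longlonglongrightarrow> \<bar>v i - s\<bar>"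
      using LIMSEQ_ignore_initial_segment[OF s, of i] by (intro tendsto_intros) (simp add: add.commute)
    have "\<bar>v i - v (i + k)\<bar> \<le> 2 * A * (1 / 16) ^ i" for k
    proof -
      have "0 \<le> 2 * A * (1 / 16) ^ (i + k)" using A by simp
      then show ?thesis using part[of i k] by linarith
    qed
    then show "\<forall>\<^sub>F k in sequentially. \<bar>v i - v (i + k)\<bar> \<le> 2 * A * (1 / 16) ^ i" by simp
  qed simp
  then show ?thesis using that by blast
qed

text \<open>With \<open>\<phi>\<close> the golden ratio, \<open>r\<^sub>i\<^sub>+\<^sub>1 + (\<phi> - 1) r\<^sub>i\<close> satisfies a perturbed recurrence of
  order one with ratio \<open>\<phi>\<close>, whose solution is then fed into the contraction of ratio \<open>\<phi> - 1\<close>.\<close>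

lemma approx_fib_recurrence:
  fixes r :: "nat \<Rightarrow> real"
  assumes "\<And>i. i0 \<le> i \<Longrightarrow> \<bar>r (i + 2) - r (i + 1) - r i\<bar> \<le> A * (1 / 16) ^ i"
  shows "\<exists>\<rho> B. 0 \<le> B \<and> (\<forall>i\<ge>i0. \<bar>r i - \<rho> * real (F i)\<bar> \<le> B * (3 / 4) ^ i)"
proof -
  define \<phi> where "\<phi> = (1 + sqrt 5) / 2"
  have "0 * (1 / 16) ^ i0 \<le> A * (1 / 16) ^ i0" using order_trans[OF abs_ge_zero assms[of i0]] by simp
  then have A: "0 \<le> A" by (rule mult_right_le_imp_le) simp
  have "11 / 5 \<le> sqrt 5" by (rule real_le_rsqrt) (simp add: power2_eq_square)
  moreover have "sqrt 5 \<le> 9 / 4" by (rule real_le_lsqrt) (simp_all add: power2_eq_square)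
  ultimately have phi: "16 / 10 \<le> \<phi>" "\<phi> \<le> 13 / 8" by (simp_all add: \<phi>_def)
  have phi2: "\<phi> * \<phi> = \<phi> + 1" by (simp add: \<phi>_def field_simps)
  define u where "u i = r (Suc i) + (\<phi> - 1) * r i" for i
  have u_step: "u (Suc i) - \<phi> * u i = r (i + 2) - r (i + 1) - r i" for i
    using phi2 by (simp add: u_def) algebra
  define v where "v i = u (i0 + i) / \<phi> ^ (i0 + i)" for i
  have "\<bar>v (Suc i) - v i\<bar> \<le> A * (1 / 16) ^ i" for i
  proof -
    have "v (Suc i) - v i = (r (i0 + i + 2) - r (i0 + i + 1) - r (i0 + i)) / \<phi> ^ Suc (i0 + i)"
      using u_step[of "i0 + i"] phi by (simp add: v_def field_simps)
    also have "\<bar>\<dots>\<bar> \<le> A * (1 / 16) ^ (i0 + i) / 1"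
      unfolding abs_divide
    proof (rule frac_le)
      have "1 \<le> \<phi> ^ Suc (i0 + i)" using phi by (intro one_le_power) simp
      then show "1 \<le> \<bar>\<phi> ^ Suc (i0 + i)\<bar>" by simp
      show "\<bar>r (i0 + i + 2) - r (i0 + i + 1) - r (i0 + i)\<bar> \<le> A * (1 / 16) ^ (i0 + i)"
        by (rule assms) simp
    qed (use A in simp_all)
    also have "\<dots> \<le> A * (1 / 16) ^ i"
      using A by (simp add: mult_left_mono power_decreasing)
    finally show ?thesis .
  qed
  then obtain s where s: "\<And>i. \<bar>v i - s\<bar> \<le> 2 * A * (1 / 16) ^ i"
    by (rule geometric_increments_tail) blast
  have u_s: "\<bar>u (i0 + i) - s * \<phi> ^ (i0 + i)\<bar> \<le> 2 * A * 2 ^ i0 * (1 / 2) ^ i" for i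
  proof -
    have "u (i0 + i) - s * \<phi> ^ (i0 + i) = (v i - s) * \<phi> ^ (i0 + i)"
      using phi by (simp add: v_def field_simps)
    also have "\<bar>\<dots>\<bar> = \<bar>v i - s\<bar> * \<phi> ^ (i0 + i)" using phi by (simp add: abs_mult)
    also have "\<dots> \<le> 2 * A * (1 / 16) ^ i * 2 ^ (i0 + i)"
      using s phi A by (intro mult_mono power_mono) simp_all
    also have "\<dots> = 2 * A * 2 ^ i0 * (1 / 8) ^ i"
      by (simp add: power_add power_divide field_simps flip: power_mult_distrib)
    also have "\<dots> \<le> 2 * A * 2 ^ i0 * (1 / 2) ^ i"
      using A by (intro mult_left_mono power_mono) simp_all
    finally show ?thesis .
  qed
  define \<rho> where "\<rho> = s / \<phi>"
  \<comment> \<open>The combination of consecutive Fibonacci numbers used in u is a pure power of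
    \<phi>, so the choice \<rho> = s / \<phi> removes the main term exactly.\<close>
  have F_phi: "real (F (Suc i)) + (\<phi> - 1) * real (F i) = \<phi> ^ Suc i" for i
  proof (induction i)
    case 0
    then show ?case by (simp add: F_0 F_1)
  next
    case (Suc i)
    have "\<phi> ^ Suc (Suc i) = \<phi> * (real (F (Suc i)) + (\<phi> - 1) * real (F i))"
      using Suc by simp
    also have "\<dots> = real (F (Suc (Suc i))) + (\<phi> - 1) * real (F (Suc i))"
      using phi2 by (simp add: F_Suc_Suc) algebra
    finally show ?case by simp
  qed
  define x where "x i = r (i0 + i) - \<rho> * real (F (i0 + i))" for i
  define A' where "A' = 2 * A * 2 ^ i0"
  have A': "0 \<le> A'" using A by (simp add: A'_def)
  have x_step: "\<bar>x (Suc i)\<bar> \<le> 5 / 8 * \<bar>x i\<bar> + A' * (1 / 2) ^ i" for i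
  proof -
    have "x (Suc i) + (\<phi> - 1) * x i = u (i0 + i) - \<rho> * (real (F (Suc (i0 + i))) + (\<phi> - 1) * real (F (i0 + i)))"
      by (simp add: x_def u_def algebra_simps)
    also have "\<dots> = u (i0 + i) - s * \<phi> ^ (i0 + i)"
      unfolding F_phi using phi by (simp add: \<rho>_def)
    finally have "\<bar>x (Suc i)\<bar> \<le> A' * (1 / 2) ^ i + \<bar>(\<phi> - 1) * x i\<bar>"
      using u_s[of i] unfolding A'_def by linarith
    moreover have "\<bar>(\<phi> - 1) * x i\<bar> \<le> 5 / 8 * \<bar>x i\<bar>"
      using phi unfolding abs_mult by (intro mult_right_mono) simp_all
    ultimately show ?thesis by simp
  qed
  \<comment> \<open>The summand 8 A' makes the perturbation at most B / 8 times the power of 3/4,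
    and 5/8 + 1/8 = 3/4.\<close>
  define B where "B = \<bar>x 0\<bar> + 8 * A'"
  have B: "0 \<le> B" using A' by (simp add: B_def)
  have x_le: "\<bar>x i\<bar> \<le> B * (3 / 4) ^ i" for i
  proof (induction i)
    case 0
    then show ?case using A' by (simp add: B_def)
  next
    case (Suc i)
    have "A' * (1 / 2) ^ i \<le> B / 8 * (3 / 4) ^ i"
      using A' by (intro mult_mono power_mono) (simp_all add: B_def)
    then have "\<bar>x (Suc i)\<bar> \<le> 5 / 8 * (B * (3 / 4) ^ i) + B / 8 * (3 / 4) ^ i"
      using x_step[of i] Suc by linarith
    then show ?case by simp
  qed
  have "\<bar>r i - \<rho> * real (F i)\<bar> \<le> B * (4 / 3) ^ i0 * (3 / 4) ^ i" if i: "i0 \<le> i" for i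
  proof -
    obtain k where k: "i = i0 + k" using le_Suc_ex[OF i] by blast
    have "(4 / 3 :: real) ^ i0 * (3 / 4) ^ i = (4 / 3 * (3 / 4)) ^ i0 * (3 / 4) ^ k"
      unfolding k power_add power_mult_distrib by (simp only: mult.assoc)
    then have "B * (4 / 3) ^ i0 * (3 / 4) ^ i = B * (3 / 4) ^ k" by (simp add: mult.assoc)
    then show ?thesis using x_le[of k] unfolding x_def k by linarith
  qed
  moreover have "0 \<le> B * (4 / 3) ^ i0" using B by simp
  ultimately show ?thesis by blast
qed

section \<open>Sharp asymptotics of the matrices\<close>

context sym_data
begin

text \<open>Writing y1 / y0 as \<xi> minus a small quotient in both terms of the recursion makes
  \<xi> cancel.\<close>

lemma y0_growth:
  assumes "1 \<le> i" "m \<noteq> 0" "y0 i \<noteq> 0" "y0 (i + 1) \<noteq> 0"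
  shows "y0 (i + 2) = m * y0 (i + 1) * y0 i *
    (1 + sg (i + 1) * (err (c1 (i + 1)) / (m * y0 (i + 1)) - err (c1 i) / (m * y0 i)))"
  using assms(2-) unfolding rec0[OF assms(1)] err_def by (simp add: field_simps)

text \<open>The first identity computes the error of X_{i+2} through \<open>W i\<close> and shows
  that the leak is very small. Inserted in the second, this determines m |\<open>y0 i\<close>|
  |\<open>err (c1 i)\<close>| as 1 + o(1), the leading constant required for the errors.\<close>

lemma leak_mult_y0:
  assumes "1 \<le> i"
  shows "leak i * y0 (i + 1) = err (c1 (i + 2)) + sg i * err (c1 i) * err (c1 (i + 1))"
    "y0 i * leak i = m * y0 i * err (c1 i) + sg i * (\<epsilon> i + err (c1 i) * err (c1 i))"
proof -
  show "leak i * y0 (i + 1) = err (c1 (i + 2)) + sg i * err (c1 i) * err (c1 (i + 1))"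
    using err_W[of i "c1 (i + 1)"] unfolding W_c(3)[OF assms] by simp
  have "y0 i * (\<xi> * err (c1 i) - err (c2 i)) = \<epsilon> i + err (c1 i) * err (c1 i)"
    unfolding det[OF assms, symmetric] err_def by (simp add: algebra_simps)
  then show "y0 i * leak i = m * y0 i * err (c1 i) + sg i * (\<epsilon> i + err (c1 i) * err (c1 i))"
    unfolding leak_def by (simp add: distrib_left mult.left_commute)
qed

text \<open>Bounds up to a constant K improve themselves to bounds up to 1 + \<delta>. Growth of N
  like 4^i makes the relative perturbation of the recursion O(16^(-i)), as
  \<open>approx_fib_recurrence\<close> demands.\<close>

lemma sized_data_exists:
  fixes N :: "nat \<Rightarrow> real"
  assumes m: "1 \<le> m" and \<kappa>: "0 < \<kappa>" and K: "1 \<le> K"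
    and e_N: "\<And>i. 1 \<le> i \<Longrightarrow> \<bar>err (c1 i)\<bar> * N i \<le> K" "\<And>i. 1 \<le> i \<Longrightarrow> \<bar>err (c2 i)\<bar> * N i \<le> K"
    and N_y0: "\<And>i. 1 \<le> i \<Longrightarrow> N i \<le> K * (\<bar>y0 i\<bar> + 1)" "\<And>i. 1 \<le> i \<Longrightarrow> \<bar>y0 i\<bar> \<le> N i"
    and N_grow: "\<And>i. 1 \<le> i \<Longrightarrow> \<kappa> * 4 ^ i \<le> N i"
  shows "\<exists>\<rho> C \<delta>. sized_data m \<xi> y0 y1 y2 \<epsilon> \<rho> C \<delta>"
proof -
  have N_pos: "0 < N i" if "1 \<le> i" for i
    using N_grow[OF that] \<kappa> by (meson less_le_trans mult_pos_pos zero_less_numeral zero_less_power)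
  obtain k where k: "2 * K / \<kappa> < 4 ^ k" using real_arch_pow[of 4 "2 * K / \<kappa>"] by auto
  define i0 where "i0 = max 1 k"
  have N_big: "2 * K \<le> N i" if "i0 \<le> i" for i
  proof -
    have "2 * K \<le> \<kappa> * 4 ^ k" using k \<kappa> by (simp add: field_simps)
    also have "\<dots> \<le> \<kappa> * 4 ^ i" using \<kappa> that by (simp add: i0_def power_increasing)
    also have "\<dots> \<le> N i" using N_grow[of i] that by (simp add: i0_def)
    finally show ?thesis .
  qed
  have y_low: "N i \<le> 2 * K * \<bar>y0 i\<bar>" if "i0 \<le> i" for i
    using N_y0(1)[of i] N_big[OF that] that by (simp add: i0_def algebra_simps)
  have y_nz: "0 < \<bar>y0 i\<bar>" if "i0 \<le> i" for i
  proof -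
    have "0 < 2 * K * \<bar>y0 i\<bar>" using y_low[OF that] N_pos[of i] that by (simp add: i0_def)
    then show ?thesis using K by (simp add: zero_less_mult_iff)
  qed
  have ey: "\<bar>err (c1 i)\<bar> \<le> K / \<bar>y0 i\<bar>" "\<bar>err (c2 i)\<bar> \<le> K / \<bar>y0 i\<bar>" if "i0 \<le> i" for i
  proof -
    have i: "1 \<le> i" using that by (simp add: i0_def)
    have "\<bar>err (c1 i)\<bar> * \<bar>y0 i\<bar> \<le> \<bar>err (c1 i)\<bar> * N i" "\<bar>err (c2 i)\<bar> * \<bar>y0 i\<bar> \<le> \<bar>err (c2 i)\<bar> * N i"
      using N_y0(2)[OF i] by (simp_all add: mult_left_mono)
    then show "\<bar>err (c1 i)\<bar> \<le> K / \<bar>y0 i\<bar>" "\<bar>err (c2 i)\<bar> \<le> K / \<bar>y0 i\<bar>"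
      using e_N[OF i] y_nz[OF that] by (simp_all add: pos_le_divide_eq)
  qed
  define \<eta> where "\<eta> i = sg (i + 1) * (err (c1 (i + 1)) / (m * y0 (i + 1)) - err (c1 i) / (m * y0 i))" for i
  define c3 where "c3 = 8 * (K * K * K) / (\<kappa> * \<kappa>)"
  have c3: "0 < c3" using K \<kappa> by (simp add: c3_def)
  have quot: "\<bar>err (c1 i) / (m * y0 i)\<bar> \<le> c3 / 2 * (1 / 16) ^ j" if "i0 \<le> i" "j \<le> i" for i j
  proof -
    have "\<kappa> * 4 ^ j \<le> \<kappa> * 4 ^ i" using \<kappa> that by (simp add: power_increasing)
    also have "\<dots> \<le> 2 * K * \<bar>y0 i\<bar>" using N_grow[of i] y_low[of i] that by (simp add: i0_def)
    finally have *: "\<kappa> * 4 ^ j \<le> 2 * K * \<bar>y0 i\<bar>" .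
    have "(\<kappa> * 4 ^ j) * (\<kappa> * 4 ^ j) \<le> (2 * K * \<bar>y0 i\<bar>) * (2 * K * \<bar>y0 i\<bar>)"
      by (rule mult_mono[OF * *]) (use \<kappa> K in simp_all)
    then have le: "\<kappa> * \<kappa> * 16 ^ j \<le> 4 * (K * K) * (\<bar>y0 i\<bar> * \<bar>y0 i\<bar>)"
      by (simp add: mult_ac flip: power_mult_distrib)
    have "\<bar>err (c1 i) / (m * y0 i)\<bar> = \<bar>err (c1 i)\<bar> / (m * \<bar>y0 i\<bar>)" using m by (simp add: abs_mult)
    also have "\<dots> \<le> (K / \<bar>y0 i\<bar>) / (1 * \<bar>y0 i\<bar>)"
      using ey(1)[OF that(1)] m y_nz[OF that(1)] K by (intro frac_le mult_mono) simp_all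
    also have "\<dots> = K / (\<bar>y0 i\<bar> * \<bar>y0 i\<bar>)" by simp
    also have "\<dots> \<le> c3 / 2 / 16 ^ j"
    proof -
      define Y where "Y = \<bar>y0 i\<bar> * \<bar>y0 i\<bar>"
      have "0 < Y" unfolding Y_def using y_nz[OF that(1)] by (intro mult_pos_pos)
      have "K * (\<kappa> * \<kappa> * 16 ^ j) \<le> K * (4 * (K * K) * Y)"
        using le K unfolding Y_def by (intro mult_left_mono) simp_all
      then show ?thesis unfolding Y_def[symmetric] using \<open>0 < Y\<close> \<kappa> by (simp add: c3_def field_simps)
    qed
    also have "\<dots> = c3 / 2 * (1 / 16) ^ j" by (simp add: power_divide)
    finally show ?thesis .
  qed
  have eta: "\<bar>\<eta> i\<bar> \<le> c3 * (1 / 16) ^ i" if "i0 \<le> i" for i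
  proof -
    have "\<bar>\<eta> i\<bar> = \<bar>err (c1 (i + 1)) / (m * y0 (i + 1)) - err (c1 i) / (m * y0 i)\<bar>"
      by (simp add: \<eta>_def abs_mult sg_def)
    moreover have "\<bar>err (c1 (i + 1)) / (m * y0 (i + 1))\<bar> \<le> c3 / 2 * (1 / 16) ^ i"
      "\<bar>err (c1 i) / (m * y0 i)\<bar> \<le> c3 / 2 * (1 / 16) ^ i"
      using that by (intro quot; simp)+
    ultimately have "\<bar>\<eta> i\<bar> \<le> c3 / 2 * (1 / 16) ^ i + c3 / 2 * (1 / 16) ^ i"
      using abs_triangle_ineq4[of "err (c1 (i + 1)) / (m * y0 (i + 1))" "err (c1 i) / (m * y0 i)"]
      by (smt (verit))
    then show ?thesis by simp
  qed
  obtain k' where k': "2 * c3 < 16 ^ k'" using real_arch_pow[of 16 "2 * c3"] by auto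
  define i1 where "i1 = max i0 k'"
  have i1: "i0 \<le> i1" "1 \<le> i1" by (simp_all add: i1_def i0_def)
  have eta_half: "\<bar>\<eta> i\<bar> \<le> 1 / 2" if "i1 \<le> i" for i
  proof -
    have "(16 :: real) ^ k' \<le> 16 ^ i" using that by (intro power_increasing) (simp_all add: i1_def)
    then have "2 * c3 \<le> 16 ^ i" using k' by linarith
    then have "c3 * (1 / 16) ^ i \<le> 1 / 2" by (simp add: power_divide field_simps)
    then show ?thesis using eta[of i] that i1 by simp
  qed
  define z where "z i = m * \<bar>y0 i\<bar>" for i
  have z_pos: "0 < z i" if "i0 \<le> i" for i using y_nz[OF that] m by (simp add: z_def)
  have "\<exists>\<rho> B. 0 \<le> B \<and> (\<forall>i\<ge>i1. \<bar>ln (z i) - \<rho> * real (F i)\<bar> \<le> B * (3 / 4) ^ i)"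
  proof (rule approx_fib_recurrence)
    fix i assume i: "i1 \<le> i"
    have i': "1 \<le> i" "i0 \<le> i" "i0 \<le> i + 1" using i i1 by simp_all
    have "y0 (i + 2) = m * y0 (i + 1) * y0 i * (1 + \<eta> i)"
      unfolding \<eta>_def using y_nz i' m by (intro y0_growth) auto
    moreover have pos: "0 < 1 + \<eta> i" using eta_half[OF i] by linarith
    ultimately have "z (i + 2) = z (i + 1) * z i * (1 + \<eta> i)"
      using m by (simp add: z_def abs_mult mult_ac)
    moreover have "ln (z (i + 1) * z i * (1 + \<eta> i)) = ln (z (i + 1)) + ln (z i) + ln (1 + \<eta> i)"
      using z_pos[OF i'(2)] z_pos[OF i'(3)] pos by (subst ln_mult_pos | simp)+
    ultimately have "ln (z (i + 2)) = ln (z (i + 1)) + ln (z i) + ln (1 + \<eta> i)" by simp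
    then have "\<bar>ln (z (i + 2)) - ln (z (i + 1)) - ln (z i)\<bar> = \<bar>ln (1 + \<eta> i)\<bar>" by simp
    also have "\<dots> \<le> \<bar>\<eta> i\<bar> + 2 * (\<eta> i)\<^sup>2"
      using abs_ln_one_plus_x_minus_x_bound[of "\<eta> i"] eta_half[OF i] by linarith
    also have "(\<eta> i)\<^sup>2 \<le> \<bar>\<eta> i\<bar> * (1 / 2)"
      using mult_left_mono[OF eta_half[OF i], of "\<bar>\<eta> i\<bar>"] by (simp add: power2_eq_square)
    finally show "\<bar>ln (z (i + 2)) - ln (z (i + 1)) - ln (z i)\<bar> \<le> (2 * c3) * (1 / 16) ^ i" using eta[OF i'(2)] by simp
  qed
  then obtain \<rho> B :: real where B: "0 \<le> B" and r: "\<And>i. i1 \<le> i \<Longrightarrow> \<bar>ln (z i) - \<rho> * real (F i)\<bar> \<le> B * (3 / 4) ^ i"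
    by blast
  have r_B: "\<bar>ln (z i) - \<rho> * real (F i)\<bar> \<le> B" if "i1 \<le> i" for i
  proof -
    have "B * (3 / 4) ^ i \<le> B * 1" using B by (intro mult_left_mono power_le_one) simp_all
    then show ?thesis using r[OF that] by simp
  qed
  have rho: "0 < \<rho>"
  proof (rule ccontr)
    assume "\<not> 0 < \<rho>"
    then have le: "\<rho> * real (F i) \<le> 0" for i by (simp add: mult_nonpos_nonneg)
    obtain j where j: "2 * K * exp B / \<kappa> < 4 ^ j" using real_arch_pow[of 4 "2 * K * exp B / \<kappa>"] by auto
    define i where "i = max i1 j"
    have i: "i1 \<le> i" "i0 \<le> i" "1 \<le> i" using i1 by (simp_all add: i_def)
    have "ln (z i) \<le> B" using r_B[OF i(1)] le[of i] by linarith
    then have "z i \<le> exp B" using z_pos[OF i(2)] by (metis exp_le_cancel_iff exp_ln)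
    moreover have "\<bar>y0 i\<bar> \<le> z i" using m mult_right_mono[of 1 m "\<bar>y0 i\<bar>"] by (simp add: z_def)
    ultimately have "2 * K * \<bar>y0 i\<bar> \<le> 2 * K * exp B" using K by (intro mult_left_mono) simp_all
    then have "\<kappa> * 4 ^ i \<le> 2 * K * exp B" using N_grow[OF i(3)] y_low[OF i(2)] by linarith
    moreover have "\<kappa> * 4 ^ j \<le> \<kappa> * 4 ^ i" using \<kappa> by (simp add: i_def power_increasing)
    moreover have "2 * K * exp B < \<kappa> * 4 ^ j" using j \<kappa> by (simp add: field_simps)
    ultimately show False by linarith
  qed
  define E where "E i = exp (\<rho> * real (F i))" for i
  define q where "q = exp (- \<rho>)"
  have q: "0 < q" "q < 1" using rho by (simp_all add: q_def)
  have E_pos: "0 < E i" for i by (simp add: E_def)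
  have E_ge1: "1 \<le> E i" for i using rho by (simp add: E_def)
  have inv_E: "1 / E i \<le> q ^ i" for i
  proof -
    have "1 / E i = exp (- (\<rho> * real (F i)))" by (simp add: E_def exp_minus field_simps)
    also have "\<dots> \<le> exp (- (\<rho> * i))" using rho F_ge[of i] by simp
    also have "\<dots> = q ^ i" by (simp add: q_def mult.commute flip: exp_of_nat_mult)
    finally show ?thesis .
  qed
  have E_rec: "E (i + 2) = E (i + 1) * E i" for i
    by (simp add: E_def F_Suc_Suc distrib_left exp_add)
  define a where "a i = B * exp B * (3 / 4) ^ i" for i :: nat
  have a: "0 \<le> a i" "a i \<le> B * exp B" for i
  proof -
    show "0 \<le> a i" using B by (simp add: a_def)
    have "B * exp B * (3 / 4) ^ i \<le> B * exp B * 1" using B by (intro mult_left_mono power_le_one) simp_all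
    then show "a i \<le> B * exp B" by (simp add: a_def)
  qed
  have exp_le: "exp x \<le> 1 + a i" if "\<bar>x\<bar> \<le> B * (3 / 4) ^ i" for x and i :: nat
  proof -
    define b where "b = B * (3 / 4) ^ i"
    have b: "0 \<le> b" "b \<le> B" using B power_le_one[of "3 / 4 :: real" i] mult_left_mono[of "(3 / 4) ^ i" 1 B]
      by (simp_all add: b_def)
    have "exp b * (1 - b) \<le> exp b * exp (- b)"
      using exp_ge_add_one_self[of "- b"] by (intro mult_left_mono) simp_all
    then have "exp b \<le> 1 + b * exp b" by (simp add: exp_minus algebra_simps)
    also have "\<dots> \<le> 1 + b * exp B" using b by (simp add: mult_left_mono)
    finally have "exp b \<le> 1 + a i" by (simp add: a_def b_def mult_ac)
    moreover have "exp x \<le> exp b" using that by (simp add: b_def)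
    ultimately show ?thesis by linarith
  qed
  have zE: "z i \<le> E i * (1 + a i)" "E i \<le> z i * (1 + a i)" if i: "i1 \<le> i" for i
  proof -
    have zp: "0 < z i" using z_pos i i1 by simp
    define x where "x = ln (z i) - \<rho> * real (F i)"
    have "E i * exp x = z i" using zp by (simp add: E_def x_def flip: exp_add)
    moreover have "E i * exp x \<le> E i * (1 + a i)"
      using exp_le[OF r[OF i]] E_pos[of i] by (simp add: x_def)
    ultimately show "z i \<le> E i * (1 + a i)" by simp
    have "z i * exp (- x) = exp (ln (z i)) * exp (- x)" using zp by simp
    also have "\<dots> = E i" by (simp add: E_def x_def flip: exp_add)
    finally have "z i * exp (- x) = E i" .
    moreover have "z i * exp (- x) \<le> z i * (1 + a i)"
      using exp_le[of "- x" i] r[OF i] zp by (simp add: x_def abs_minus_commute)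
    ultimately show "E i \<le> z i * (1 + a i)" by simp
  qed
  define c5 where "c5 = m * (1 + B * exp B)"
  have BB: "0 \<le> B * exp B" using B by simp
  have c5: "1 \<le> c5" "1 + B * exp B \<le> c5"
  proof -
    have "1 * (1 + B * exp B) \<le> m * (1 + B * exp B)" using m BB by (intro mult_right_mono) simp_all
    then show "1 + B * exp B \<le> c5" by (simp add: c5_def)
    then show "1 \<le> c5" using BB by linarith
  qed
  have Ey: "E i \<le> c5 * \<bar>y0 i\<bar>" "\<bar>y0 i\<bar> \<le> c5 * E i" if i: "i1 \<le> i" for i
  proof -
    have "z i * (1 + a i) \<le> z i * (1 + B * exp B)"
      using a(2)[of i] z_pos[of i] i i1 by simp
    then show "E i \<le> c5 * \<bar>y0 i\<bar>" using zE(2)[OF i] by (simp add: z_def c5_def mult_ac)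
    have "\<bar>y0 i\<bar> \<le> z i" using m mult_right_mono[of 1 m "\<bar>y0 i\<bar>"] by (simp add: z_def)
    also have "\<dots> \<le> E i * (1 + a i)" by (rule zE(1)[OF i])
    also have "\<dots> \<le> E i * c5" using a(2)[of i] c5 E_pos[of i] by simp
    finally show "\<bar>y0 i\<bar> \<le> c5 * E i" by (simp add: mult.commute)
  qed
  define c7 where "c7 = K * c5"
  have c7: "0 < c7" using K c5 by (simp add: c7_def)
  have eE: "\<bar>err (c1 i)\<bar> \<le> c7 / E i" "\<bar>err (c2 i)\<bar> \<le> c7 / E i" if i: "i1 \<le> i" for i
  proof -
    have "K / \<bar>y0 i\<bar> \<le> c7 / E i"
      using Ey(1)[OF i] E_pos[of i] y_nz[of i] i i1 K by (simp add: c7_def field_simps mult_left_mono)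
    then show "\<bar>err (c1 i)\<bar> \<le> c7 / E i" "\<bar>err (c2 i)\<bar> \<le> c7 / E i"
      using ey[of i] i i1 by simp_all
  qed
  define c8 where "c8 = (c7 + c7 * c7) * c5"
  have c8: "0 < c8" unfolding c8_def using c7 c5 by (intro mult_pos_pos add_pos_pos) simp_all
  have leakE: "\<bar>leak i\<bar> \<le> c8 / (E i * E (i + 1) * E (i + 1))" if i: "i1 \<le> i" for i
  proof -
    have i1': "1 \<le> i" "i1 \<le> i + 1" "i1 \<le> i + 2" "i0 \<le> i + 1" using i i1 by simp_all
    have "\<bar>leak i\<bar> * \<bar>y0 (i + 1)\<bar> = \<bar>err (c1 (i + 2)) + sg i * err (c1 i) * err (c1 (i + 1))\<bar>"
      unfolding leak_mult_y0(1)[OF i1'(1), symmetric] abs_mult ..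
    also have "\<dots> \<le> \<bar>err (c1 (i + 2))\<bar> + \<bar>err (c1 i)\<bar> * \<bar>err (c1 (i + 1))\<bar>"
    proof -
      have "\<bar>sg i\<bar> = 1" by (simp add: sg_def)
      then have "\<bar>sg i * err (c1 i) * err (c1 (i + 1))\<bar> = \<bar>err (c1 i)\<bar> * \<bar>err (c1 (i + 1))\<bar>"
        by (simp add: abs_mult)
      then show ?thesis by linarith
    qed
    also have "\<dots> \<le> c7 / E (i + 2) + (c7 / E i) * (c7 / E (i + 1))"
      using eE(1) i i1' c7 E_pos by (intro add_mono mult_mono) (simp_all add: less_imp_le)
    also have "\<dots> = (c7 + c7 * c7) / (E i * E (i + 1))"
      unfolding E_rec using E_pos[of i] E_pos[of "i + 1"] by (simp add: field_simps)
    finally have 1: "\<bar>leak i\<bar> * \<bar>y0 (i + 1)\<bar> \<le> (c7 + c7 * c7) / (E i * E (i + 1))" .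
    have "\<bar>leak i\<bar> * E (i + 1) \<le> \<bar>leak i\<bar> * (c5 * \<bar>y0 (i + 1)\<bar>)"
      using Ey(1)[OF i1'(2)] by (intro mult_left_mono) simp_all
    also have "\<dots> \<le> c5 * ((c7 + c7 * c7) / (E i * E (i + 1)))"
      using mult_left_mono[OF 1, of c5] c5 by (simp add: mult_ac)
    also have "\<dots> = c8 / (E i * E (i + 1))" by (simp add: c8_def mult_ac)
    finally show ?thesis using E_pos[of i] E_pos[of "i + 1"] by (simp add: field_simps)
  qed
  \<comment> \<open>The sequence \<delta> is assembled from the actual overshoots in the bounds, so
    those hold at every index; only the tail from i1 on needs estimating for summability.\<close>
  define b1 where "b1 i = (m * \<bar>y0 i\<bar> + 2 * \<bar>err (c1 i)\<bar> + \<bar>leak i\<bar>) / E i - 1" for i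
  define b2 where "b2 i = \<bar>err (c1 i)\<bar> * E i - 1" for i
  define b4 where "b4 i = \<bar>leak i\<bar> * exp (\<rho> * (F i + 2 * real (F (i - 1))))" for i
  define \<delta> where "\<delta> i = max 0 (b1 i) + max 0 (b2 i) + b4 i" for i
  have b4_nonneg: "0 \<le> b4 i" for i by (simp add: b4_def)
  have inv_E': "1 / E (i + 1) \<le> q ^ i" for i
    using inv_E[of "i + 1"] q power_decreasing[of i "i + 1" q] by linarith
  have leak1: "\<bar>leak i\<bar> * E i \<le> c8 * q ^ i" if i: "i1 \<le> i" for i
  proof -
    have "\<bar>leak i\<bar> * E i \<le> c8 / (E i * E (i + 1) * E (i + 1)) * E i"
      using leakE[OF i] E_pos[of i] by (intro mult_right_mono) simp_all
    also have "\<dots> = c8 * (1 / E (i + 1) * (1 / E (i + 1)))" using E_pos[of i] by (simp add: field_simps)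
    also have "\<dots> \<le> c8 * (q ^ i * 1)"
      using inv_E'[of i] E_ge1[of "i + 1"] E_pos[of "i + 1"] c8 q by (intro mult_left_mono mult_mono) simp_all
    finally show ?thesis by simp
  qed
  have b1_le: "b1 i \<le> a i + (2 * c7 + c8) * q ^ i" if i: "i1 \<le> i" for i
  proof -
    have "m * \<bar>y0 i\<bar> / E i \<le> 1 + a i" using zE(1)[OF i] E_pos[of i] by (simp add: z_def field_simps)
    moreover have "\<bar>err (c1 i)\<bar> / E i \<le> c7 * q ^ i"
    proof -
      have "\<bar>err (c1 i)\<bar> / E i \<le> (c7 / E i) / 1"
        using eE(1)[OF i] E_ge1[of i] c7 E_pos[of i] by (intro frac_le) simp_all
      also have "\<dots> \<le> c7 * q ^ i" using mult_left_mono[OF inv_E[of i], of c7] c7 by simp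
      finally show ?thesis .
    qed
    moreover have "\<bar>leak i\<bar> / E i \<le> c8 * q ^ i"
    proof -
      have "\<bar>leak i\<bar> / E i \<le> \<bar>leak i\<bar> * E i"
        using E_ge1[of i] E_pos[of i] mult_mono[of 1 "E i" 1 "E i"]
        by (simp add: divide_le_eq mult.assoc mult_le_cancel_left1)
      then show ?thesis using leak1[OF i] by simp
    qed
    ultimately show ?thesis by (simp add: b1_def add_divide_distrib distrib_right)
  qed
  define c9 where "c9 = (1 + B * exp B) * (c7 * c7 + c5 * c8)"
  have b2_le: "b2 i \<le> a i + c9 * q ^ i" if i: "i1 \<le> i" for i
  proof -
    have i': "1 \<le> i" using i i1 by simp
    let ?e = "\<bar>err (c1 i)\<bar>"
    have "z i * ?e = \<bar>m * y0 i * err (c1 i)\<bar>" using m by (simp add: z_def abs_mult)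
    also have "\<dots> = \<bar>y0 i * leak i - sg i * (\<epsilon> i + err (c1 i) * err (c1 i))\<bar>"
      unfolding leak_mult_y0(2)[OF i'] by simp
    also have "\<dots> \<le> \<bar>y0 i\<bar> * \<bar>leak i\<bar> + (1 + ?e * ?e)"
    proof -
      have "\<bar>sg i * (\<epsilon> i + err (c1 i) * err (c1 i))\<bar> = \<bar>\<epsilon> i + err (c1 i) * err (c1 i)\<bar>"
        by (simp add: abs_mult sg_def)
      also have "\<dots> \<le> 1 + ?e * ?e" using eps_abs[OF i'] abs_triangle_ineq[of "\<epsilon> i" "err (c1 i) * err (c1 i)"]
        by (simp add: abs_mult)
      finally show ?thesis using abs_triangle_ineq4[of "y0 i * leak i" "sg i * (\<epsilon> i + err (c1 i) * err (c1 i))"]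
        by (simp add: abs_mult)
    qed
    also have "\<bar>y0 i\<bar> * \<bar>leak i\<bar> \<le> c5 * (c8 * q ^ i)"
    proof -
      have "\<bar>y0 i\<bar> * \<bar>leak i\<bar> \<le> (c5 * E i) * \<bar>leak i\<bar>" using Ey(2)[OF i] by (intro mult_right_mono) simp_all
      also have "\<dots> \<le> c5 * (c8 * q ^ i)" using mult_left_mono[OF leak1[OF i], of c5] c5 by (simp add: mult_ac)
      finally show ?thesis .
    qed
    also have "?e * ?e \<le> c7 * c7 * q ^ i"
    proof -
      have "?e * ?e \<le> (c7 / E i) * (c7 / E i)" using eE(1)[OF i] c7 E_pos[of i] by (intro mult_mono) simp_all
      also have "\<dots> = c7 * c7 * (1 / E i * (1 / E i))" by simp
      also have "\<dots> \<le> c7 * c7 * (q ^ i * 1)"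
        using inv_E[of i] E_ge1[of i] E_pos[of i] c7 q by (intro mult_left_mono mult_mono) simp_all
      finally show ?thesis by simp
    qed
    finally have ze: "z i * ?e \<le> 1 + (c7 * c7 + c5 * c8) * q ^ i" by (simp add: algebra_simps)
    have "?e * E i \<le> ?e * (z i * (1 + a i))" using zE(2)[OF i] by (intro mult_left_mono) simp_all
    also have "\<dots> = (1 + a i) * (z i * ?e)" by (simp add: mult_ac)
    also have "\<dots> \<le> (1 + a i) * (1 + (c7 * c7 + c5 * c8) * q ^ i)"
      using ze a(1)[of i] by (intro mult_left_mono) simp_all
    also have "\<dots> = 1 + a i + (1 + a i) * ((c7 * c7 + c5 * c8) * q ^ i)" by (simp add: algebra_simps)
    also have "\<dots> \<le> 1 + a i + (1 + B * exp B) * ((c7 * c7 + c5 * c8) * q ^ i)"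
      using a(2)[of i] c7 c5 c8 q by (intro add_left_mono mult_right_mono) simp_all
    finally show ?thesis by (simp add: b2_def c9_def mult_ac)
  qed
  have b4_le: "b4 i \<le> c8 * q ^ i" if i: "i1 \<le> i" for i
  proof -
    obtain p where p: "i = p + 1" using i i1 le_Suc_ex[of 1 i] by (auto simp: add.commute)
    have "exp (\<rho> * (F i + 2 * real (F (i - 1)))) = E i * E p * E p"
      unfolding p by (simp add: E_def distrib_left mult.commute flip: exp_add)
    then have "b4 i = \<bar>leak i\<bar> * (E i * E p * E p)" by (simp only: b4_def)
    also have "\<dots> \<le> c8 / (E i * E (i + 1) * E (i + 1)) * (E i * E p * E p)"
      using E_pos[of i] E_pos[of p] by (intro mult_right_mono leakE i) simp
    also have "\<dots> = c8 * (1 / E i * (1 / E i))"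
    proof -
      have "E (i + 1) = E i * E p" using E_rec[of p] p by simp
      then show ?thesis using E_pos[of i] E_pos[of p] by (simp add: field_simps)
    qed
    also have "\<dots> \<le> c8 * (q ^ i * 1)"
      using inv_E[of i] E_ge1[of i] E_pos[of i] c8 q by (intro mult_left_mono mult_mono) simp_all
    finally show ?thesis by simp
  qed
  have c9: "0 \<le> c9" using BB c7 c5 c8 by (simp add: c9_def)
  define M where "M i = 2 * (B * exp B) * (3 / 4) ^ i + (2 * c7 + 2 * c8 + c9) * q ^ i" for i :: nat
  have "\<delta> i \<le> M i" if i: "i1 \<le> i" for i
  proof -
    have "max 0 (b1 i) \<le> a i + (2 * c7 + c8) * q ^ i" using b1_le[OF i] a(1)[of i] c7 c8 q by simp
    moreover have "max 0 (b2 i) \<le> a i + c9 * q ^ i" using b2_le[OF i] a(1)[of i] c9 q by simp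
    moreover have "M i = a i + a i + ((2 * c7 + c8) * q ^ i + c9 * q ^ i + c8 * q ^ i)"
      by (simp add: M_def a_def algebra_simps)
    ultimately show ?thesis using b4_le[OF i] unfolding \<delta>_def by linarith
  qed
  moreover have delta_nonneg: "0 \<le> \<delta> i" for i using b4_nonneg[of i] by (simp add: \<delta>_def)
  moreover have "summable M"
    unfolding M_def using q by (intro summable_add summable_mult summable_geometric) simp_all
  ultimately have summ: "summable \<delta>"
    by (intro summable_comparison_test[of \<delta> M]) auto
  \<comment> \<open>The finite sum covers the indices below i1.\<close>
  define C where "C = c7 + (\<Sum>j<i1. \<bar>err (c2 j)\<bar> * E j)"
  have sum_nonneg: "0 \<le> (\<Sum>j<i1. \<bar>err (c2 j)\<bar> * E j)" using E_pos by (intro sum_nonneg) (simp add: less_imp_le)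
  have expE: "exp (- \<rho> * real (F i)) = 1 / E i" for i by (simp add: E_def exp_minus field_simps)
  have "sized_data m \<xi> y0 y1 y2 \<epsilon> \<rho> C \<delta>"
  proof unfold_locales
    show "0 \<le> C" using c7 sum_nonneg by (simp add: C_def)
    fix i :: nat assume i: "1 \<le> i"
    have "b1 i \<le> \<delta> i" using b4_nonneg[of i] by (simp add: \<delta>_def)
    then show "m * \<bar>y0 i\<bar> + 2 * \<bar>err (c1 i)\<bar> + \<bar>leak i\<bar> \<le> exp (\<rho> * real (F i)) * (1 + \<delta> i)"
      using E_pos[of i] unfolding b1_def E_def[symmetric] by (simp add: field_simps)
    have "b2 i \<le> \<delta> i" using b4_nonneg[of i] by (simp add: \<delta>_def)
    then show "\<bar>err (c1 i)\<bar> \<le> exp (- \<rho> * real (F i)) * (1 + \<delta> i)"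
      using E_pos[of i] unfolding b2_def expE by (simp add: field_simps)
    show "\<bar>err (c2 i)\<bar> \<le> C * exp (- \<rho> * real (F i))"
    proof (cases "i1 \<le> i")
      case True
      have "c7 / E i \<le> C / E i" using sum_nonneg E_pos[of i] by (simp add: C_def divide_right_mono)
      then show ?thesis using eE(2)[OF True] unfolding expE by simp
    next
      case False
      then have "\<bar>err (c2 i)\<bar> * E i \<le> (\<Sum>j<i1. \<bar>err (c2 j)\<bar> * E j)"
        using E_pos by (intro member_le_sum) (simp_all add: less_imp_le)
      then have "\<bar>err (c2 i)\<bar> * E i \<le> C" using c7 by (simp add: C_def)
      then show ?thesis using E_pos[of i] unfolding expE by (simp add: field_simps)
    qed
    have "b4 i \<le> \<delta> i" by (simp add: \<delta>_def)
    then have "\<bar>leak i\<bar> * exp (\<rho> * (F i + 2 * real (F (i - 1)))) * exp (- \<rho> * (F i + 2 * real (F (i - 1))))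
        \<le> \<delta> i * exp (- \<rho> * (F i + 2 * real (F (i - 1))))"
      unfolding b4_def by (intro mult_right_mono) simp_all
    moreover have "exp (\<rho> * (F i + 2 * real (F (i - 1)))) * exp (- \<rho> * (F i + 2 * real (F (i - 1)))) = 1"
      by (simp flip: exp_add)
    ultimately show "\<bar>leak i\<bar> \<le> \<delta> i * exp (- \<rho> * (F i + 2 * real (F (i - 1))))"
      by (simp only: mult.assoc mult_1_right)
  qed (use m rho delta_nonneg summ in simp_all)
  then show ?thesis by blast
qed

end

section \<open>From the matrices to the points\<close>

lemma abs_entry_le_infnorm:
  fixes A :: "real^2^2"
  shows "\<bar>A $ i $ j\<bar> \<le> infnorm A"
proof -
  have "axis i (axis j 1) \<in> (Basis :: (real^2^2) set)" by (simp add: axis_in_Basis_iff)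
  then show ?thesis using Basis_le_infnorm[of "axis i (axis j 1)" A] by (simp add: inner_axis)
qed

lemma infnorm_le_entries:
  fixes A :: "real^2^2"
  assumes "\<And>i j. \<bar>A $ i $ j\<bar> \<le> B"
  shows "infnorm A \<le> B"
proof -
  have "\<bar>A \<bullet> b\<bar> \<le> B" if b: "b \<in> Basis" for b
  proof -
    obtain i j where "b = axis i (axis j 1)" using b unfolding Basis_vec_def Basis_real_def by blast
    then show ?thesis using assms[of i j] by (simp add: inner_axis)
  qed
  then show ?thesis by (simp add: infnorm_Max)
qed

lemma M_seq_inverse:
  "matrix_inv (M_seq m i) = vector [vector [0, - ((-1) ^ i)], vector [(-1) ^ i, m]]"
proof -
  define V :: "int^2^2" where "V = vector [vector [0, - ((-1) ^ i)], vector [(-1) ^ i, m]]"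
  have V: "M_seq m i ** V = mat 1" "V ** M_seq m i = mat 1"
    by (cases "even i";
      simp add: V_def M_seq_def M_mat_def matrix_matrix_mult_def transpose_def mat_def vec_eq_iff forall_2 sum_2 vector_2)+
  have "X = V" if "M_seq m i ** X = mat 1" for X
  proof -
    have "X = (V ** M_seq m i) ** X" by (simp add: V)
    also have "\<dots> = V ** (M_seq m i ** X)" by (simp only: matrix_mul_assoc)
    finally show ?thesis by (simp add: that)
  qed
  then have "matrix_inv (M_seq m i) = V"
    unfolding matrix_inv_def by (intro some_equality) (use V in blast)+
  then show ?thesis by (simp add: V_def)
qed

lemma invertible_int_det:
  fixes A :: "int^2^2"
  assumes "invertible A"
  shows "det A = 1 \<or> det A = -1"
proof -
  obtain B where "A ** B = mat 1" using assms by (auto simp: invertible_def)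
  then have "det A * det B = 1" by (metis det_I det_mul)
  then show ?thesis by (simp add: zmult_eq_1_iff) blast
qed

text \<open>Symmetry, integrality and unit determinants give the algebraic recursions; (E2) with
  unboundedness gives the growth 4^i, and (E3) bounds the errors by the inverse of the norm.\<close>

lemma E_set_sized_data:
  fixes m :: int and \<xi> :: real
  assumes "m \<ge> 1" and "\<xi> \<in> E_set m"
  obtains y0 y1 y2 \<epsilon> \<rho> C \<delta> where "sized_data (real_of_int m) \<xi> y0 y1 y2 \<epsilon> \<rho> C \<delta>"
proof -
  obtain W c where W: "\<And>i. 1 \<le> i \<Longrightarrow> invertible (W i)"
    "\<not> bounded ((\<lambda>i. real_mat (W i)) ` {1..})"
    "\<And>i. 1 \<le> i \<Longrightarrow> W (i + 2) = W (i + 1) ** W i"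
    and c: "c \<ge> 1"
    and sym: "\<And>i. 1 \<le> i \<Longrightarrow> transpose (W i ** matrix_inv (M_seq m i)) = W i ** matrix_inv (M_seq m i)"
    and E2: "\<And>i. 1 \<le> i \<Longrightarrow> inverse c * infnorm (real_mat (W (i + 1))) * infnorm (real_mat (W i))
          \<le> infnorm (real_mat (W (i + 2)))"
    and E3: "\<And>i. 1 \<le> i \<Longrightarrow> infnorm ((vector [\<xi>, -1] :: real^2) v* real_mat (W i))
          \<le> c * inverse (infnorm (real_mat (W i)))"
    using assms(2) unfolding E_set_def by blast
  define N where "N i = infnorm (real_mat (W i))" for i
  define w where "w i a b = real_of_int (W i $ a $ b)" for i a b
  \<comment> \<open>These are the entries (1,1), (2,1) and (2,2) of W_i M_i^(-1).\<close>
  define y0 where "y0 i = sg i * w i 1 2" for i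
  define y1 where "y1 i = sg i * w i 2 2" for i
  define y2 where "y2 i = m * w i 2 2 - sg i * w i 2 1" for i
  define \<epsilon> where "\<epsilon> i = real_of_int (det (W i))" for i
  have sgi: "real_of_int ((-1) ^ i) = sg i" for i by (simp add: sg_def)
  have symm: "sg i * w i 2 2 = m * w i 1 2 - sg i * w i 1 1" if i: "1 \<le> i" for i
  proof -
    have "(W i ** matrix_inv (M_seq m i)) $ 2 $ 1 = (W i ** matrix_inv (M_seq m i)) $ 1 $ 2"
      using arg_cong[OF sym[OF i], of "\<lambda>A. A $ 1 $ 2"] by (simp add: transpose_def)
    then have "W i $ 2 $ 2 * (-1) ^ i = W i $ 1 $ 2 * m - W i $ 1 $ 1 * (-1) ^ i"
      unfolding M_seq_inverse by (simp add: matrix_matrix_mult_def sum_2 vector_2)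
    from arg_cong[OF this, of real_of_int] show ?thesis
      by (simp add: w_def sgi mult.commute flip: sgi)
  qed
  have w_y: "w i 1 2 = sg i * y0 i" "w i 2 2 = sg i * y1 i"
    "w i 2 1 = m * y1 i - sg i * y2 i" for i
    by (simp_all add: y0_def y1_def y2_def algebra_simps)
  have w11: "w i 1 1 = m * y0 i - sg i * y1 i" if "1 \<le> i" for i
  proof -
    have "sg i * (sg i * w i 1 1) = sg i * (m * w i 1 2 - sg i * w i 2 2)" using symm[OF that] by simp
    then show ?thesis by (simp add: y0_def y1_def algebra_simps)
  qed
  have rec: "w (i + 2) a b = w (i + 1) a 1 * w i 1 b + w (i + 1) a 2 * w i 2 b" if "1 \<le> i" for i a b
    unfolding w_def W(3)[OF that] by (simp add: matrix_matrix_mult_def sum_2)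
  have ss: "sg i * sg i = 1" for i by simp
  interpret sym_data "real_of_int m" \<xi> y0 y1 y2 \<epsilon>
  proof unfold_locales
    fix i :: nat assume i: "1 \<le> i"
    show "y0 i \<in> \<int>" "y1 i \<in> \<int>" "y2 i \<in> \<int>"
      by (auto simp: y0_def y1_def y2_def w_def sg_def intro!: Ints_mult Ints_diff Ints_power)
    have "\<epsilon> i = w i 1 1 * w i 2 2 - w i 1 2 * w i 2 1"
      by (simp add: \<epsilon>_def det_2 w_def)
    then show "y0 i * y2 i - y1 i * y1 i = \<epsilon> i"
      unfolding w_y w11[OF i] using ss[of i] by algebra
    show "\<epsilon> i = 1 \<or> \<epsilon> i = - 1"
      using invertible_int_det[OF W(1)[OF i]] by (auto simp: \<epsilon>_def)
    have i': "1 \<le> i + 1" "1 \<le> i + 2" by simp_all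
    have s2: "sg (i + 2) = sg i" by simp
    note r = rec[OF i, of 1 2] rec[OF i, of 2 2] rec[OF i, of 1 1] rec[OF i, of 2 1]
    note r' = r[unfolded w_y w11[OF i] w11[OF i'(1)] w11[OF i'(2)] s2]
    have q: "sg (i + 1) = - sg i" by simp
    show a0: "y0 (i + 2) = y0 (i + 1) * (m * y0 i + sg (i + 1) * y1 i) - sg (i + 1) * y1 (i + 1) * y0 i"
      using r'(1) ss[of i] unfolding q by algebra
    show a1: "y1 (i + 2) = y1 (i + 1) * (m * y0 i + sg (i + 1) * y1 i) - sg (i + 1) * y2 (i + 1) * y0 i"
      using r'(2) ss[of i] unfolding q by algebra
    show a2: "y1 (i + 2) = y0 (i + 1) * (m * y1 i + sg (i + 1) * y2 i) - sg (i + 1) * y1 (i + 1) * y1 i"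
      using r'(3) ss[of i] a0 unfolding q by algebra
    show "y2 (i + 2) = y1 (i + 1) * (m * y1 i + sg (i + 1) * y2 i) - sg (i + 1) * y2 (i + 1) * y1 i"
      using r'(4) ss[of i] a1 unfolding q by algebra
  qed simp
  have w_N: "\<bar>w i a b\<bar> \<le> N i" for i a b
    using abs_entry_le_infnorm[of "real_mat (W i)" a b] by (simp add: N_def w_def map_matrix_def)
  have N_ge1: "1 \<le> N i" if i: "1 \<le> i" for i
  proof (rule ccontr)
    assume "\<not> 1 \<le> N i"
    then have "W i $ a $ b = 0" for a b
      using w_N[of i a b] by (simp add: w_def)
    then have "det (W i) = 0" by (simp add: det_2)
    then show False using invertible_int_det[OF W(1)[OF i]] by simp
  qed
  have err_w: "\<bar>\<xi> * w i 1 b - w i 2 b\<bar> * N i \<le> c" if i: "1 \<le> i" for i b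
  proof -
    have "((vector [\<xi>, -1] :: real^2) v* real_mat (W i)) $ b = \<xi> * w i 1 b - w i 2 b"
      by (simp add: vector_matrix_mult_def sum_2 vector_2 w_def map_matrix_def)
    then have "\<bar>\<xi> * w i 1 b - w i 2 b\<bar> \<le> c * inverse (N i)"
      using component_le_infnorm_cart[of "(vector [\<xi>, -1] :: real^2) v* real_mat (W i)" b] E3[OF i]
      unfolding N_def by simp
    then show ?thesis using N_ge1[OF i] by (simp add: field_simps)
  qed
  have sg1: "\<bar>sg i\<bar> = 1" for i by (simp add: sg_def)
  have e1: "\<bar>err (c1 i)\<bar> * N i \<le> c" if i: "1 \<le> i" for i
  proof -
    have "err (c1 i) = sg i * (\<xi> * w i 1 2 - w i 2 2)"
      by (simp add: err_def y0_def y1_def algebra_simps)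
    then show ?thesis using err_w[OF i, of 2] sg1[of i] by (simp add: abs_mult)
  qed
  have m1: "1 \<le> real_of_int m" using assms(1) by simp
  have e2: "\<bar>err (c2 i)\<bar> * N i \<le> (m + 1) * c" if i: "1 \<le> i" for i
  proof -
    have "\<xi> * w i 1 1 - w i 2 1 = m * err (c1 i) - sg i * err (c2 i)"
      unfolding w11[OF i] w_y by (simp add: err_def algebra_simps)
    then have "err (c2 i) = sg i * (m * err (c1 i) - (\<xi> * w i 1 1 - w i 2 1))" by simp
    then have "\<bar>err (c2 i)\<bar> = \<bar>m * err (c1 i) - (\<xi> * w i 1 1 - w i 2 1)\<bar>"
      using sg1[of i] by (simp add: abs_mult)
    also have "\<dots> \<le> m * \<bar>err (c1 i)\<bar> + \<bar>\<xi> * w i 1 1 - w i 2 1\<bar>"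
      using abs_triangle_ineq4[of "m * err (c1 i)"] m1 by (simp add: abs_mult)
    finally have "\<bar>err (c2 i)\<bar> * N i \<le> (m * \<bar>err (c1 i)\<bar> + \<bar>\<xi> * w i 1 1 - w i 2 1\<bar>) * N i"
      using N_ge1[OF i] by (intro mult_right_mono) simp_all
    also have "\<dots> = m * (\<bar>err (c1 i)\<bar> * N i) + \<bar>\<xi> * w i 1 1 - w i 2 1\<bar> * N i"
      by (simp add: algebra_simps)
    also have "\<dots> \<le> m * c + c"
      using e1[OF i] err_w[OF i, of 1] m1 by (intro add_mono mult_left_mono) simp_all
    finally show ?thesis by (simp add: algebra_simps)
  qed
  define X where "X = 1 + \<bar>\<xi>\<bar>"
  define c0 where "c0 = (m + 1) * c * (X * X) * 4"
  have X: "1 \<le> X" by (simp add: X_def)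
  have c_le: "c \<le> (m + 1) * c" using c m1 by (simp add: mult_le_cancel_right1)
  have XX: "1 \<le> X * X" "X \<le> X * X" using X mult_mono[of 1 X 1 X] mult_mono[of 1 X X X] by simp_all
  have c0_ge: "(m + 1) * c \<le> c0" "c \<le> c0" "1 \<le> c0"
  proof -
    have "0 \<le> (m + 1) * c" using m1 c by simp
    then have "(m + 1) * c * 1 \<le> (m + 1) * c * (X * X * 4)" using XX by (intro mult_left_mono) simp_all
    then show "(m + 1) * c \<le> c0" by (simp add: c0_def mult.assoc)
    then show "c \<le> c0" using c_le by simp
    then show "1 \<le> c0" using c by simp
  qed
  have err_le: "\<bar>err (c1 i)\<bar> \<le> c" "\<bar>err (c2 i)\<bar> \<le> (m + 1) * c" if i: "1 \<le> i" for i
    using e1[OF i] e2[OF i] N_ge1[OF i] mult_left_mono[of 1 "N i" "\<bar>err (c1 i)\<bar>"]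
      mult_left_mono[of 1 "N i" "\<bar>err (c2 i)\<bar>"] by simp_all
  \<comment> \<open>All entries are controlled by \<open>y0 i\<close>: by (E3) the second row is
    \<xi> times the first up to c, and symmetry expresses the entry (1,1) by \<open>y0 i\<close> and
    \<open>y1 i\<close>.\<close>
  have N_le: "N i \<le> c0 * (\<bar>y0 i\<bar> + 1)" if i: "1 \<le> i" for i
  proof -
    define Q where "Q = (m + 1) * c * (\<bar>y0 i\<bar> + 1)"
    have mc: "1 \<le> (m + 1) * c" using c c_le by linarith
    have Q: "\<bar>y0 i\<bar> \<le> Q" "(m + 1) * c \<le> Q" "0 \<le> Q" "m * \<bar>y0 i\<bar> \<le> Q"
    proof -
      have "1 * (\<bar>y0 i\<bar> + 1) \<le> Q" unfolding Q_def using mc by (intro mult_right_mono) simp_all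
      then show "\<bar>y0 i\<bar> \<le> Q" "0 \<le> Q" by simp_all
      have "(m + 1) * c * 1 \<le> Q" unfolding Q_def using mc by (intro mult_left_mono) simp_all
      then show "(m + 1) * c \<le> Q" by simp
      have "real_of_int m * 1 * (\<bar>y0 i\<bar> + 1) \<le> Q" unfolding Q_def using m1 c by (intro mult_right_mono mult_mono) simp_all
      then show "m * \<bar>y0 i\<bar> \<le> Q" using m1 by (simp add: algebra_simps)
    qed
    have X0: "0 \<le> X" "0 \<le> X * X" "\<bar>\<xi>\<bar> \<le> X" using X by (simp_all add: X_def)
    have XQ: "Q \<le> X * Q" "X * Q \<le> X * X * Q"
      using mult_right_mono[OF X Q(3)] mult_right_mono[OF XX(2) Q(3)] by simp_all
    have cQ: "c \<le> Q" using c_le Q(2) by linarith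
    have err_c: "\<bar>\<xi> * w i 1 b - w i 2 b\<bar> \<le> c" for b
      using err_w[OF i, of b] mult_left_mono[OF N_ge1[OF i], of "\<bar>\<xi> * w i 1 b - w i 2 b\<bar>"] by simp
    have below: "\<bar>w i 2 b\<bar> \<le> \<bar>\<xi>\<bar> * \<bar>w i 1 b\<bar> + c" for b
      using err_c[of b] abs_mult[of \<xi> "w i 1 b"] by linarith
    have w12: "\<bar>w i 1 2\<bar> = \<bar>y0 i\<bar>" and w22: "\<bar>w i 2 2\<bar> = \<bar>y1 i\<bar>"
      using sg1[of i] by (simp_all add: w_y abs_mult)
    have "\<bar>\<xi>\<bar> * \<bar>y0 i\<bar> \<le> \<bar>\<xi>\<bar> * Q" using Q(1) by (intro mult_left_mono) simp_all
    moreover have "X * Q = Q + \<bar>\<xi>\<bar> * Q" by (simp add: X_def algebra_simps)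
    ultimately have y1_le: "\<bar>y1 i\<bar> \<le> X * Q" using below[of 2] cQ unfolding w12 w22 by linarith
    have w11_le: "\<bar>w i 1 1\<bar> \<le> 2 * (X * Q)"
    proof -
      have "\<bar>w i 1 1\<bar> \<le> \<bar>m * y0 i\<bar> + \<bar>sg i * y1 i\<bar>" unfolding w11[OF i] by (rule abs_triangle_ineq4)
      also have "\<dots> = m * \<bar>y0 i\<bar> + \<bar>y1 i\<bar>" using m1 sg1[of i] by (simp add: abs_mult)
      finally show ?thesis using Q(4) XQ(1) y1_le by linarith
    qed
    have "\<bar>\<xi>\<bar> * \<bar>w i 1 1\<bar> \<le> X * (2 * (X * Q))"
      using X0 w11_le by (intro mult_mono) simp_all
    then have w21_le: "\<bar>w i 2 1\<bar> \<le> 4 * (X * X * Q)"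
      using below[of 1] cQ XQ Q(3) by (simp add: mult.assoc)
    have "\<bar>w i a b\<bar> \<le> 4 * (X * X * Q)" for a b
    proof -
      have "\<bar>w i 1 1\<bar> \<le> 4 * (X * X * Q)" using w11_le Q(3) XQ by linarith
      moreover have "\<bar>w i 1 2\<bar> \<le> 4 * (X * X * Q)" using w12 Q(1,3) XQ by linarith
      moreover have "\<bar>w i 2 2\<bar> \<le> 4 * (X * X * Q)" using w22 y1_le Q(3) XQ by linarith
      ultimately show ?thesis using exhaust_2[of a] exhaust_2[of b] w21_le by (elim disjE) simp_all
    qed
    then have "N i \<le> 4 * (X * X * Q)"
      unfolding N_def by (intro infnorm_le_entries) (simp add: w_def map_matrix_def)
    also have "\<dots> = c0 * (\<bar>y0 i\<bar> + 1)" unfolding c0_def Q_def by (simp only: mult_ac)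
    finally show ?thesis .
  qed
  have E2': "N (i + 1) * N i \<le> c * N (i + 2)" if "1 \<le> i" for i
    using E2[OF that] c unfolding N_def by (simp add: field_simps)
  \<comment> \<open>From norms at least 4c at two consecutive indices, (E2) gives growth by a factor
    4. The bound 4c^2 at one index i \<ge> 2 also ensures 4c at the next, using the predecessor i -
    1.\<close>
  obtain i where i: "2 \<le> i" "4 * c * c \<le> N i"
  proof -
    have "\<exists>i\<ge>2. 4 * c * c \<le> N i"
    proof (rule ccontr)
      assume "\<not> ?thesis"
      then have *: "N i < 4 * c * c" if "2 \<le> i" for i using that by force
      have "N i \<le> max (N 1) (4 * c * c)" if "1 \<le> i" for i
        using *[of i] that by (cases "i = 1") auto
      then have "norm (real_mat (W i)) \<le> sqrt DIM(real^2^2) * max (N 1) (4 * c * c)" if "1 \<le> i" for i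
        using norm_le_infnorm[of "real_mat (W i)"] that
        by (smt (verit, best) N_def mult_left_mono real_sqrt_ge_zero of_nat_0_le_iff)
      then have "bounded ((\<lambda>i. real_mat (W i)) ` {1..})"
        unfolding bounded_iff by (intro exI[of _ "sqrt DIM(real^2^2) * max (N 1) (4 * c * c)"]) auto
      then show False using W(2) by simp
    qed
    then show ?thesis using that by blast
  qed
  have big: "4 * c \<le> N (i + k)" for k
  proof (induction k rule: less_induct)
    case (less k)
    have cc: "4 * c \<le> 4 * c * c" using c by simp
    consider "k = 0" | "k = 1" | l where "k = l + 2" by (metis One_nat_def add_2_eq_Suc' not0_implies_Suc)
    then show ?case
    proof cases
      case 1
      then show ?thesis using i cc by simp
    next
      case 2
      have "N i * 1 \<le> N i * N (i - 1)" using N_ge1[of "i - 1"] N_ge1[of i] i by (intro mult_left_mono) simp_all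
      also have "\<dots> \<le> c * N (i + 1)" using E2'[of "i - 1"] i by (simp add: eval_nat_numeral)
      finally have "c * (4 * c) \<le> c * N (i + 1)" using i by (simp add: mult_ac)
      then show ?thesis using c 2 by simp
    next
      case 3
      have "(4 * c) * (4 * c) \<le> N (i + l + 1) * N (i + l)"
        using less.IH[of l] less.IH[of "l + 1"] 3 c by (intro mult_mono) (simp_all add: add.assoc)
      also have "\<dots> \<le> c * N (i + l + 2)" using E2'[of "i + l"] i by simp
      finally have "c * (16 * c) \<le> c * N (i + k)" using 3 by (simp add: mult_ac add.assoc)
      then have "16 * c \<le> N (i + k)" using c by simp
      then show ?thesis using c by simp
    qed
  qed
  have grow: "4 ^ k \<le> N (i + k)" for k
  proof (induction k rule: less_induct)
    case (less k)
    consider "k = 0" | "k = 1" | l where "k = l + 2" by (metis One_nat_def add_2_eq_Suc' not0_implies_Suc)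
    then show ?case
    proof cases
      case 1
      then show ?thesis using N_ge1[of i] i by simp
    next
      case 2
      then show ?thesis using big[of 1] c by simp
    next
      case 3
      have "4 ^ (l + 1) * (4 * c) \<le> N (i + l + 1) * N (i + l)"
        using less.IH[of "l + 1"] big[of l] 3 c N_ge1[of "i + l + 1"] by (intro mult_mono) (simp_all add: add.assoc)
      also have "\<dots> \<le> c * N (i + l + 2)" using E2'[of "i + l"] i by simp
      finally have "c * 4 ^ k \<le> c * N (i + k)" using 3 by (simp add: mult_ac add.assoc)
      then show ?thesis using c by simp
    qed
  qed
  define \<kappa> where "\<kappa> = (1 / 4 :: real) ^ i"
  have N_grow: "\<kappa> * 4 ^ j \<le> N j" if j: "1 \<le> j" for j
  proof (cases "i \<le> j")
    case True
    then obtain k where k: "j = i + k" using le_Suc_ex by blast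
    have "\<kappa> * 4 ^ j = 4 ^ k" by (simp add: \<kappa>_def k power_add power_divide)
    then show ?thesis using grow[of k] k by simp
  next
    case False
    then have "(4 :: real) ^ j \<le> 4 ^ i" by (intro power_increasing) simp_all
    then have "\<kappa> * 4 ^ j \<le> 1" by (simp add: \<kappa>_def power_divide)
    then show ?thesis using N_ge1[OF j] by simp
  qed
  have "\<exists>\<rho> C \<delta>. sized_data m \<xi> y0 y1 y2 \<epsilon> \<rho> C \<delta>"
  proof (rule sized_data_exists[where N = N and K = c0 and \<kappa> = \<kappa>])
    fix i :: nat assume i: "1 \<le> i"
    show "\<bar>err (c1 i)\<bar> * N i \<le> c0" "\<bar>err (c2 i)\<bar> * N i \<le> c0"
      using e1[OF i] e2[OF i] c0_ge by simp_all
    show "\<bar>y0 i\<bar> \<le> N i" using w_N[of i 1 2] sg1[of i] by (simp add: y0_def abs_mult)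
  qed (use m1 c0_ge N_le N_grow in \<open>simp_all add: \<kappa>_def\<close>)
  then show ?thesis using that by blast
qed

section \<open>Comparison of the two maps\<close>

context sym_data
begin

lemma om_linear: "om (a *\<^sub>R e + b *\<^sub>R e') n = a *\<^sub>R om e n + b *\<^sub>R om e' n"
proof (induction n rule: less_induct)
  case (less n)
  show ?case
  proof (cases "n = 0")
    case False
    then have "om (a *\<^sub>R e + b *\<^sub>R e') (n - F (ix n)) = a *\<^sub>R om e (n - F (ix n)) + b *\<^sub>R om e' (n - F (ix n))"
      using less.IH[of "n - F (ix n)"] F_pos[of "ix n"] by simp
    then show ?thesis using False by (subst (1 2 3) om.simps) (simp add: W_linear)
  qed (simp add: om_0)
qed

lemma om_eq_0: "om e n = 0 \<Longrightarrow> e = 0"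
proof (induction n rule: less_induct)
  case (less n)
  show ?case
  proof (cases "n = 0")
    case False
    then have "W (ix n) (om e (n - F (ix n))) = 0" using less.prems by (subst (asm) om.simps) simp
    then have "om e (n - F (ix n)) = 0" using W_eq_0 ix_ge_1[of n] False by simp
    then show ?thesis using less.IH[of "n - F (ix n)"] F_pos[of "ix n"] False by simp
  qed (use less.prems in \<open>simp add: om_0\<close>)
qed

definition point :: "real \<times> real \<Rightarrow> real \<Rightarrow> real^3" where
  "point p x = vector [fst p, snd p, x]"

lemma mem_L_solutions_point:
  assumes "fst p \<in> \<int>" "snd p \<in> \<int>" "x \<in> \<int>" "\<bar>fst p\<bar> \<le> exp t" "\<bar>err p\<bar> \<le> exp (t - q $ 1)"
    "\<bar>\<xi>\<^sup>2 * fst p - x\<bar> \<le> exp (t - q $ 2)"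
  shows "point p x \<in> L_solutions (vector [1, \<xi>, \<xi>\<^sup>2]) q t"
  using assms by (simp add: L_solutions_def point_def err_def forall_3 vector_3 mult.commute)

lemma point_combination_eq_0:
  "a *\<^sub>R point p x + b *\<^sub>R point p' x' + c *\<^sub>R point p'' x'' = 0 \<longleftrightarrow>
     a *\<^sub>R p + b *\<^sub>R p' + c *\<^sub>R p'' = 0 \<and> a * x + b * x' + c * x'' = 0"
  by (auto simp: point_def vec_eq_iff forall_3 vector_3 prod_eq_iff)

end

lemma Phi_scale:
  assumes "0 < \<rho>"
  shows "\<rho> *\<^sub>R Phi (vector [a, b, c]) = Phi (vector [\<rho> * a, \<rho> * b, \<rho> * c])"
proof -
  have "sort (map ((*) \<rho>) [a, b, c]) = map ((*) \<rho>) (sort [a, b, c])"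
  proof (rule properties_for_sort)
    have "sorted_wrt (\<lambda>x y. \<rho> * x \<le> \<rho> * y) (sort [a, b, c])"
      using sorted_sort[of "[a, b, c]"] by (rule sorted_wrt_mono_rel[rotated]) (use assms in simp)
    then show "sorted (map ((*) \<rho>) (sort [a, b, c]))" by (simp only: sorted_wrt_map)
  qed (simp only: mset_map mset_sort)
  moreover have "length (sort [a, b, c]) = Suc (Suc (Suc 0))" by (simp only: length_sort list.size add_0 add_Suc_right)
  then obtain x y z where "sort [a, b, c] = [x, y, z]" unfolding length_Suc_conv length_0_conv by blast
  ultimately show ?thesis
    by (simp add: Phi_def vec_eq_iff forall_3 vector_3 del: sort_key_simps)
qed

context sized_data
begin

lemma point_bounds:
  obtains K where "1 \<le> K" "\<And>n. \<bar>fst (pt n)\<bar> \<le> K * exp (\<rho> * n)" "\<And>n. \<bar>err (pt n)\<bar> \<le> K * exp (- \<rho> * n)"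
    "\<And>n. \<bar>D n\<bar> \<le> K * exp (- \<rho> * al n)"
    "\<And>n. \<bar>fst (om (1, 0) n)\<bar> \<le> K * exp (\<rho> * n)" "\<And>n. \<bar>err (om (1, 0) n)\<bar> \<le> K * exp (- \<rho> * n)"
proof -
  obtain K1 where K1: "0 \<le> K1" "\<And>n. \<bar>fst (pt n)\<bar> \<le> K1 * exp (\<rho> * n)"
    "\<And>n. \<bar>err (pt n)\<bar> \<le> K1 * exp (- \<rho> * n)"
    by (rule om_bounds[of "(0, 1)"]) blast
  obtain K2 where K2: "0 \<le> K2" "\<And>n. \<bar>D n\<bar> \<le> K2 * exp (- \<rho> * al n)"
    by (rule D_bound) blast
  obtain K3 where K3: "0 \<le> K3" "\<And>n. \<bar>fst (om (1, 0) n)\<bar> \<le> K3 * exp (\<rho> * n)"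
    "\<And>n. \<bar>err (om (1, 0) n)\<bar> \<le> K3 * exp (- \<rho> * n)"
    by (rule om_bounds[of "(1, 0)"]) blast
  have weaken: "x \<le> (1 + K1 + K2 + K3) * exp y" if "x \<le> L * exp y" "L \<le> K1 + K2 + K3" for x y L :: real
  proof -
    have "L * exp y \<le> (1 + K1 + K2 + K3) * exp y" using that(2) by (intro mult_right_mono) simp_all
    with that(1) show ?thesis by (rule order_trans)
  qed
  show ?thesis
    by (rule that[of "1 + K1 + K2 + K3"]; (rule weaken, (rule K1 K2 K3))?)
       (use K1(1) K2(1) K3(1) in simp_all)
qed

lemma L_map_P_map_close:
  "\<exists>c > 0. \<forall>q \<in> A_set []. infnorm (L_map (vector [1, \<xi>, \<xi>\<^sup>2]) q - \<rho> *\<^sub>R P_map (inverse \<rho> *\<^sub>R q)) \<le> c"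
proof -
  obtain K where K: "1 \<le> K" "\<And>n. \<bar>fst (pt n)\<bar> \<le> K * exp (\<rho> * n)" "\<And>n. \<bar>err (pt n)\<bar> \<le> K * exp (- \<rho> * n)"
    "\<And>n. \<bar>D n\<bar> \<le> K * exp (- \<rho> * al n)"
    "\<And>n. \<bar>fst (om (1, 0) n)\<bar> \<le> K * exp (\<rho> * n)" "\<And>n. \<bar>err (om (1, 0) n)\<bar> \<le> K * exp (- \<rho> * n)"
    by (rule point_bounds) blast
  define L where "L = ln K"
  have lnK: "0 \<le> L" "exp L = K" using K(1) by (simp_all add: L_def)
  \<comment> \<open>L absorbs the constant K; the second summand absorbs the bounded case, whose
    losses of at most 25 per height fit within 50.\<close>
  define C1 where "C1 = L + \<rho> * 50"
  have C1: "0 \<le> C1" "\<rho> * 50 \<le> C1" using lnK rho by (simp_all add: C1_def)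
  have expK: "x \<le> exp y" if "x \<le> K * exp z" "z \<le> y - L" for x y z
  proof -
    have "K * exp z = exp (L + z)" using lnK by (simp add: exp_add)
    also have "\<dots> \<le> exp y" using that(2) by simp
    finally show ?thesis using that(1) by simp
  qed
  have "infnorm (L_map (vector [1, \<xi>, \<xi>\<^sup>2]) q - \<rho> *\<^sub>R P_map (inverse \<rho> *\<^sub>R q)) \<le> 2 * C1 + ln 6"
    if q: "q \<in> A_set []" for q
  proof -
    define q' where "q' = inverse \<rho> *\<^sub>R q"
    have qq: "q $ 1 = \<rho> * q' $ 1" "q $ 2 = \<rho> * q' $ 2" using rho by (simp_all add: q'_def)
    have "q' \<in> A_set []" using q rho by (auto simp: A_set_Nil q'_def mult_left_mono)
    then obtain n n' where b: "bracket (q' $ 1 / 2) (q' $ 1 - q' $ 2) n n'"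
      and P: "P_map q' = Phi (vector [q' $ 1 - real n, q' $ 2 + real n - real n', real n'])"
      by (rule P_map_bracket)
    define p1 where "p1 = \<rho> * (q' $ 1 - real n)"
    define p2 where "p2 = \<rho> * (q' $ 2 + real n - real n')"
    define p3 where "p3 = \<rho> * real n'"
    have P': "\<rho> *\<^sub>R P_map (inverse \<rho> *\<^sub>R q) = Phi (vector [p1, p2, p3])"
      unfolding q'_def[symmetric] P p1_def p2_def p3_def by (rule Phi_scale[OF rho])
    have sum: "p1 + p2 + p3 = q $ 1 + q $ 2"
      by (simp add: p1_def p2_def p3_def qq algebra_simps)
    have n: "real n \<le> q' $ 1 / 2" "real n - real (al n) \<le> q' $ 1 - q' $ 2"
      and n': "q' $ 1 / 2 \<le> real n'" "q' $ 2 \<le> real n' + real (al n')" "n < n'"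
      using b by (simp_all add: bracket_def excess_def reach_def)
    have sol: "point (pt v) (X2 v) \<in> L_solutions (vector [1, \<xi>, \<xi>\<^sup>2]) q (\<rho> * p + C1)"
      if "real v \<le> p" "q' $ 1 - real v \<le> p" "q' $ 2 - real (al v) \<le> p" for v p
    proof (rule mem_L_solutions_point)
      have "\<rho> * real v \<le> \<rho> * p" "\<rho> * (q' $ 1 - real v) \<le> \<rho> * p" "\<rho> * (q' $ 2 - real (al v)) \<le> \<rho> * p"
        using that rho by simp_all
      then have *: "\<rho> * real v \<le> \<rho> * p + C1 - L"
        "- \<rho> * real v \<le> \<rho> * p + C1 - q $ 1 - L" "- \<rho> * real (al v) \<le> \<rho> * p + C1 - q $ 2 - L"
        using rho unfolding C1_def qq right_diff_distrib mult_minus_left by linarith+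
      show "\<bar>fst (pt v)\<bar> \<le> exp (\<rho> * p + C1)"
        by (rule expK[OF K(2) *(1)])
      show "\<bar>err (pt v)\<bar> \<le> exp (\<rho> * p + C1 - q $ 1)"
        by (rule expK[OF K(3) *(2)])
      show "\<bar>\<xi>\<^sup>2 * fst (pt v) - X2 v\<bar> \<le> exp (\<rho> * p + C1 - q $ 2)"
        by (rule expK[OF K(4)[unfolded D_def] *(3)])
    qed (use om_Ints[of "(0, 1)" v] X2_Ints in simp_all)
    have "linked lin_indep n n' \<or> n' \<le> n + 25 \<and> q' $ 1 / 2 - (q' $ 1 - q' $ 2) \<le> 25"
      by (rule linked_or_small[OF b])
    then show ?thesis
    proof
      assume "linked lin_indep n n'"
      then obtain v where v: "n < v" "v < n'" "n' \<le> n + al v" "lin_indep n v n'"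
        by (auto simp: linked_def)
      have gap: "real n' - real n \<le> real (al v)" using v(3) by simp
      \<comment> \<open>If v is at most q_1 / 2, maximality of n shows that its excess is too large;
        if v is larger, minimality of n' shows that its reach is too small. Combined with n' - n
        \<le> \<open>al v\<close>, either fact gives both inequalities.\<close>
      have "real v \<le> q' $ 2 + real n - real n' \<and> q' $ 1 - real v \<le> q' $ 2 + real n - real n'"
      proof (cases "real v \<le> q' $ 1 / 2")
        case True
        then have "q' $ 1 - q' $ 2 < real v - real (al v)"
          using b v(1) by (simp add: bracket_def excess_def)
        then show ?thesis using gap True by simp
      next
        case False
        then have "real v + real (al v) < q' $ 2"
          using b v(1,2) by (simp add: bracket_def reach_def)
        then show ?thesis using gap False by simp
      qed
      then have solv: "point (pt v) (X2 v) \<in> L_solutions (vector [1, \<xi>, \<xi>\<^sup>2]) q (p2 + C1)"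
        unfolding p2_def using gap by (intro sol) simp_all
      have soln: "point (pt n) (X2 n) \<in> L_solutions (vector [1, \<xi>, \<xi>\<^sup>2]) q (p1 + C1)"
        unfolding p1_def using n by (intro sol) simp_all
      have soln': "point (pt n') (X2 n') \<in> L_solutions (vector [1, \<xi>, \<xi>\<^sup>2]) q (p3 + C1)"
        unfolding p3_def using n' by (intro sol) simp_all
      have "\<alpha> = 0 \<and> \<beta> = 0 \<and> \<gamma> = 0"
        if "\<alpha> *\<^sub>R point (pt n) (X2 n) + \<beta> *\<^sub>R point (pt v) (X2 v) + \<gamma> *\<^sub>R point (pt n') (X2 n') = 0" for \<alpha> \<beta> \<gamma>
        using v(4) that unfolding point_combination_eq_0 lin_indep_def by blast
      then show ?thesis unfolding P' by (rule L_map_close[OF _ soln solv soln' sum C1(1)])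
    next
      assume small: "n' \<le> n + 25 \<and> q' $ 1 / 2 - (q' $ 1 - q' $ 2) \<le> 25"
      then have s: "real n' \<le> real n + 25" "q' $ 2 \<le> q' $ 1 / 2 + 25" by simp_all
      \<comment> \<open>The companion of \<open>pt n\<close>: the same invertible product applied to
        the other unit vector, hence independent of \<open>pt n\<close> and of comparable
        size.\<close>
      define e where "e = om (1, 0) n"
      let ?r = "\<lambda>p. real_of_int (round (\<xi>\<^sup>2 * fst p))"
      have round: "\<bar>\<xi>\<^sup>2 * fst p - ?r p\<bar> \<le> exp t" if "0 \<le> t" for p :: "real \<times> real" and t
      proof -
        have "\<bar>\<xi>\<^sup>2 * fst p - ?r p\<bar> \<le> 1" using of_int_round_abs_le[of "\<xi>\<^sup>2 * fst p"] by linarith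
        also have "1 \<le> exp t" using that by simp
        finally show ?thesis .
      qed
      have mono: "\<rho> * x \<le> \<rho> * y" if "x \<le> y" for x y using that rho by simp
      have X: "point (pt n) (?r (pt n)) \<in> L_solutions (vector [1, \<xi>, \<xi>\<^sup>2]) q (p1 + C1)"
      proof (rule mem_L_solutions_point)
        show "\<bar>fst (pt n)\<bar> \<le> exp (p1 + C1)"
          by (rule expK[OF K(2)]) (use mono[of "real n" "q' $ 1 - real n + 50"] n in \<open>simp add: p1_def C1_def algebra_simps\<close>)
        show "\<bar>err (pt n)\<bar> \<le> exp (p1 + C1 - q $ 1)"
          by (rule expK[OF K(3)]) (use rho in \<open>simp add: p1_def C1_def qq algebra_simps\<close>)
        show "\<bar>\<xi>\<^sup>2 * fst (pt n) - ?r (pt n)\<bar> \<le> exp (p1 + C1 - q $ 2)"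
          by (rule round) (use mono[of "q' $ 2" "q' $ 1 - real n + 50"] n s lnK in \<open>simp add: p1_def C1_def qq algebra_simps\<close>)
      qed (use om_Ints[of "(0, 1)" n] in simp_all)
      have Y: "point e (?r e) \<in> L_solutions (vector [1, \<xi>, \<xi>\<^sup>2]) q (p3 + C1)"
      proof (rule mem_L_solutions_point)
        show "\<bar>fst e\<bar> \<le> exp (p3 + C1)"
          unfolding e_def
          by (rule expK[OF K(5)]) (use mono[of "real n" "real n' + 50"] n' in \<open>simp add: p3_def C1_def algebra_simps\<close>)
        show "\<bar>err e\<bar> \<le> exp (p3 + C1 - q $ 1)"
          unfolding e_def
          by (rule expK[OF K(6)])
             (use mono[of "- real n" "real n' - q' $ 1 + 50"] n' s in \<open>simp add: p3_def C1_def qq algebra_simps\<close>)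
        show "\<bar>\<xi>\<^sup>2 * fst e - ?r e\<bar> \<le> exp (p3 + C1 - q $ 2)"
          by (rule round) (use mono[of "q' $ 2" "real n' + 50"] n' s lnK in \<open>simp add: p3_def C1_def qq algebra_simps\<close>)
      qed (use om_Ints[of "(1, 0)" n] in \<open>simp_all add: e_def\<close>)
      \<comment> \<open>This point satisfies the inequalities once t \<ge> q_2, and the predicted
        height q_2 + n - n', before scaling by \<rho>, is within 25 of that.\<close>
      have Z: "point (0, 0) 1 \<in> L_solutions (vector [1, \<xi>, \<xi>\<^sup>2]) q (p2 + C1)"
      proof (rule mem_L_solutions_point)
        have "0 \<le> p2 + C1 - q $ 2"
          using mono[of 0 "real n - real n' + 50"] s lnK by (simp add: p2_def C1_def qq algebra_simps)
        then show "\<bar>\<xi>\<^sup>2 * fst (0, 0) - 1\<bar> \<le> exp (p2 + C1 - q $ 2)" by simp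
      qed (simp_all add: err_def)
      have "\<alpha> = 0 \<and> \<beta> = 0 \<and> \<gamma> = 0"
        if "\<alpha> *\<^sub>R point (pt n) (?r (pt n)) + \<beta> *\<^sub>R point (0, 0) 1 + \<gamma> *\<^sub>R point e (?r e) = 0" for \<alpha> \<beta> \<gamma>
      proof -
        have rel: "\<alpha> *\<^sub>R pt n + \<gamma> *\<^sub>R om (1, 0) n = 0" "\<alpha> * ?r (pt n) + \<beta> * 1 + \<gamma> * ?r e = 0"
          using that unfolding point_combination_eq_0 e_def by (simp_all add: zero_prod_def[symmetric])
        from rel(1) have "om (\<alpha> *\<^sub>R (0, 1) + \<gamma> *\<^sub>R (1, 0)) n = 0" by (simp only: om_linear)
        then have "\<alpha> *\<^sub>R (0, 1) + \<gamma> *\<^sub>R (1, 0) = (0 :: real \<times> real)" by (rule om_eq_0)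
        then have "\<alpha> = 0" "\<gamma> = 0" by (simp_all add: prod_eq_iff)
        then show ?thesis using rel(2) by simp
      qed
      then show ?thesis unfolding P' by (rule L_map_close[OF _ X Z Y sum C1(1)])
    qed
  qed
  moreover have "0 < 2 * C1 + ln (6 :: real)" using C1(1) by (simp add: add_nonneg_pos)
  ultimately show ?thesis by blast
qed

end

theorem theorem3p3:
  fixes m :: int and \<xi> :: real
  assumes "m \<ge> 1" and "\<xi> \<in> E_set m"
  shows "\<exists>\<rho> > 0. \<exists>c > 0. \<forall>q \<in> A_set [].
    infnorm (L_map (vector [1, \<xi>, \<xi>\<^sup>2]) q - \<rho> *\<^sub>R P_map (inverse \<rho> *\<^sub>R q)) \<le> c"
proof -
  obtain y0 y1 y2 \<epsilon> \<rho> C \<delta> where "sized_data (real_of_int m) \<xi> y0 y1 y2 \<epsilon> \<rho> C \<delta>"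
    using E_set_sized_data[OF assms] by blast
  then interpret sized_data "real_of_int m" \<xi> y0 y1 y2 \<epsilon> \<rho> C \<delta> .
  show ?thesis using rho L_map_P_map_close by blast
qed

end
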